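(* Let $X=(X_1,X_2)$ be a $2$-dimensional affine process with finite and irreducible state space $E\subset\mathbb R^2$ whose affine span is all of $\mathbb R^2$. Assume $X$ has no autonomous components, in the sense that no nonzero linear combination $a_1X_1+a_2X_2$ of the components of $X$ is itself an affine process. Then, up to an invertible affine transformation (i.e. after replacing $X$, $E$ and the jump kernel $F$ by those of $T(X)$ for some invertible affine map $T\colon\mathbb R^2\to\mathbb R^2$), one has $E=\{x\in\mathbb N^2\colon x_1+x_2\le N\}$ for some $N\in\mathbb N$, and $$F(x,\cdot)=x_1\left(\lambda_1\delta_{(-1,0)}+\lambda_2\delta_{(-1,1)}\right)+x_2\left(\lambda_3\delta_{(0,-1)}+\lambda_4\delta_{(1,-1)}\right)+(N-x_1-x_2)\left(\lambda_5\delta_{(1,0)}+\lambda_6\delta_{(0,1)}\right),\quad x\in E,$$ for some $\lambda_1,\ldots,\lambda_6\in\mathbb R_+$.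
   Context: Setting. $(\Omega,\mathcal F)$ is a measurable space with a right-continuous filtration $(\mathcal F_t)_{t\ge0}$; $d\ge1$ (here $d=2$); $E\subseteq\mathbb R^d$ is nonempty and measurable (the state space); $X=(X_t)_{t\ge0}$ is a càdlàg adapted process with values in $E$, with the convention $X_{0-}=X_0$; $(\mathbb P_x)_{x\in E}$ is a family of probability measures on $\mathcal F$ such that for each $x\in E$, $X$ is a $\mathbb P_x$-semimartingale with $\mathbb P_x(X_0=x)=1$. Notation: $\mathbb N=\{0,1,2,\ldots\}$; $\mathbb R_+=[0,\infty)$; $\delta_x$ is the Dirac measure at $x$; $\mathbb S^d$ is the set of symmetric $d\times d$ matrices; $\mathfrak M^d_*$ is the vector space of all signed Radon measures on $\mathbb R^d\setminus\{0\}$, i.e. set functions $\mu_+-\mu_-$ with $\mu_\pm$ positive measures on $\mathbb R^d\setminus\{0\}$ that assign finite mass to compact subsets. Affine process. $X$ is affine with triplet $(b,c,F)$ if $b\colon\mathbb R^d\to\mathbb R^d$, $c\colon\mathbb R^d\to\mathbb S^d$, $F\colon\mathbb R^d\to\mathfrak M^d_*$ are affine maps such that for each $x\in E$: $c(x)$ is positive semidefinite, $F(x,d\xi)$ is a positive measure on $\mathbb R^d\setminus\{0\}$ with $\int(\|\xi\|^2\wedge1)F(x,d\xi)<\infty$, and the semimartingale characteristics $(B,C,\nu)$ of $X$ under $\mathbb P_x$ are $B_t=\int_0^tb(X_{s-})ds$, $C_t=\int_0^tc(X_{s-})ds$, $\nu(dt,d\xi)=F(X_{t-},d\xi)dt$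 (the choice of truncation function is irrelevant). For an affine image $Y=f(X)$ of $X$, where $f\colon\mathbb R^d\to\mathbb R^m$ is affine, being an affine process (with state space $f(E)$) means that there are affine maps $b^Y\colon\mathbb R^m\to\mathbb R^m$, $c^Y\colon\mathbb R^m\to\mathbb S^m$, $F^Y\colon\mathbb R^m\to\mathfrak M^m_*$ such that for each $y\in f(E)$, $c^Y(y)$ is positive semidefinite and $F^Y(y,d\eta)$ is a positive measure on $\mathbb R^m\setminus\{0\}$ with $\int(\|\eta\|^2\wedge1)F^Y(y,d\eta)<\infty$, and under every $\mathbb P_x$, $x\in E$, the semimartingale characteristics $(B^Y,C^Y,\nu^Y)$ of $Y$ are $B^Y_t=\int_0^tb^Y(Y_{s-})ds$, $C^Y_t=\int_0^tc^Y(Y_{s-})ds$, $\nu^Y(dt,d\eta)=F^Y(Y_{t-},d\eta)dt$. For an invertible affine map $T$, the transformed process $T(X)$ is affine with state space $T(E)$ and jump kernel $B\mapsto F(T^{-1}(y),\{\xi\colon T(\xi)-T(0)\in B\})$, $y\in T(E)$. $X$ has irreducible state space if for every $x\in E$, $X$ has positive $\mathbb P_x$-probability of eventually reaching any other state $y\in E$. *)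

theory Defs
  imports "HOL-Probability.Probability"
begin

section \<open>Signed Radon measures away from the origin\<close>

text \<open>A measure on the punctured space is encoded as a Borel measure on the whole space that
  gives no mass to the origin.\<close>

definition punctured_radon :: "'a::euclidean_space measure \<Rightarrow> bool" where
  "punctured_radon \<mu> \<longleftrightarrow> sets \<mu> = sets borel \<and> emeasure \<mu> {0} = 0 \<and>
     (\<forall>K. compact K \<and> 0 \<notin> K \<longrightarrow> emeasure \<mu> K < \<infinity>)"

definition punctured_bounded :: "'a::euclidean_space set \<Rightarrow> bool" where
  "punctured_bounded B \<longleftrightarrow> B \<in> sets borel \<and> (\<exists>K. compact K \<and> 0 \<notin> K \<and> B \<subseteq> K)"

lemma punctured_radon_finite:
  assumes "punctured_radon \<mu>" "punctured_bounded B"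
  shows "emeasure \<mu> B < \<infinity>"
proof -
  obtain K where K: "compact K" "0 \<notin> K" "B \<subseteq> K"
    using assms(2) by (auto simp: punctured_bounded_def)
  have "K \<in> sets \<mu>"
    using K assms(1) by (auto simp: punctured_radon_def borel_compact)
  then have "emeasure \<mu> B \<le> emeasure \<mu> K"
    by (rule emeasure_mono[OF K(3)])
  also have "\<dots> < \<infinity>"
    using K assms(1) by (auto simp: punctured_radon_def)
  finally show ?thesis .
qed

lemma punctured_radon_null: "punctured_radon (null_measure borel)"
  by (simp add: punctured_radon_def)

lemma punctured_radon_scale:
  "punctured_radon \<mu> \<Longrightarrow> punctured_radon (scale_measure (ennreal r) \<mu>)"
  by (auto simp: punctured_radon_def ennreal_mult_less_top)

lemma punctured_radon_add:
  assumes "punctured_radon \<mu>" "punctured_radon \<nu>"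
  obtains \<rho> where "punctured_radon \<rho>"
    "\<And>B. B \<in> sets borel \<Longrightarrow> emeasure \<rho> B = emeasure \<mu> B + emeasure \<nu> B"
proof -
  define \<rho> where "\<rho> = measure_of UNIV (sets borel) (\<lambda>B. emeasure \<mu> B + emeasure \<nu> B)"
  have sb: "sets \<mu> = sets borel" "sets \<nu> = sets borel"
    using assms by (auto simp: punctured_radon_def)
  have s: "sets \<rho> = sets borel"
    unfolding \<rho>_def using sets.sigma_sets_eq[of borel] by simp
  have e: "emeasure \<rho> B = emeasure \<mu> B + emeasure \<nu> B" if "B \<in> sets borel" for B
    unfolding \<rho>_def
  proof (rule emeasure_measure_of_sigma)
    show "sigma_algebra UNIV (sets (borel :: 'a measure))"
      using sets.sigma_algebra_axioms[of borel] by simp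
    show "positive (sets borel) (\<lambda>B. emeasure \<mu> B + emeasure \<nu> B)"
      by (simp add: positive_def)
    show "countably_additive (sets borel) (\<lambda>B. emeasure \<mu> B + emeasure \<nu> B)"
      using sb
      by (auto intro!: countably_additiveI
               simp: suminf_add[symmetric] suminf_emeasure image_subset_iff)
  qed (use that in auto)
  have "punctured_radon \<rho>"
    using assms s by (auto simp: punctured_radon_def e borel_compact)
  then show thesis using e that by blast
qed

text \<open>The difference of two Radon measures need not be defined on sets on which both are infinite.
  A signed Radon measure is therefore a set function on the Borel subsets of compact subsets of
  the punctured space; it is extended by 0 to all other sets.\<close>

definition radon_difference :: "'a::euclidean_space measure \<Rightarrow> 'a measure \<Rightarrow> 'a set \<Rightarrow> real" where
  "radon_difference \<mu> \<nu> = (\<lambda>B. if punctured_bounded B then measure \<mu> B - measure \<nu> B else 0)"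

typedef (overloaded) 'a signed_radon =
  "{m :: 'a::euclidean_space set \<Rightarrow> real.
     \<exists>\<mu> \<nu>. punctured_radon \<mu> \<and> punctured_radon \<nu> \<and> m = radon_difference \<mu> \<nu>}"
  morphisms signed_value Abs_signed_radon
  using punctured_radon_null by blast

setup_lifting type_definition_signed_radon

lemma measure_add_punctured:
  assumes "punctured_radon \<mu>" "punctured_radon \<nu>" "punctured_bounded B"
    and "emeasure \<rho> B = emeasure \<mu> B + emeasure \<nu> B"
  shows "measure \<rho> B = measure \<mu> B + measure \<nu> B"
  using assms punctured_radon_finite[of \<mu> B] punctured_radon_finite[of \<nu> B]
  by (auto simp: measure_def enn2real_plus)

instantiation signed_radon :: (euclidean_space) real_vector
begin

lift_definition zero_signed_radon :: "'a signed_radon" is "\<lambda>_. 0"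
proof -
  have "(\<lambda>_. 0) = radon_difference (null_measure borel) (null_measure (borel :: 'a measure))"
    by (auto simp: radon_difference_def measure_def)
  then show "\<exists>\<mu> \<nu> :: 'a measure. punctured_radon \<mu> \<and> punctured_radon \<nu> \<and>
      (\<lambda>_. 0) = radon_difference \<mu> \<nu>"
    using punctured_radon_null by blast
qed

lift_definition plus_signed_radon :: "'a signed_radon \<Rightarrow> 'a signed_radon \<Rightarrow> 'a signed_radon"
  is "\<lambda>m n B. m B + n B"
proof -
  fix m n :: "'a set \<Rightarrow> real"
  assume "\<exists>\<mu> \<nu>. punctured_radon \<mu> \<and> punctured_radon \<nu> \<and> m = radon_difference \<mu> \<nu>"
    and "\<exists>\<mu> \<nu>. punctured_radon \<mu> \<and> punctured_radon \<nu> \<and> n = radon_difference \<mu> \<nu>"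
  then obtain \<mu>1 \<nu>1 \<mu>2 \<nu>2 where *: "punctured_radon \<mu>1" "punctured_radon \<nu>1"
      "punctured_radon \<mu>2" "punctured_radon \<nu>2"
      "m = radon_difference \<mu>1 \<nu>1" "n = radon_difference \<mu>2 \<nu>2"
    by blast
  obtain \<mu> where \<mu>: "punctured_radon \<mu>"
      "\<And>B. B \<in> sets borel \<Longrightarrow> emeasure \<mu> B = emeasure \<mu>1 B + emeasure \<mu>2 B"
    using punctured_radon_add[OF *(1,3)] by blast
  obtain \<nu> where \<nu>: "punctured_radon \<nu>"
      "\<And>B. B \<in> sets borel \<Longrightarrow> emeasure \<nu> B = emeasure \<nu>1 B + emeasure \<nu>2 B"
    using punctured_radon_add[OF *(2,4)] by blast
  have "m B + n B = radon_difference \<mu> \<nu> B" for B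
  proof (cases "punctured_bounded B")
    case True
    then have "B \<in> sets borel" by (simp add: punctured_bounded_def)
    then show ?thesis
      using True measure_add_punctured[OF *(1,3) True \<mu>(2)]
        measure_add_punctured[OF *(2,4) True \<nu>(2)]
      by (simp add: * radon_difference_def)
  qed (simp add: * radon_difference_def)
  then show "\<exists>\<mu> \<nu>. punctured_radon \<mu> \<and> punctured_radon \<nu> \<and>
      (\<lambda>B. m B + n B) = radon_difference \<mu> \<nu>"
    using \<mu> \<nu> by blast
qed

lift_definition scaleR_signed_radon :: "real \<Rightarrow> 'a signed_radon \<Rightarrow> 'a signed_radon"
  is "\<lambda>r m B. r * m B"
proof -
  fix r :: real and m :: "'a set \<Rightarrow> real"
  assume "\<exists>\<mu> \<nu>. punctured_radon \<mu> \<and> punctured_radon \<nu> \<and> m = radon_difference \<mu> \<nu>"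
  then obtain \<mu> \<nu> where *: "punctured_radon \<mu>" "punctured_radon \<nu>" "m = radon_difference \<mu> \<nu>"
    by blast
  let ?s = "scale_measure (ennreal \<bar>r\<bar>)"
  have "(\<lambda>B. r * m B) = (if r \<ge> 0 then radon_difference (?s \<mu>) (?s \<nu>)
      else radon_difference (?s \<nu>) (?s \<mu>))"
    by (auto simp: * radon_difference_def fun_eq_iff algebra_simps)
  then show "\<exists>\<mu> \<nu>. punctured_radon \<mu> \<and> punctured_radon \<nu> \<and>
      (\<lambda>B. r * m B) = radon_difference \<mu> \<nu>"
    using punctured_radon_scale[OF *(1)] punctured_radon_scale[OF *(2)] by metis
qed

definition uminus_signed_radon :: "'a signed_radon \<Rightarrow> 'a signed_radon" where
  "- m = (- 1 :: real) *\<^sub>R m" for m :: "'a signed_radon"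

definition minus_signed_radon :: "'a signed_radon \<Rightarrow> 'a signed_radon \<Rightarrow> 'a signed_radon" where
  "m - n = m + (- n)" for m n :: "'a signed_radon"

instance
  by standard
    (simp_all add: minus_signed_radon_def uminus_signed_radon_def,
      (transfer; simp add: fun_eq_iff algebra_simps)+)

end

definition represents :: "'a::euclidean_space measure \<Rightarrow> 'a signed_radon \<Rightarrow> bool" where
  "represents \<mu> m \<longleftrightarrow> punctured_radon \<mu> \<and>
     (\<forall>B. punctured_bounded B \<longrightarrow> signed_value m B = measure \<mu> B)"

lemma represents_unique:
  assumes "represents \<mu> m" "represents \<nu> m"
  shows "\<mu> = \<nu>"
proof -
  define A :: "nat \<Rightarrow> 'a set"
    where "A n = {x. inverse (real (Suc n)) \<le> norm x \<and> norm x \<le> real n}" for n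
  have cA: "compact (A n)" for n
  proof -
    have "A n = cball 0 (real n) \<inter> {x. inverse (real (Suc n)) \<le> norm x}"
      by (auto simp: A_def dist_norm)
    moreover have "closed {x :: 'a. inverse (real (Suc n)) \<le> norm x}"
      by (intro closed_Collect_le continuous_intros)
    ultimately show ?thesis by (simp add: compact_Int_closed)
  qed
  have zA: "0 \<notin> A n" for n by (simp add: A_def)
  have sA: "A n \<in> sets borel" for n using cA by (simp add: borel_compact)
  have inc: "incseq A"
  proof (rule incseq_SucI, rule subsetI)
    fix n x assume "x \<in> A n"
    moreover have "inverse (real (Suc (Suc n))) \<le> inverse (real (Suc n))"
      by (rule le_imp_inverse_le) auto
    ultimately show "x \<in> A (Suc n)"
      unfolding A_def mem_Collect_eq of_nat_Suc by linarith
  qed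
  have U: "(\<Union>n. A n) = - {0}"
  proof -
    have "\<exists>n. x \<in> A n" if x: "x \<noteq> 0" for x
    proof -
      obtain n where n: "inverse (real (Suc n)) < norm x"
        using reals_Archimedean[of "norm x"] x by auto
      obtain k where k: "norm x \<le> real k"
        using real_arch_simple by blast
      have "inverse (real (Suc (max n k))) \<le> inverse (real (Suc n))"
        by (simp add: field_simps)
      then have "x \<in> A (max n k)"
        using n k unfolding A_def mem_Collect_eq by linarith
      then show ?thesis ..
    qed
    then show ?thesis using zA by auto
  qed
  have sets: "sets \<mu> = sets borel" "sets \<nu> = sets borel"
    and rad: "punctured_radon \<mu>" "punctured_radon \<nu>"
    using assms by (auto simp: represents_def punctured_radon_def)
  have fin: "emeasure \<mu> (B \<inter> A n) = emeasure \<nu> (B \<inter> A n)" if "B \<in> sets borel" for B n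
  proof -
    have pb: "punctured_bounded (B \<inter> A n)"
      using that cA zA sA by (auto simp: punctured_bounded_def)
    then have "measure \<mu> (B \<inter> A n) = measure \<nu> (B \<inter> A n)"
      using assms by (auto simp: represents_def)
    moreover have "emeasure \<mu> (B \<inter> A n) \<noteq> \<infinity>" "emeasure \<nu> (B \<inter> A n) \<noteq> \<infinity>"
      using punctured_radon_finite[OF rad(1) pb] punctured_radon_finite[OF rad(2) pb] by auto
    ultimately show ?thesis by (simp add: emeasure_eq_ennreal_measure)
  qed
  have lim: "emeasure \<rho> B = (SUP n. emeasure \<rho> (B \<inter> A n))"
    if "B \<in> sets borel" "punctured_radon \<rho>" for B \<rho>
  proof -
    have s: "sets \<rho> = sets borel" and z: "{0} \<in> null_sets \<rho>"
      using that(2) by (auto simp: punctured_radon_def null_sets_def)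
    have "(SUP n. emeasure \<rho> (B \<inter> A n)) = emeasure \<rho> (\<Union>n. B \<inter> A n)"
      using inc that sA s by (intro SUP_emeasure_incseq) (auto simp: incseq_def)
    also have "(\<Union>n. B \<inter> A n) = B - {0}" using U by auto
    also have "emeasure \<rho> (B - {0}) = emeasure \<rho> B"
      using z that s by (intro emeasure_Diff_null_set) auto
    finally show ?thesis by simp
  qed
  show ?thesis
    by (rule measure_eqI) (use sets fin lim rad in auto)
qed

definition radon_measure_of :: "'a::euclidean_space signed_radon \<Rightarrow> 'a measure" where
  "radon_measure_of m = (THE \<mu>. represents \<mu> m)"

lemma radon_measure_of_eqI: "represents \<mu> m \<Longrightarrow> radon_measure_of m = \<mu>"
  unfolding radon_measure_of_def by (blast intro: represents_unique)

definition levy_measure :: "'a::euclidean_space signed_radon \<Rightarrow> bool" where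
  "levy_measure m \<longleftrightarrow> (\<exists>\<mu>. represents \<mu> m) \<and>
     (\<integral>\<^sup>+ \<xi>. ennreal (min ((norm \<xi>)\<^sup>2) 1) \<partial>radon_measure_of m) < \<infinity>"

definition affine_map :: "('a::real_vector \<Rightarrow> 'b::real_vector) \<Rightarrow> bool" where
  "affine_map f \<longleftrightarrow> linear (\<lambda>x. f x - f 0)"


section \<open>Processes and local martingales\<close>

text \<open>Processes are indexed by \<open>real\<close>, but only times \<open>t \<ge> 0\<close> are ever referred to. The
  filtration is not assumed to be complete. Identities between processes that are only
  determined up to evanescence are required almost surely, for all times simultaneously.\<close>

definition right_continuous_filtration :: "'w measure \<Rightarrow> (real \<Rightarrow> 'w measure) \<Rightarrow> bool" where
  "right_continuous_filtration M Ft \<longleftrightarrow>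
     (\<forall>t\<ge>0. subalgebra M (Ft t)) \<and>
     (\<forall>s t. 0 \<le> s \<and> s \<le> t \<longrightarrow> sets (Ft s) \<subseteq> sets (Ft t)) \<and>
     (\<forall>t\<ge>0. sets (Ft t) = (\<Inter>u\<in>{t<..}. sets (Ft u)))"

definition adapted :: "(real \<Rightarrow> 'w measure) \<Rightarrow> (real \<Rightarrow> 'w \<Rightarrow> 'a::topological_space) \<Rightarrow> bool" where
  "adapted Ft X \<longleftrightarrow> (\<forall>t\<ge>0. X t \<in> borel_measurable (Ft t))"

definition cadlag :: "'w set \<Rightarrow> (real \<Rightarrow> 'w \<Rightarrow> 'a::t2_space) \<Rightarrow> bool" where
  "cadlag \<Omega> X \<longleftrightarrow> (\<forall>\<omega>\<in>\<Omega>.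
     (\<forall>t\<ge>0. continuous (at_right t) (\<lambda>s. X s \<omega>)) \<and>
     (\<forall>t>0. \<exists>l. ((\<lambda>s. X s \<omega>) \<longlongrightarrow> l) (at_left t)))"

definition left_limit :: "(real \<Rightarrow> 'w \<Rightarrow> 'a::t2_space) \<Rightarrow> real \<Rightarrow> 'w \<Rightarrow> 'a" where
  "left_limit X t \<omega> = (if t \<le> 0 then X 0 \<omega> else Lim (at_left t) (\<lambda>s. X s \<omega>))"

definition jump :: "(real \<Rightarrow> 'w \<Rightarrow> 'a::real_normed_vector) \<Rightarrow> real \<Rightarrow> 'w \<Rightarrow> 'a" where
  "jump X t \<omega> = X t \<omega> - left_limit X t \<omega>"

definition ext_stopping_time :: "(real \<Rightarrow> 'w measure) \<Rightarrow> ('w \<Rightarrow> ereal) \<Rightarrow> bool" where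
  "ext_stopping_time Ft \<tau> \<longleftrightarrow>
     (\<forall>\<omega>\<in>space (Ft 0). 0 \<le> \<tau> \<omega>) \<and> (\<forall>t\<ge>0. Measurable.pred (Ft t) (\<lambda>\<omega>. \<tau> \<omega> \<le> ereal t))"

definition stopped :: "('w \<Rightarrow> ereal) \<Rightarrow> (real \<Rightarrow> 'w \<Rightarrow> 'a) \<Rightarrow> real \<Rightarrow> 'w \<Rightarrow> 'a" where
  "stopped \<tau> X t \<omega> = X (real_of_ereal (min (ereal t) (\<tau> \<omega>))) \<omega>"

definition martingale :: "'w measure \<Rightarrow> (real \<Rightarrow> 'w measure) \<Rightarrow> (real \<Rightarrow> 'w \<Rightarrow> real) \<Rightarrow> bool" where
  "martingale P Ft Z \<longleftrightarrow> adapted Ft Z \<and> cadlag (space P) Z \<and> (\<forall>t\<ge>0. integrable P (Z t)) \<and>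
     (\<forall>s t. 0 \<le> s \<and> s \<le> t \<longrightarrow> (AE \<omega> in P. real_cond_exp P (Ft s) (Z t) \<omega> = Z s \<omega>))"

definition local_martingale ::
    "'w measure \<Rightarrow> (real \<Rightarrow> 'w measure) \<Rightarrow> (real \<Rightarrow> 'w \<Rightarrow> real) \<Rightarrow> bool" where
  "local_martingale P Ft Z \<longleftrightarrow> adapted Ft Z \<and> cadlag (space P) Z \<and>
     (\<exists>\<tau> :: nat \<Rightarrow> 'w \<Rightarrow> ereal.
        (\<forall>n. ext_stopping_time Ft (\<tau> n)) \<and>
        (AE \<omega> in P. incseq (\<lambda>n. \<tau> n \<omega>) \<and> (\<lambda>n. \<tau> n \<omega>) \<longlonglongrightarrow> \<infinity>) \<and>
        (\<forall>n. martingale P Ft (stopped (\<tau> n) Z)))"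

definition continuous_paths :: "'w set \<Rightarrow> (real \<Rightarrow> 'w \<Rightarrow> real) \<Rightarrow> bool" where
  "continuous_paths \<Omega> Z \<longleftrightarrow> (\<forall>\<omega>\<in>\<Omega>. continuous_on {0..} (\<lambda>t. Z t \<omega>))"

definition finite_variation_on :: "real \<Rightarrow> (real \<Rightarrow> real) \<Rightarrow> bool" where
  "finite_variation_on t a \<longleftrightarrow> (\<exists>V. \<forall>n (p :: nat \<Rightarrow> real).
     mono p \<and> 0 \<le> p 0 \<and> p n \<le> t \<longrightarrow> (\<Sum>i<n. \<bar>a (p (Suc i)) - a (p i)\<bar>) \<le> V)"

definition finite_variation_process ::
    "'w measure \<Rightarrow> (real \<Rightarrow> 'w measure) \<Rightarrow> (real \<Rightarrow> 'w \<Rightarrow> real) \<Rightarrow> bool" where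
  "finite_variation_process P Ft A \<longleftrightarrow> adapted Ft A \<and> cadlag (space P) A \<and>
     (\<forall>\<omega>\<in>space P. A 0 \<omega> = 0 \<and> (\<forall>t\<ge>0. finite_variation_on t (\<lambda>s. A s \<omega>)))"

definition semimartingale ::
    "'w measure \<Rightarrow> (real \<Rightarrow> 'w measure) \<Rightarrow> (real \<Rightarrow> 'w \<Rightarrow> real^'n) \<Rightarrow> bool" where
  "semimartingale P Ft X \<longleftrightarrow> adapted Ft X \<and> cadlag (space P) X \<and>
     (\<forall>i. \<exists>Z A. local_martingale P Ft Z \<and> (\<forall>\<omega>\<in>space P. Z 0 \<omega> = 0) \<and>
        finite_variation_process P Ft A \<and>
        (AE \<omega> in P. \<forall>t\<ge>0. X t \<omega> $ i = X 0 \<omega> $ i + Z t \<omega> + A t \<omega>))"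


section \<open>Semimartingale characteristics\<close>

text \<open>The predictable sigma-algebra is generated by the left-continuous adapted processes.\<close>

definition predictable_sigma :: "(real \<Rightarrow> 'w measure) \<Rightarrow> ('w \<times> real) measure" where
  "predictable_sigma Ft = sigma (space (Ft 0) \<times> {0..})
     {{(\<omega>, t) \<in> space (Ft 0) \<times> {0..}. H t \<omega> \<in> U} | (H :: real \<Rightarrow> 'w \<Rightarrow> real) U.
        adapted Ft H \<and> (\<forall>\<omega>\<in>space (Ft 0). \<forall>t>0. continuous (at_left t) (\<lambda>s. H s \<omega>)) \<and>
        U \<in> sets borel}"

definition predictable :: "(real \<Rightarrow> 'w measure) \<Rightarrow> (real \<Rightarrow> 'w \<Rightarrow> 'a::topological_space) \<Rightarrow> bool" where
  "predictable Ft H \<longleftrightarrow> (\<lambda>(\<omega>, t). H t \<omega>) \<in> borel_measurable (predictable_sigma Ft)"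

definition truncation :: "'a::real_normed_vector \<Rightarrow> 'a" where
  "truncation \<xi> = (if norm \<xi> \<le> 1 then \<xi> else 0)"

text \<open>\<open>X(h) = X - (\<Sum>s\<le>t. \<Delta>X s - h (\<Delta>X s))\<close> for the truncation function \<open>h\<close>. Only finitely many
  summands do not vanish when \<open>X\<close> is cadlag.\<close>

definition truncated_process ::
    "(real \<Rightarrow> 'w \<Rightarrow> 'a::real_normed_vector) \<Rightarrow> real \<Rightarrow> 'w \<Rightarrow> 'a" where
  "truncated_process X t \<omega> = X t \<omega> -
     (\<Sum>s\<in>{s\<in>{0<..t}. jump X s \<omega> \<noteq> truncation (jump X s \<omega>)}.
        jump X s \<omega> - truncation (jump X s \<omega>))"

text \<open>The predictable finite variation part in the canonical decomposition of the special
  semimartingale \<open>X(h)\<close>.\<close>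

definition first_characteristic ::
    "'w measure \<Rightarrow> (real \<Rightarrow> 'w measure) \<Rightarrow> (real \<Rightarrow> 'w \<Rightarrow> real^'n) \<Rightarrow> (real \<Rightarrow> 'w \<Rightarrow> real^'n) \<Rightarrow> bool"
  where
  "first_characteristic P Ft X B \<longleftrightarrow> (\<forall>i.
     finite_variation_process P Ft (\<lambda>t \<omega>. B t \<omega> $ i) \<and> predictable Ft (\<lambda>t \<omega>. B t \<omega> $ i) \<and>
     local_martingale P Ft (\<lambda>t \<omega>. truncated_process X t \<omega> $ i - X 0 \<omega> $ i - B t \<omega> $ i))"

definition purely_discontinuous ::
    "'w measure \<Rightarrow> (real \<Rightarrow> 'w measure) \<Rightarrow> (real \<Rightarrow> 'w \<Rightarrow> real) \<Rightarrow> bool" where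
  "purely_discontinuous P Ft Z \<longleftrightarrow> local_martingale P Ft Z \<and> (\<forall>\<omega>\<in>space P. Z 0 \<omega> = 0) \<and>
     (\<forall>N. local_martingale P Ft N \<and> continuous_paths (space P) N \<longrightarrow>
        local_martingale P Ft (\<lambda>t \<omega>. Z t \<omega> * N t \<omega>))"

definition continuous_martingale_part ::
    "'w measure \<Rightarrow> (real \<Rightarrow> 'w measure) \<Rightarrow> (real \<Rightarrow> 'w \<Rightarrow> real) \<Rightarrow> (real \<Rightarrow> 'w \<Rightarrow> real) \<Rightarrow> bool" where
  "continuous_martingale_part P Ft Y Yc \<longleftrightarrow>
     local_martingale P Ft Yc \<and> continuous_paths (space P) Yc \<and> (\<forall>\<omega>\<in>space P. Yc 0 \<omega> = 0) \<and>
     (\<exists>Z A. purely_discontinuous P Ft Z \<and> finite_variation_process P Ft A \<and>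
        (AE \<omega> in P. \<forall>t\<ge>0. Y t \<omega> = Y 0 \<omega> + Yc t \<omega> + Z t \<omega> + A t \<omega>))"

definition predictable_covariation ::
    "'w measure \<Rightarrow> (real \<Rightarrow> 'w measure) \<Rightarrow> (real \<Rightarrow> 'w \<Rightarrow> real) \<Rightarrow> (real \<Rightarrow> 'w \<Rightarrow> real) \<Rightarrow>
      (real \<Rightarrow> 'w \<Rightarrow> real) \<Rightarrow> bool" where
  "predictable_covariation P Ft Y Z A \<longleftrightarrow>
     finite_variation_process P Ft A \<and> predictable Ft A \<and>
     local_martingale P Ft (\<lambda>t \<omega>. Y t \<omega> * Z t \<omega> - A t \<omega>)"

definition second_characteristic ::
    "'w measure \<Rightarrow> (real \<Rightarrow> 'w measure) \<Rightarrow> (real \<Rightarrow> 'w \<Rightarrow> real^'n) \<Rightarrow> (real \<Rightarrow> 'w \<Rightarrow> real^'n^'n) \<Rightarrow> bool"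
  where
  "second_characteristic P Ft X C \<longleftrightarrow> (\<exists>Xc :: 'n \<Rightarrow> real \<Rightarrow> 'w \<Rightarrow> real.
     (\<forall>i. continuous_martingale_part P Ft (\<lambda>t \<omega>. X t \<omega> $ i) (Xc i)) \<and>
     (\<forall>i j. predictable_covariation P Ft (Xc i) (Xc j) (\<lambda>t \<omega>. C t \<omega> $ i $ j)))"

definition jump_measure :: "(real \<Rightarrow> 'w \<Rightarrow> 'a::euclidean_space) \<Rightarrow> 'w \<Rightarrow> (real \<times> 'a) measure" where
  "jump_measure X \<omega> =
     distr (count_space {t. 0 < t \<and> jump X t \<omega> \<noteq> 0}) borel (\<lambda>t. (t, jump X t \<omega>))"

definition random_integral ::
    "(('w \<times> real) \<times> 'a \<Rightarrow> ennreal) \<Rightarrow> ('w \<Rightarrow> (real \<times> 'a) measure) \<Rightarrow> real set \<Rightarrow> 'w \<Rightarrow> ennreal" where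
  "random_integral W \<mu> I \<omega> = (\<integral>\<^sup>+ (s, \<xi>). W ((\<omega>, s), \<xi>) * indicator I s \<partial>\<mu> \<omega>)"

text \<open>The predictable compensator of a random measure.\<close>

definition compensator ::
    "'w measure \<Rightarrow> (real \<Rightarrow> 'w measure) \<Rightarrow> ('w \<Rightarrow> (real \<times> 'a::euclidean_space) measure) \<Rightarrow>
      ('w \<Rightarrow> (real \<times> 'a) measure) \<Rightarrow> bool" where
  "compensator P Ft \<mu> \<nu> \<longleftrightarrow> (\<forall>\<omega>\<in>space P. sets (\<nu> \<omega>) = sets borel) \<and>
     (\<forall>W \<in> borel_measurable (predictable_sigma Ft \<Otimes>\<^sub>M borel).
        predictable Ft (\<lambda>t. random_integral W \<nu> {0..t}) \<and>
        (\<integral>\<^sup>+ \<omega>. random_integral W \<nu> {0..} \<omega> \<partial>P) = (\<integral>\<^sup>+ \<omega>. random_integral W \<mu> {0..} \<omega> \<partial>P))"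

definition semimartingale_characteristics ::
    "'w measure \<Rightarrow> (real \<Rightarrow> 'w measure) \<Rightarrow> (real \<Rightarrow> 'w \<Rightarrow> real^'n) \<Rightarrow>
      (real \<Rightarrow> 'w \<Rightarrow> real^'n) \<Rightarrow> (real \<Rightarrow> 'w \<Rightarrow> real^'n^'n) \<Rightarrow> ('w \<Rightarrow> (real \<times> (real^'n)) measure) \<Rightarrow> bool"
  where
  "semimartingale_characteristics P Ft X B C \<nu> \<longleftrightarrow> semimartingale P Ft X \<and>
     first_characteristic P Ft X B \<and> second_characteristic P Ft X C \<and>
     compensator P Ft (jump_measure X) \<nu>"


section \<open>Affine processes\<close>

definition stochastic_setting ::
    "'w measure \<Rightarrow> (real \<Rightarrow> 'w measure) \<Rightarrow> (real^'n \<Rightarrow> 'w measure) \<Rightarrow> (real^'n) set \<Rightarrow>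
      (real \<Rightarrow> 'w \<Rightarrow> real^'n) \<Rightarrow> bool" where
  "stochastic_setting M Ft P E X \<longleftrightarrow>
     right_continuous_filtration M Ft \<and> E \<in> sets borel \<and> E \<noteq> {} \<and>
     adapted Ft X \<and> cadlag (space M) X \<and> (\<forall>\<omega>\<in>space M. \<forall>t\<ge>0. X t \<omega> \<in> E) \<and>
     (\<forall>x\<in>E. prob_space (P x) \<and> sets (P x) = sets M \<and> semimartingale (P x) Ft X \<and>
        measure (P x) {\<omega>\<in>space M. X 0 \<omega> = x} = 1)"

text \<open>\<open>Q\<close> is the family of probability measures under which the characteristics of \<open>Y\<close>, a process
  with state space \<open>S\<close>, are prescribed. The last line says \<open>\<nu>(dt, d\<xi>) = F(Y(t-), d\<xi>) dt\<close>.\<close>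

definition affine_characteristics ::
    "(real \<Rightarrow> 'w measure) \<Rightarrow> 'w measure set \<Rightarrow> (real^'n) set \<Rightarrow> (real \<Rightarrow> 'w \<Rightarrow> real^'n) \<Rightarrow>
      (real^'n \<Rightarrow> real^'n) \<Rightarrow> (real^'n \<Rightarrow> real^'n^'n) \<Rightarrow> (real^'n \<Rightarrow> (real^'n) signed_radon) \<Rightarrow> bool"
  where
  "affine_characteristics Ft Q S Y b c F \<longleftrightarrow>
     affine_map b \<and> affine_map c \<and> affine_map F \<and> (\<forall>y. transpose (c y) = c y) \<and>
     (\<forall>y\<in>S. (\<forall>v. 0 \<le> v \<bullet> (c y *v v)) \<and> levy_measure (F y)) \<and>
     (\<forall>P\<in>Q. \<exists>\<nu>. semimartingale_characteristics P Ft Y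
        (\<lambda>t \<omega>. LINT s:{0..t}|lborel. b (left_limit Y s \<omega>))
        (\<lambda>t \<omega>. LINT s:{0..t}|lborel. c (left_limit Y s \<omega>)) \<nu> \<and>
        (\<forall>\<omega>\<in>space P. \<forall>A\<in>sets borel. emeasure (\<nu> \<omega>) A =
           (\<integral>\<^sup>+ t. emeasure (radon_measure_of (F (left_limit Y t \<omega>))) {\<xi>. (t, \<xi>) \<in> A}
              * indicator {0..} t \<partial>lborel)))"

definition affine_process ::
    "'w measure \<Rightarrow> (real \<Rightarrow> 'w measure) \<Rightarrow> (real^'n \<Rightarrow> 'w measure) \<Rightarrow> (real^'n) set \<Rightarrow>
      (real \<Rightarrow> 'w \<Rightarrow> real^'n) \<Rightarrow>
      (real^'n \<Rightarrow> real^'n) \<Rightarrow> (real^'n \<Rightarrow> real^'n^'n) \<Rightarrow> (real^'n \<Rightarrow> (real^'n) signed_radon) \<Rightarrow> bool"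
  where
  "affine_process M Ft P E X b c F \<longleftrightarrow>
     stochastic_setting M Ft P E X \<and> affine_characteristics Ft (P ` E) E X b c F"

text \<open>For an affine map \<open>f\<close>, the image \<open>f(X)\<close> is an affine process with state space \<open>f(E)\<close>; its
  characteristics are taken under the measures of the original family.\<close>

definition affine_image_is_affine ::
    "(real \<Rightarrow> 'w measure) \<Rightarrow> (real^'n \<Rightarrow> 'w measure) \<Rightarrow> (real^'n) set \<Rightarrow>
      (real \<Rightarrow> 'w \<Rightarrow> real^'n) \<Rightarrow> (real^'n \<Rightarrow> real^'m) \<Rightarrow> bool" where
  "affine_image_is_affine Ft P E X f \<longleftrightarrow>
     (\<exists>b c F. affine_characteristics Ft (P ` E) (f ` E) (\<lambda>t \<omega>. f (X t \<omega>)) b c F)"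

text \<open>For a countable state space without accumulation points, the events below are measurable
  because \<open>X\<close> is right-continuous.\<close>

definition irreducible_state_space ::
    "'w measure \<Rightarrow> (real^'n \<Rightarrow> 'w measure) \<Rightarrow> (real^'n) set \<Rightarrow> (real \<Rightarrow> 'w \<Rightarrow> real^'n) \<Rightarrow> bool" where
  "irreducible_state_space M P E X \<longleftrightarrow> (\<forall>x\<in>E. \<forall>y\<in>E. x \<noteq> y \<longrightarrow>
     0 < measure (P x) {\<omega>\<in>space M. \<exists>t\<ge>0. X t \<omega> = y})"

definition transformed_kernel ::
    "('a \<Rightarrow> 'a) \<Rightarrow> ('a \<Rightarrow> 'a signed_radon) \<Rightarrow> 'a \<Rightarrow> 'a::euclidean_space measure" where
  "transformed_kernel T F y = distr (radon_measure_of (F (inv T y))) borel (\<lambda>\<xi>. T \<xi> - T 0)"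

end

theory Submission
  imports Defs
begin

text \<open>A process with finite state space moves by jumps, and comparing the jump measure with its
  compensator shows that from \<open>x\<close> it jumps by \<open>\<xi>\<close> at a rate \<open>\<alpha>(\<xi>, x)\<close> that is affine in \<open>x\<close>, nonnegative on
  \<open>E\<close>, and zero if \<open>x + \<xi> \<notin> E\<close>. Hence \<open>\<alpha>(\<xi>, \<cdot>)\<close> decreases strictly along \<open>\<xi>\<close>; rescaled to decrease by 1, it
  takes natural values on \<open>E\<close> and vanishes on an edge of the convex hull of \<open>E\<close>. A jump decreases the
  function of its own edge by 1 and does not decrease any other one. If two of the linear parts were
  antiparallel, the jumps affecting them would form an autonomous component, so exactly three
  edges remain. Integrality of the increments, again together with the absence of autonomous
  components, makes the three functions sum to a constant \<open>N\<close>, so each jump decreases one of them by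
  1 and increases another one by 1. Two of them are the required coordinates, and irreducibility
  makes \<open>E\<close> the full simplex.

  That the absence of autonomous components can be exploited at all rests on the converse
  computation: if the rate of every jump with \<open>a \<bullet> \<xi> \<noteq> 0\<close> depends on \<open>x\<close> only through \<open>a \<bullet> x\<close>, then \<open>a \<bullet> X\<close> is
  an affine process. Its truncated jumps are compensated by occupation times, which gives a true
  martingale.\<close>

section \<open>Affine jump rates on a finite set in the plane\<close>

text \<open>The planar argument sees only affinity, signs and support of the rates and is therefore
  isolated in \<open>affine_rates\<close>. Irreducibility enters it only as the existence of a jump
  that decreases a given linear functional: otherwise the states maximizing the functional could
  never be left. Finiteness of \<open>E\<close> supplies the rigidity: a jump can be repeated as
  long as its rate is positive, so its level counts the remaining repetitions. Comparing two levels
  that vanish on the same edge then leaves no freedom of scale. The obstacle on the probabilistic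
  side is that an autonomous component is defined through full semimartingale characteristics.
  Contradicting the hypothesis means constructing them, including a predictable first characteristic
  of finite variation on every path, over a filtration that need not be complete. Occupation times
  provide it, being Lipschitz in time on every path. Both directions, from characteristics to rates
  and back, test the compensator with the predictable event that the left limit equals a given
  state.\<close>

definition perp :: "real^2 \<Rightarrow> real^2" where
  "perp x = vector [- x $ 2, x $ 1]"

lemma perp_component [simp]: "perp x $ 1 = - x $ 2" "perp x $ 2 = x $ 1"
  by (simp_all add: perp_def)

lemma inner_vec2: "x \<bullet> y = x $ 1 * y $ 1 + x $ 2 * y $ 2" for x y :: "real^2"
  by (simp add: inner_vec_def sum_2)

lemma vec2_eq_iff: "x = y \<longleftrightarrow> x $ 1 = y $ 1 \<and> x $ 2 = y $ 2" for x y :: "real^2"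
  by (auto simp: vec_eq_iff forall_2)

lemma perp_orthogonal [simp]: "perp x \<bullet> x = 0" "x \<bullet> perp x = 0"
  by (simp_all add: inner_vec2)

lemma perp_eq_0_iff [simp]: "perp x = 0 \<longleftrightarrow> x = 0"
  by (auto simp: vec2_eq_iff)

lemma inner_perp_swap: "perp x \<bullet> y = - (perp y \<bullet> x)"
  by (simp add: inner_vec2)

text \<open>The vectors \<open>w\<close> and \<open>perp w\<close> form an orthogonal basis of equal
  lengths.\<close>

lemma vec2_decompose:
  assumes "w \<noteq> 0"
  shows "x = ((x \<bullet> w) / (w \<bullet> w)) *\<^sub>R w + ((x \<bullet> perp w) / (w \<bullet> w)) *\<^sub>R perp w"
proof -
  define d where "d = w \<bullet> w"
  have "d \<noteq> 0" using assms by (simp add: d_def)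
  moreover have "d *\<^sub>R x = (x \<bullet> w) *\<^sub>R w + (x \<bullet> perp w) *\<^sub>R perp w"
    unfolding vec2_eq_iff inner_vec2 d_def by (simp add: algebra_simps)
  then have "(1 / d) *\<^sub>R d *\<^sub>R x = (1 / d) *\<^sub>R ((x \<bullet> w) *\<^sub>R w + (x \<bullet> perp w) *\<^sub>R perp w)"
    by simp
  ultimately show ?thesis
    by (simp add: d_def scaleR_add_right)
qed

lemma orthogonal_imp_parallel_perp:
  assumes "u \<bullet> w = 0" "w \<noteq> 0"
  obtains r where "u = r *\<^sub>R perp w"
  using vec2_decompose[OF assms(2), of u] assms(1) by auto

text \<open>\<open>perp g1 \<bullet> g2\<close> is the determinant of the pair \<open>g1\<close>,
  \<open>g2\<close>, and the coefficients are those of Cramer's rule. Linear independence of slopes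
  is expressed below by this determinant.\<close>

lemma cramer_combination:
  assumes "perp g1 \<bullet> g2 \<noteq> 0"
  obtains p q where "h = p *\<^sub>R g1 + q *\<^sub>R g2"
proof
  show "h = ((perp h \<bullet> g2) / (perp g1 \<bullet> g2)) *\<^sub>R g1 + ((perp g1 \<bullet> h) / (perp g1 \<bullet> g2)) *\<^sub>R g2"
    using assms unfolding vec2_eq_iff inner_vec2
    by (simp add: divide_simps) (simp add: algebra_simps)
qed

text \<open>The interface between probability and plane geometry. Signs and support are available
  only on \<open>E\<close>, affinity on the whole plane. Irreducibility survives as
  \<open>exists_decreasing_jump\<close>, the absence of autonomous components as
  \<open>not_autonomous\<close>.\<close>

locale affine_rates =
  fixes E :: "(real^2) set" and rate :: "real^2 \<Rightarrow> real^2 \<Rightarrow> real" and grad :: "real^2 \<Rightarrow> real^2"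
  assumes finite_E: "finite E"
    and affine_hull_E: "affine hull E = UNIV"
    and rate_affine: "\<And>\<xi> x. rate \<xi> x = rate \<xi> 0 + grad \<xi> \<bullet> x"
    and rate_nonneg: "\<And>\<xi> x. x \<in> E \<Longrightarrow> 0 \<le> rate \<xi> x"
    and rate_support: "\<And>\<xi> x. x \<in> E \<Longrightarrow> rate \<xi> x \<noteq> 0 \<Longrightarrow> x + \<xi> \<in> E"
    and rate_zero [simp]: "\<And>x. rate 0 x = 0"
    and exists_decreasing_jump:
      "\<And>a. a \<noteq> 0 \<Longrightarrow> \<exists>\<xi>. (\<exists>x\<in>E. rate \<xi> x \<noteq> 0) \<and> a \<bullet> \<xi> < 0"
    and not_autonomous:
      "\<And>a. a \<noteq> 0 \<Longrightarrow> \<exists>\<xi>. a \<bullet> \<xi> \<noteq> 0 \<and> \<not> (\<exists>p q. \<forall>x. rate \<xi> x = p + q * (a \<bullet> x))"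
begin

section \<open>Levels of jumps and the edges on which they vanish\<close>

definition jumps :: "(real^2) set" where
  "jumps = {\<xi>. \<exists>x\<in>E. rate \<xi> x \<noteq> 0}"

text \<open>A hyperplane cannot contain a set whose affine hull is the whole space. Identities
  between affine functions can thus be checked on \<open>E\<close>.\<close>

lemma affine_function_zero:
  assumes "\<And>x. x \<in> E \<Longrightarrow> k + h \<bullet> x = 0"
  shows "k = 0 \<and> h = 0"
proof -
  have "affine {x. h \<bullet> x = - k}" by (rule affine_hyperplane)
  moreover have "E \<subseteq> {x. h \<bullet> x = - k}" using assms by force
  ultimately have "affine hull E \<subseteq> {x. h \<bullet> x = - k}" by (rule hull_minimal[rotated])
  then have *: "h \<bullet> x = - k" for x by (auto simp: affine_hull_E)
  from *[of 0] have "k = 0" by simp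
  with *[of h] show ?thesis by simp
qed

lemma rate_eq_0: "\<xi> \<notin> jumps \<Longrightarrow> rate \<xi> x = 0"
proof -
  assume "\<xi> \<notin> jumps"
  then have "rate \<xi> 0 = 0 \<and> grad \<xi> = 0"
    by (intro affine_function_zero) (auto simp: jumps_def rate_affine[symmetric])
  then show ?thesis by (subst rate_affine) simp
qed

lemma rate_shift: "rate \<xi> (x + r *\<^sub>R z) = rate \<xi> x + r * (grad \<xi> \<bullet> z)"
  using rate_affine[of \<xi> x] rate_affine[of \<xi> "x + r *\<^sub>R z"] by (simp add: inner_simps)

text \<open>If the rate did not decrease along its own jump, it would stay positive at all points
  \<open>x + real n *\<^sub>R \<xi>\<close>, and \<open>rate_support\<close> would place this
  infinite sequence in the finite set \<open>E\<close>.\<close>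

lemma grad_self_neg:
  assumes "\<xi> \<in> jumps"
  shows "grad \<xi> \<bullet> \<xi> < 0"
proof (rule ccontr)
  assume "\<not> ?thesis"
  then have nn: "0 \<le> grad \<xi> \<bullet> \<xi>" by simp
  obtain x where x: "x \<in> E" "rate \<xi> x > 0"
    using assms rate_nonneg by (force simp: jumps_def less_le)
  have \<xi>: "\<xi> \<noteq> 0" using x by auto
  have in_E: "x + real n *\<^sub>R \<xi> \<in> E" for n
  proof (induction n)
    case (Suc n)
    have "rate \<xi> (x + real n *\<^sub>R \<xi>) \<noteq> 0"
      using x(2) nn by (simp add: rate_shift add_pos_nonneg less_imp_neq[symmetric])
    from rate_support[OF Suc this] show ?case by (simp add: algebra_simps)
  qed (use x in simp)
  have "inj (\<lambda>n. x + real n *\<^sub>R \<xi>)" using \<xi> by (auto intro!: injI)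
  then have "infinite (range (\<lambda>n. x + real n *\<^sub>R \<xi>))" by (rule range_inj_infinite)
  moreover have "range (\<lambda>n. x + real n *\<^sub>R \<xi>) \<subseteq> E" using in_E by auto
  ultimately show False using finite_E finite_subset by blast
qed

text \<open>The rate of a jump, rescaled such that the jump decreases it by exactly 1, and the linear
  part of this affine function.\<close>

definition level :: "real^2 \<Rightarrow> real^2 \<Rightarrow> real" where
  "level \<xi> x = rate \<xi> x / - (grad \<xi> \<bullet> \<xi>)"

definition slope :: "real^2 \<Rightarrow> real^2" where
  "slope \<xi> = (1 / - (grad \<xi> \<bullet> \<xi>)) *\<^sub>R grad \<xi>"

lemma level_affine: "level \<xi> x = level \<xi> 0 + slope \<xi> \<bullet> x"
  unfolding level_def slope_def by (subst rate_affine) (simp add: add_divide_distrib)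

lemma level_shift: "level \<xi> (x + r *\<^sub>R z) = level \<xi> x + r * (slope \<xi> \<bullet> z)"
  using level_affine[of \<xi> x] level_affine[of \<xi> "x + r *\<^sub>R z"] by (simp add: inner_simps)

lemma level_add: "level \<xi> (x + z) = level \<xi> x + slope \<xi> \<bullet> z"
  using level_shift[of \<xi> x 1 z] by simp

lemma slope_self: "\<xi> \<in> jumps \<Longrightarrow> slope \<xi> \<bullet> \<xi> = - 1"
  using grad_self_neg[of \<xi>] by (simp add: slope_def)

lemma slope_nonzero: "\<xi> \<in> jumps \<Longrightarrow> slope \<xi> \<noteq> 0"
  using slope_self by force

lemma jump_nonzero: "\<xi> \<in> jumps \<Longrightarrow> \<xi> \<noteq> 0"
  using slope_self by force

lemma rate_eq_level: "\<xi> \<in> jumps \<Longrightarrow> rate \<xi> x = - (grad \<xi> \<bullet> \<xi>) * level \<xi> x"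
  using grad_self_neg[of \<xi>] by (simp add: level_def)

lemma level_nonneg: "\<xi> \<in> jumps \<Longrightarrow> x \<in> E \<Longrightarrow> 0 \<le> level \<xi> x"
  using grad_self_neg[of \<xi>] rate_nonneg[of x \<xi>] by (simp add: level_def divide_nonneg_neg)

lemma level_support: "\<xi> \<in> jumps \<Longrightarrow> x \<in> E \<Longrightarrow> level \<xi> x \<noteq> 0 \<Longrightarrow> x + \<xi> \<in> E"
  using rate_support[of x \<xi>] by (auto simp: level_def)

text \<open>Every jump lowers the level by 1 and remains possible while the level is nonzero. Since
  the level is never negative on \<open>E\<close>, the chain of jumps must hit 0 exactly. The
  induction runs over an upper bound of the level.\<close>

lemma level_chain:
  assumes "\<xi> \<in> jumps" "x \<in> E"
  obtains k :: nat where "level \<xi> x = real k" "\<And>j. j \<le> k \<Longrightarrow> x + real j *\<^sub>R \<xi> \<in> E"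
proof -
  have "\<exists>k::nat. level \<xi> x = real k \<and> (\<forall>j\<le>k. x + real j *\<^sub>R \<xi> \<in> E)"
    if "x \<in> E" "level \<xi> x < real n" for x n
    using that
  proof (induction n arbitrary: x)
    case 0
    then show ?case using level_nonneg[OF assms(1), of x] by simp
  next
    case (Suc n)
    show ?case
    proof (cases "level \<xi> x = 0")
      case True
      then show ?thesis using Suc.prems by (intro exI[of _ 0]) auto
    next
      case False
      have "x + \<xi> \<in> E" "level \<xi> (x + \<xi>) = level \<xi> x - 1"
        using level_support[OF assms(1) Suc.prems(1) False] by (auto simp: level_add slope_self assms)
      with Suc.IH[of "x + \<xi>"] Suc.prems
      obtain k :: nat where k: "level \<xi> (x + \<xi>) = real k" "\<forall>j\<le>k. x + \<xi> + real j *\<^sub>R \<xi> \<in> E"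
        by auto
      have "x + real j *\<^sub>R \<xi> \<in> E" if "j \<le> Suc k" for j
        using k(2) Suc.prems(1) that by (cases j) (auto simp: algebra_simps)
      moreover have "level \<xi> x = real (Suc k)"
        using k(1) \<open>level \<xi> (x + \<xi>) = level \<xi> x - 1\<close> by simp
      ultimately show ?thesis by blast
    qed
  qed
  moreover obtain n where "level \<xi> x < real n" using reals_Archimedean2 by blast
  ultimately obtain k :: nat where "level \<xi> x = real k" "\<forall>j\<le>k. x + real j *\<^sub>R \<xi> \<in> E"
    using assms(2) by blast
  then show thesis by (intro that) auto
qed

text \<open>The chain of jumps from a state of positive level passes level 1 one step before it ends
  at 0.\<close>

lemma exists_level_1:
  assumes "\<xi> \<in> jumps"
  obtains x where "x \<in> E" "level \<xi> x = 1"
proof -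
  obtain x where x: "x \<in> E" "rate \<xi> x \<noteq> 0" using assms by (auto simp: jumps_def)
  then have "level \<xi> x \<noteq> 0" using grad_self_neg[OF assms] by (simp add: level_def)
  obtain k where k: "level \<xi> x = real k" "\<And>j. j \<le> k \<Longrightarrow> x + real j *\<^sub>R \<xi> \<in> E"
    using level_chain[OF assms x(1)] by blast
  have "k \<noteq> 0" using k \<open>level \<xi> x \<noteq> 0\<close> by auto
  then have "level \<xi> (x + real (k - 1) *\<^sub>R \<xi>) = 1"
    using k(1) by (simp add: level_shift slope_self assms of_nat_diff)
  moreover have "x + real (k - 1) *\<^sub>R \<xi> \<in> E" by (intro k(2)) simp
  ultimately show thesis by (rule that[rotated])
qed

text \<open>If the zero set of the rate contained a single state, every state would lie on the line
  through it in the direction of the jump.\<close>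

lemma two_zeros:
  assumes "\<xi> \<in> jumps"
  obtains p q where "p \<in> E" "q \<in> E" "p \<noteq> q" "level \<xi> p = 0" "level \<xi> q = 0"
proof (rule ccontr)
  assume contr: "\<not> thesis"
  note thesisI = that
  have uniq: "p = q" if "p \<in> E" "q \<in> E" "level \<xi> p = 0" "level \<xi> q = 0" for p q
  proof (rule ccontr)
    assume "p \<noteq> q"
    with that have thesis by (intro thesisI[of p q])
    then show False using contr by contradiction
  qed
  have zero: "\<exists>k::nat. x + real k *\<^sub>R \<xi> \<in> E \<and> level \<xi> (x + real k *\<^sub>R \<xi>) = 0" if x: "x \<in> E" for x
  proof -
    obtain k where k: "level \<xi> x = real k" "\<And>j. j \<le> k \<Longrightarrow> x + real j *\<^sub>R \<xi> \<in> E"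
      using level_chain[OF assms x] by blast
    then show ?thesis by (intro exI[of _ k]) (simp add: level_shift slope_self assms)
  qed
  obtain y where "y \<in> E" using assms by (auto simp: jumps_def)
  \<comment> \<open>The functional \<open>perp \<xi>\<close> is constant along the jump, and all
    chains of jumps end in the same zero, so it would be constant on \<open>E\<close>.\<close>
  have "- (perp \<xi> \<bullet> y) + perp \<xi> \<bullet> x = 0" if "x \<in> E" for x
  proof -
    obtain j :: nat where j: "x + real j *\<^sub>R \<xi> \<in> E" "level \<xi> (x + real j *\<^sub>R \<xi>) = 0"
      using zero[OF \<open>x \<in> E\<close>] by (elim exE conjE)
    obtain k :: nat where k: "y + real k *\<^sub>R \<xi> \<in> E" "level \<xi> (y + real k *\<^sub>R \<xi>) = 0"
      using zero[OF \<open>y \<in> E\<close>] by (elim exE conjE)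
    have "x + real j *\<^sub>R \<xi> = y + real k *\<^sub>R \<xi>"
      using uniq[OF j(1) k(1) j(2) k(2)] .
    then have "perp \<xi> \<bullet> (x + real j *\<^sub>R \<xi>) = perp \<xi> \<bullet> (y + real k *\<^sub>R \<xi>)" by simp
    then show ?thesis by (simp add: inner_simps)
  qed
  then have "- (perp \<xi> \<bullet> y) = 0 \<and> perp \<xi> = 0" by (rule affine_function_zero)
  then show False using jump_nonzero[OF assms] by simp
qed

text \<open>A state on the line \<open>k + h \<bullet> x = 0\<close> has no room for a jump that
  decreases \<open>h\<close>, so the level of the jump vanishes there too. Two affine functions with
  two common zeros in the plane are proportional; the sign of the factor is read off from the jump
  itself.\<close>

lemma level_proportional:
  assumes \<xi>: "\<xi> \<in> jumps" and nonneg: "\<And>x. x \<in> E \<Longrightarrow> 0 \<le> k + h \<bullet> x" and neg: "h \<bullet> \<xi> < 0"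
    and p: "p \<in> E" "k + h \<bullet> p = 0" and q: "q \<in> E" "k + h \<bullet> q = 0" and "p \<noteq> q"
  obtains r where "0 < r" "slope \<xi> = r *\<^sub>R h" "\<And>x. level \<xi> x = r * (k + h \<bullet> x)"
proof -
  have zero: "level \<xi> y = 0" if "y \<in> E" "k + h \<bullet> y = 0" for y
    using nonneg[of "y + \<xi>"] level_support[OF \<xi> that(1)] that(2) neg by (auto simp: inner_simps)
  have "slope \<xi> \<bullet> (q - p) = 0" "h \<bullet> (q - p) = 0"
    using zero[OF p] zero[OF q] p q level_affine[of \<xi> p] level_affine[of \<xi> q]
    by (auto simp: inner_simps)
  then obtain s t where s: "slope \<xi> = s *\<^sub>R perp (q - p)" and t: "h = t *\<^sub>R perp (q - p)"
    using orthogonal_imp_parallel_perp \<open>p \<noteq> q\<close> by (metis eq_iff_diff_eq_0)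
  have "t \<noteq> 0" using neg t by auto
  then have sl: "slope \<xi> = (s / t) *\<^sub>R h" using s t by simp
  have "(s / t) * (h \<bullet> \<xi>) = - 1" using slope_self[OF \<xi>] sl by simp
  then have "0 < s / t" using neg by (smt (verit) mult_nonpos_nonpos)
  moreover have "level \<xi> x = (s / t) * (k + h \<bullet> x)" for x
  proof -
    have "level \<xi> x - level \<xi> p = (s / t) * (h \<bullet> x - h \<bullet> p)"
      by (simp add: level_affine[of \<xi> x] level_affine[of \<xi> p] sl right_diff_distrib)
    moreover have "h \<bullet> p = - k" using p(2) by simp
    ultimately show ?thesis using zero[OF p] by (simp add: algebra_simps)
  qed
  ultimately show thesis using that sl by blast
qed

text \<open>The two levels are proportional by \<open>level_proportional\<close>. The factor is
  natural because it is the value of \<open>level \<xi>\<close> where \<open>level \<zeta>\<close>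
  is 1, and it divides 1 because of a state where \<open>level \<xi>\<close> is 1.\<close>

lemma level_eqI:
  assumes \<xi>: "\<xi> \<in> jumps" and \<zeta>: "\<zeta> \<in> jumps" and neg: "slope \<zeta> \<bullet> \<xi> < 0"
  shows "slope \<xi> = slope \<zeta> \<and> level \<xi> = level \<zeta>"
proof -
  obtain p q where pq: "p \<in> E" "q \<in> E" "p \<noteq> q" "level \<zeta> p = 0" "level \<zeta> q = 0"
    using two_zeros[OF \<zeta>] by blast
  obtain r where r: "0 < r" "slope \<xi> = r *\<^sub>R slope \<zeta>" "\<And>x. level \<xi> x = r * (level \<zeta> 0 + slope \<zeta> \<bullet> x)"
    using level_proportional[OF \<xi> _ neg, of "level \<zeta> 0" p q] pq level_nonneg[OF \<zeta>]
    by (metis level_affine)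
  then have lev: "level \<xi> x = r * level \<zeta> x" for x by (simp add: level_affine[of \<zeta> x])
  have "r \<in> \<nat>" using exists_level_1[OF \<zeta>] level_chain[OF \<xi>] lev by (metis mult.right_neutral of_nat_in_Nats)
  then obtain m where m: "r = real m" by (auto elim: Nats_cases)
  obtain y where y: "y \<in> E" "level \<xi> y = 1" using exists_level_1[OF \<xi>] by blast
  obtain n where "level \<zeta> y = real n" using level_chain[OF \<zeta> y(1)] by blast
  then have "real m * real n = 1" using lev[of y] y m by simp
  then have "m = 1" by (metis of_nat_mult of_nat_eq_1_iff nat_mult_eq_1_iff)
  then show ?thesis using r(2) lev m by auto
qed

text \<open>A negative value would force equal slopes by \<open>level_eqI\<close>; the value is an
  integer because it is the difference of two natural levels, before and after the jump.\<close>

lemma slope_integral: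
  assumes "\<xi> \<in> jumps" "\<zeta> \<in> jumps" "slope \<zeta> \<noteq> slope \<xi>"
  obtains k :: nat where "slope \<zeta> \<bullet> \<xi> = real k"
proof -
  have nn: "0 \<le> slope \<zeta> \<bullet> \<xi>" using level_eqI[OF assms(1,2)] assms(3) by fastforce
  obtain x where x: "x \<in> E" "level \<xi> x = 1" using exists_level_1 assms by blast
  then have "x + \<xi> \<in> E" using level_support[OF assms(1)] by simp
  obtain i where i: "level \<zeta> x = real i" using level_chain[OF assms(2) x(1)] by blast
  obtain j where j: "level \<zeta> (x + \<xi>) = real j"
    using level_chain[OF assms(2) \<open>x + \<xi> \<in> E\<close>] by blast
  from i j have "slope \<zeta> \<bullet> \<xi> = real j - real i" by (simp add: level_add)
  then have "slope \<zeta> \<bullet> \<xi> = real (j - i)" using nn by simp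
  then show thesis by (rule that)
qed

lemma level_eqI_slope:
  assumes "\<xi> \<in> jumps" "\<zeta> \<in> jumps" "slope \<zeta> = slope \<xi>"
  shows "level \<xi> = level \<zeta>"
  using level_eqI[OF assms(1,2)] slope_self assms by simp

text \<open>In the direction of \<open>u\<close>, the convex hull of \<open>E\<close> is left through one of its edges. Since the
  process can leave the opposite side, some rate vanishes exactly on this edge.\<close>

lemma exists_slope_neg:
  assumes "u \<noteq> 0"
  obtains \<zeta> where "\<zeta> \<in> jumps" "slope \<zeta> \<bullet> u < 0"
proof -
  \<comment> \<open>A gift-wrapping step around the convex hull, with \<open>s\<close> as horizontal
    and \<open>u\<close> as vertical axis: \<open>p\<close> is the top point of the face on which
    \<open>s\<close> is minimal.\<close>
  define s where "s = perp u"
  have "E \<noteq> {}" using affine_hull_E by force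
  define m where "m = Min ((\<lambda>x. s \<bullet> x) ` E)"
  have m: "m \<le> s \<bullet> x" if "x \<in> E" for x using that finite_E by (simp add: m_def)
  define E0 where "E0 = {x \<in> E. s \<bullet> x = m}"
  have "m \<in> (\<lambda>x. s \<bullet> x) ` E" unfolding m_def using finite_E \<open>E \<noteq> {}\<close> by (intro Min_in) auto
  then have "E0 \<noteq> {}" "finite E0" using finite_E by (auto simp: E0_def)
  then have "Max ((\<lambda>x. u \<bullet> x) ` E0) \<in> (\<lambda>x. u \<bullet> x) ` E0" by (intro Max_in) auto
  then obtain p where p: "p \<in> E0" "u \<bullet> p = Max ((\<lambda>x. u \<bullet> x) ` E0)" by auto
  then have pmax: "u \<bullet> x \<le> u \<bullet> p" if "x \<in> E0" for x using that \<open>finite E0\<close> by simp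
  have pE: "p \<in> E" "s \<bullet> p = m" using p by (auto simp: E0_def)
  define E1 where "E1 = E - E0"
  have "E1 \<noteq> {}"
  proof
    assume "E1 = {}"
    then have "- m + s \<bullet> x = 0" if "x \<in> E" for x using that by (auto simp: E1_def E0_def)
    then have "s = 0" using affine_function_zero by blast
    then show False using assms by (simp add: s_def)
  qed
  have "finite E1" using finite_E by (simp add: E1_def)
  \<comment> \<open>The steepness of \<open>x\<close> seen from \<open>p\<close>. The steepest state
    \<open>q\<close> lies on the hull edge that starts at \<open>p\<close> and bounds
    \<open>E\<close> in the direction of \<open>u\<close>.\<close>
  define sl where "sl x = (u \<bullet> (x - p)) / (s \<bullet> (x - p))" for x
  have "Max (sl ` E1) \<in> sl ` E1" using \<open>E1 \<noteq> {}\<close> \<open>finite E1\<close> by (intro Max_in) auto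
  then obtain q where q: "q \<in> E1" "sl q = Max (sl ` E1)" by auto
  then have qmax: "sl x \<le> sl q" if "x \<in> E1" for x using that \<open>finite E1\<close> by simp
  have pos: "0 < s \<bullet> (x - p)" if "x \<in> E1" for x
    using that m[of x] pE by (auto simp: E1_def E0_def inner_simps less_le)
  \<comment> \<open>\<open>k + h \<bullet> x\<close> is the height of the line through
    \<open>p\<close> and \<open>q\<close> above \<open>x\<close>: zero at \<open>p\<close> and
    \<open>q\<close>, nonnegative on \<open>E\<close>, decreasing in the direction of
    \<open>u\<close>.\<close>
  define h where "h = sl q *\<^sub>R s - u"
  define k where "k = - (h \<bullet> p)"
  have kh: "k + h \<bullet> x = sl q * (s \<bullet> (x - p)) - u \<bullet> (x - p)" for x
    by (simp add: k_def h_def inner_simps algebra_simps)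
  have nonneg: "0 \<le> k + h \<bullet> x" if "x \<in> E" for x
  proof (cases "x \<in> E1")
    case True
    then have "u \<bullet> (x - p) = sl x * (s \<bullet> (x - p))" using pos[OF True] by (simp add: sl_def)
    then show ?thesis using qmax[OF True] pos[OF True] by (simp add: kh mult_right_mono)
  next
    case False
    then have "x \<in> E0" using that by (simp add: E1_def)
    then show ?thesis using pmax[of x] pE by (simp add: kh E0_def inner_simps)
  qed
  have hu: "h \<bullet> u = - (u \<bullet> u)" by (simp add: h_def s_def inner_simps)
  then have "h \<bullet> u < 0" using assms by simp
  then have "h \<noteq> 0" by auto
  then obtain \<xi> where \<xi>: "\<xi> \<in> jumps" "h \<bullet> \<xi> < 0"
    using exists_decreasing_jump[of h] by (auto simp: jumps_def)
  have qz: "k + h \<bullet> q = 0" using pos[OF q(1)] by (simp add: kh) (simp add: sl_def)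
  have pz: "k + h \<bullet> p = 0" by (simp add: kh)
  have "p \<noteq> q" using p q by (auto simp: E1_def)
  have "q \<in> E" using q by (simp add: E1_def)
  obtain r where "0 < r" "slope \<xi> = r *\<^sub>R h"
    using level_proportional[OF \<xi>(1) nonneg \<xi>(2) pE(1) pz \<open>q \<in> E\<close> qz \<open>p \<noteq> q\<close>] by blast
  then have "slope \<xi> \<bullet> u < 0" using \<open>h \<bullet> u < 0\<close> by (simp add: mult_pos_neg)
  with \<xi>(1) show thesis by (rule that)
qed

text \<open>If the slopes of all jumps visible to \<open>a\<close> are multiples of
  \<open>a\<close>, the rates of these jumps depend on \<open>x\<close> only through
  \<open>a \<bullet> x\<close>. This is the form in which \<open>not_autonomous\<close> is applied
  to slopes.\<close>

lemma not_autonomous_jumps: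
  assumes "a \<noteq> 0" and "\<And>\<xi>. \<xi> \<in> jumps \<Longrightarrow> a \<bullet> \<xi> \<noteq> 0 \<Longrightarrow> \<exists>r. slope \<xi> = r *\<^sub>R a"
  shows False
proof -
  obtain \<xi> where \<xi>: "a \<bullet> \<xi> \<noteq> 0" "\<not> (\<exists>p q. \<forall>x. rate \<xi> x = p + q * (a \<bullet> x))"
    using not_autonomous[OF assms(1)] by blast
  have const: "\<not> (\<forall>x. rate \<xi> x = p + q * (a \<bullet> x))" for p q
    using \<xi>(2) by (intro notI) (erule notE, intro exI)
  have "\<xi> \<in> jumps"
    using const[of 0 0] rate_eq_0[of \<xi>] by auto
  then obtain r where r: "slope \<xi> = r *\<^sub>R a" using assms(2) \<xi>(1) by metis
  define d where "d = - (grad \<xi> \<bullet> \<xi>)"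
  have "rate \<xi> x = d * level \<xi> 0 + (d * r) * (a \<bullet> x)" for x
    using rate_eq_level[OF \<open>\<xi> \<in> jumps\<close>, of x] level_affine[of \<xi> x]
    by (simp add: d_def[symmetric] r algebra_simps)
  then show False using const by metis
qed

text \<open>For antiparallel slopes, a jump that changes one of the two levels decreases one of
  them, and \<open>level_eqI\<close> gives it one of these two slopes. All of them are multiples of
  \<open>slope \<xi>\<close>.\<close>

lemma not_antiparallel:
  assumes "\<xi> \<in> jumps" "\<zeta> \<in> jumps" "slope \<zeta> = (- r) *\<^sub>R slope \<xi>"
  shows "r \<le> 0"
proof (rule ccontr)
  assume "\<not> r \<le> 0"
  then have r: "0 < r" by simp
  show False
  proof (rule not_autonomous_jumps[of "slope \<xi>"])
    show "slope \<xi> \<noteq> 0" using slope_nonzero assms by blast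
    fix \<eta> assume \<eta>: "\<eta> \<in> jumps" "slope \<xi> \<bullet> \<eta> \<noteq> 0"
    have "slope \<eta> = slope \<xi> \<or> slope \<eta> = slope \<zeta>"
    proof (cases "slope \<xi> \<bullet> \<eta> < 0")
      case True
      then show ?thesis using level_eqI[OF \<eta>(1) assms(1)] by blast
    next
      case False
      then have "slope \<zeta> \<bullet> \<eta> < 0" using \<eta>(2) r assms(3) by simp
      then show ?thesis using level_eqI[OF \<eta>(1) assms(2)] by blast
    qed
    then show "\<exists>r. slope \<eta> = r *\<^sub>R slope \<xi>" using assms(3) by (metis scaleR_one)
  qed
qed

section \<open>Exactly three slopes, with equal weights\<close>

lemma finite_jumps: "finite jumps"
proof -
  have "jumps \<subseteq> (\<lambda>(x, y). y - x) ` (E \<times> E)"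
  proof
    fix \<xi> assume "\<xi> \<in> jumps"
    then obtain x where "x \<in> E" "x + \<xi> \<in> E" using rate_support by (auto simp: jumps_def)
    then show "\<xi> \<in> (\<lambda>(x, y). y - x) ` (E \<times> E)" by (intro image_eqI[of _ _ "(x, x + \<xi>)"]) auto
  qed
  then show ?thesis using finite_E finite_subset by blast
qed

text \<open>Up to scale, \<open>\<alpha>\<close> and \<open>\<beta>\<close> are coordinates of
  slopes with respect to \<open>perp g\<close> and \<open>g\<close>. On either side of the line
  through \<open>g\<close>, the slope pointing most strongly against \<open>g\<close> is selected; a
  positive combination of these two is a negative multiple of \<open>g\<close>.\<close>

lemma positive_dependence:
  obtains \<xi>1 \<xi>2 \<xi>3 c1 c2 c3 where "{\<xi>1, \<xi>2, \<xi>3} \<subseteq> jumps" "0 < c1" "0 < c2" "0 < c3"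
    "c1 *\<^sub>R slope \<xi>1 + c2 *\<^sub>R slope \<xi>2 + c3 *\<^sub>R slope \<xi>3 = 0" "perp (slope \<xi>1) \<bullet> slope \<xi>2 \<noteq> 0"
proof -
  have "(axis 1 1 :: real^2) \<noteq> 0" by (simp add: axis_eq_0_iff)
  then obtain \<xi>1 where \<xi>1: "\<xi>1 \<in> jumps" by (rule exists_slope_neg)
  define g where "g = slope \<xi>1"
  have g: "g \<noteq> 0" "0 < g \<bullet> g" using slope_nonzero[OF \<xi>1] by (auto simp: g_def)
  define u where "u = perp g"
  have u: "u \<noteq> 0" "- u \<noteq> 0" using g by (auto simp: u_def)
  define \<alpha> where "\<alpha> \<zeta> = slope \<zeta> \<bullet> u" for \<zeta>
  define \<beta> where "\<beta> \<zeta> = slope \<zeta> \<bullet> g" for \<zeta>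
  have min_ex: "\<exists>\<xi>\<in>A. \<forall>\<zeta>\<in>A. f \<xi> \<le> f \<zeta>" if "A \<subseteq> jumps" "A \<noteq> {}" for A and f :: "real^2 \<Rightarrow> real"
    using that finite_jumps finite_subset[of A jumps]
    by (metis arg_min_least arg_min_if_finite(1))
  obtain \<zeta> where "\<zeta> \<in> jumps" "\<alpha> \<zeta> < 0" using exists_slope_neg[OF u(1)] by (auto simp: \<alpha>_def)
  then obtain \<xi>2 where \<xi>2: "\<xi>2 \<in> jumps" "\<alpha> \<xi>2 < 0"
    and min2: "\<And>\<zeta>. \<zeta> \<in> jumps \<Longrightarrow> \<alpha> \<zeta> < 0 \<Longrightarrow> \<beta> \<xi>2 / - \<alpha> \<xi>2 \<le> \<beta> \<zeta> / - \<alpha> \<zeta>"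
    using min_ex[of "{\<zeta> \<in> jumps. \<alpha> \<zeta> < 0}" "\<lambda>\<zeta>. \<beta> \<zeta> / - \<alpha> \<zeta>"] by auto
  obtain \<zeta>' where "\<zeta>' \<in> jumps" "0 < \<alpha> \<zeta>'" using exists_slope_neg[OF u(2)] by (auto simp: \<alpha>_def)
  then obtain \<xi>3 where \<xi>3: "\<xi>3 \<in> jumps" "0 < \<alpha> \<xi>3"
    and min3: "\<And>\<zeta>. \<zeta> \<in> jumps \<Longrightarrow> 0 < \<alpha> \<zeta> \<Longrightarrow> \<beta> \<xi>3 / \<alpha> \<xi>3 \<le> \<beta> \<zeta> / \<alpha> \<zeta>"
    using min_ex[of "{\<zeta> \<in> jumps. 0 < \<alpha> \<zeta>}" "\<lambda>\<zeta>. \<beta> \<zeta> / \<alpha> \<zeta>"] by auto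
  define \<rho>2 where "\<rho>2 = \<beta> \<xi>2 / - \<alpha> \<xi>2"
  define \<rho>3 where "\<rho>3 = \<beta> \<xi>3 / \<alpha> \<xi>3"
  have neg: "\<rho>2 + \<rho>3 < 0"
  proof (rule ccontr)
    assume "\<not> ?thesis"
    then have ge: "- \<rho>2 \<le> \<rho>3" by simp
    \<comment> \<open>If \<open>neg\<close> fails, minimality of \<open>\<rho>2\<close> and
      \<open>\<rho>3\<close> makes the product of \<open>d\<close> with every slope off the line
      through \<open>g\<close> nonnegative. \<open>exists_slope_neg\<close> then yields a slope
      antiparallel to \<open>g\<close>.\<close>
    define d where "d = g + \<rho>2 *\<^sub>R u"
    have "d \<bullet> g \<noteq> 0" using g by (simp add: d_def u_def inner_simps)
    then have "d \<noteq> 0" by auto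
    then obtain \<zeta> where \<zeta>: "\<zeta> \<in> jumps" "slope \<zeta> \<bullet> d < 0" by (rule exists_slope_neg)
    then have less: "\<beta> \<zeta> + \<rho>2 * \<alpha> \<zeta> < 0" by (simp add: d_def \<alpha>_def \<beta>_def inner_simps)
    consider "\<alpha> \<zeta> < 0" | "0 < \<alpha> \<zeta>" | "\<alpha> \<zeta> = 0" by linarith
    then show False
    proof cases
      case 1
      have "\<rho>2 \<le> \<beta> \<zeta> / - \<alpha> \<zeta>" using min2[OF \<zeta>(1) 1] by (simp add: \<rho>2_def)
      then show False using 1 less by (simp add: field_simps)
    next
      case 2
      have "- \<rho>2 \<le> \<beta> \<zeta> / \<alpha> \<zeta>" using min3[OF \<zeta>(1) 2] ge by (simp add: \<rho>3_def)
      then show False using 2 less by (simp add: field_simps)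
    next
      case 3
      have "slope \<zeta> = (- (- \<beta> \<zeta> / (g \<bullet> g))) *\<^sub>R slope \<xi>1"
        using vec2_decompose[OF g(1), of "slope \<zeta>"] 3 by (simp add: \<alpha>_def \<beta>_def u_def g_def)
      from not_antiparallel[OF \<xi>1 \<zeta>(1) this] show False
        using less 3 g(2) by (simp add: divide_nonpos_pos zero_le_divide_iff)
    qed
  qed
  \<comment> \<open>The components along \<open>u\<close> are scaled to -1 and 1 and cancel, so
    \<open>w\<close> is a multiple of \<open>g\<close>, negative by \<open>neg\<close>.\<close>
  define w where "w = (1 / - \<alpha> \<xi>2) *\<^sub>R slope \<xi>2 + (1 / \<alpha> \<xi>3) *\<^sub>R slope \<xi>3"
  have "w \<bullet> u = 0"
    using \<xi>2(2) \<xi>3(2) by (simp add: w_def inner_simps \<alpha>_def[symmetric])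
  moreover have wg: "w \<bullet> g = \<rho>2 + \<rho>3"
    by (simp add: w_def inner_simps \<beta>_def[symmetric] \<rho>2_def \<rho>3_def)
  ultimately have w: "w = ((\<rho>2 + \<rho>3) / (g \<bullet> g)) *\<^sub>R g"
    using vec2_decompose[OF g(1), of w] by (simp add: u_def)
  show thesis
  proof (rule that[of \<xi>1 \<xi>2 \<xi>3 "- ((\<rho>2 + \<rho>3) / (g \<bullet> g))" "1 / - \<alpha> \<xi>2" "1 / \<alpha> \<xi>3"])
    show "{\<xi>1, \<xi>2, \<xi>3} \<subseteq> jumps" using \<xi>1 \<xi>2 \<xi>3 by simp
    show "0 < - ((\<rho>2 + \<rho>3) / (g \<bullet> g))" using neg g(2) by (simp add: divide_neg_pos)
    show "0 < 1 / - \<alpha> \<xi>2" "0 < 1 / \<alpha> \<xi>3" using \<xi>2 \<xi>3 by auto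
    show "- ((\<rho>2 + \<rho>3) / (g \<bullet> g)) *\<^sub>R slope \<xi>1 + (1 / - \<alpha> \<xi>2) *\<^sub>R slope \<xi>2 + (1 / \<alpha> \<xi>3) *\<^sub>R slope \<xi>3 = 0"
      using w unfolding w_def g_def[symmetric] by (simp add: algebra_simps)
    show "perp (slope \<xi>1) \<bullet> slope \<xi>2 \<noteq> 0"
      using \<xi>2(2) by (simp add: \<alpha>_def u_def g_def inner_commute)
  qed
qed

text \<open>The weights are carried along, although they turn out to be equal, so that the predicate
  is stable under permutations and one inequality can be applied to every ordering.\<close>

definition slope_triple ::
    "real^2 \<Rightarrow> real^2 \<Rightarrow> real^2 \<Rightarrow> real \<Rightarrow> real \<Rightarrow> real \<Rightarrow> bool" where
  "slope_triple \<xi>1 \<xi>2 \<xi>3 c1 c2 c3 \<longleftrightarrow>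
     {\<xi>1, \<xi>2, \<xi>3} \<subseteq> jumps \<and> 0 < c1 \<and> 0 < c2 \<and> 0 < c3 \<and>
     c1 *\<^sub>R slope \<xi>1 + c2 *\<^sub>R slope \<xi>2 + c3 *\<^sub>R slope \<xi>3 = 0 \<and>
     slope \<xi>1 \<noteq> slope \<xi>2 \<and> slope \<xi>1 \<noteq> slope \<xi>3 \<and> slope \<xi>2 \<noteq> slope \<xi>3 \<and>
     (\<forall>\<zeta>\<in>jumps. slope \<zeta> \<in> {slope \<xi>1, slope \<xi>2, slope \<xi>3})"

lemma slope_triple_rotate: "slope_triple \<xi>1 \<xi>2 \<xi>3 c1 c2 c3 \<Longrightarrow> slope_triple \<xi>2 \<xi>3 \<xi>1 c2 c3 c1"
  unfolding slope_triple_def by (auto simp: add.commute add.left_commute)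

lemma slope_triple_swap: "slope_triple \<xi>1 \<xi>2 \<xi>3 c1 c2 c3 \<Longrightarrow> slope_triple \<xi>2 \<xi>1 \<xi>3 c2 c1 c3"
  unfolding slope_triple_def by (auto simp: add.commute add.left_commute)

text \<open>A fourth linear part would lie in the convex cone of the other three; this contradicts the
  signs of all four on the corresponding jump.\<close>

lemma exists_slope_triple:
  obtains \<xi>1 \<xi>2 \<xi>3 c1 c2 c3 where "slope_triple \<xi>1 \<xi>2 \<xi>3 c1 c2 c3" "perp (slope \<xi>1) \<bullet> slope \<xi>2 \<noteq> 0"
proof -
  obtain \<xi>1 \<xi>2 \<xi>3 c1 c2 c3 where *: "{\<xi>1, \<xi>2, \<xi>3} \<subseteq> jumps" "0 < c1" "0 < c2" "0 < c3"
    and sum: "c1 *\<^sub>R slope \<xi>1 + c2 *\<^sub>R slope \<xi>2 + c3 *\<^sub>R slope \<xi>3 = 0"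
    and det: "perp (slope \<xi>1) \<bullet> slope \<xi>2 \<noteq> 0"
    by (rule positive_dependence)
  have "slope \<xi>1 \<noteq> slope \<xi>2" using det by auto
  moreover have "slope \<xi>1 \<noteq> slope \<xi>3"
  proof
    assume "slope \<xi>1 = slope \<xi>3"
    then have "perp (slope \<xi>1) \<bullet> (c1 *\<^sub>R slope \<xi>1 + c2 *\<^sub>R slope \<xi>2 + c3 *\<^sub>R slope \<xi>1) = 0"
      using sum by simp
    then show False using det *(3) by (simp add: inner_simps)
  qed
  moreover have "slope \<xi>2 \<noteq> slope \<xi>3"
  proof
    assume "slope \<xi>2 = slope \<xi>3"
    then have "perp (slope \<xi>2) \<bullet> (c1 *\<^sub>R slope \<xi>1 + c2 *\<^sub>R slope \<xi>2 + c3 *\<^sub>R slope \<xi>2) = 0"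
      using sum by simp
    then show False using det *(2) inner_perp_swap[of "slope \<xi>1" "slope \<xi>2"]
      by (simp add: inner_simps)
  qed
  moreover have "slope \<zeta> \<in> {slope \<xi>1, slope \<xi>2, slope \<xi>3}" if \<zeta>: "\<zeta> \<in> jumps" for \<zeta>
  proof (rule ccontr)
    assume "\<not> ?thesis"
    then have nn: "0 \<le> slope \<xi>1 \<bullet> \<zeta>" "0 \<le> slope \<xi>2 \<bullet> \<zeta>" "0 \<le> slope \<xi>3 \<bullet> \<zeta>"
      using level_eqI[OF \<zeta>, of \<xi>1] level_eqI[OF \<zeta>, of \<xi>2] level_eqI[OF \<zeta>, of \<xi>3] *(1)
      by (auto simp: not_less[symmetric])
    obtain p q where pq: "slope \<zeta> = p *\<^sub>R slope \<xi>1 + q *\<^sub>R slope \<xi>2"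
      using cramer_combination[OF det] by blast
    \<comment> \<open>Adding \<open>t\<close> times the positive dependence does not change the
      vector and makes all three coefficients nonnegative; the two summands of \<open>t\<close>
      absorb \<open>p\<close> and \<open>q\<close>.\<close>
    define t where "t = \<bar>p\<bar> / c1 + \<bar>q\<bar> / c2"
    have "0 \<le> t" using * by (simp add: t_def)
    have "t * c1 = \<bar>p\<bar> + \<bar>q\<bar> / c2 * c1" "t * c2 = \<bar>p\<bar> / c1 * c2 + \<bar>q\<bar>"
      using * by (simp_all add: t_def distrib_right)
    moreover have "0 \<le> \<bar>q\<bar> / c2 * c1" "0 \<le> \<bar>p\<bar> / c1 * c2" using * by simp_all
    ultimately have "\<bar>p\<bar> \<le> t * c1" "\<bar>q\<bar> \<le> t * c2" by simp_all
    then have nnt: "0 \<le> p + t * c1" "0 \<le> q + t * c2" by (auto simp: abs_le_iff)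
    have "slope \<zeta> = (p + t * c1) *\<^sub>R slope \<xi>1 + (q + t * c2) *\<^sub>R slope \<xi>2 + (t * c3) *\<^sub>R slope \<xi>3"
    proof -
      have "slope \<zeta> = slope \<zeta> + t *\<^sub>R (c1 *\<^sub>R slope \<xi>1 + c2 *\<^sub>R slope \<xi>2 + c3 *\<^sub>R slope \<xi>3)"
        using sum by simp
      then show ?thesis unfolding pq by (simp add: algebra_simps)
    qed
    then have "slope \<zeta> \<bullet> \<zeta> = (p + t * c1) * (slope \<xi>1 \<bullet> \<zeta>) + (q + t * c2) * (slope \<xi>2 \<bullet> \<zeta>)
        + (t * c3) * (slope \<xi>3 \<bullet> \<zeta>)"
      by (metis inner_add_left inner_scaleR_left)
    then have "0 \<le> slope \<zeta> \<bullet> \<zeta>" using nn nnt \<open>0 \<le> t\<close> *(4) by simp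
    then show False using slope_self[OF \<zeta>] by simp
  qed
  ultimately have "slope_triple \<xi>1 \<xi>2 \<xi>3 c1 c2 c3"
    using * sum unfolding slope_triple_def by blast
  with det that show thesis by blast
qed

text \<open>Pair the linear dependence with \<open>\<eta>\<close>: its own slope contributes -1 and
  the other two contribute natural numbers.\<close>

lemma slope_triple_sum:
  assumes "slope_triple \<xi>1 \<xi>2 \<xi>3 c1 c2 c3" "\<eta> \<in> jumps" "slope \<eta> = slope \<xi>1"
  obtains m n :: nat where "slope \<xi>2 \<bullet> \<eta> = real m" "slope \<xi>3 \<bullet> \<eta> = real n" "c1 = c2 * real m + c3 * real n"
proof -
  have j: "\<xi>2 \<in> jumps" "\<xi>3 \<in> jumps" and ne: "slope \<xi>2 \<noteq> slope \<eta>" "slope \<xi>3 \<noteq> slope \<eta>"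
    and sum: "c1 *\<^sub>R slope \<xi>1 + c2 *\<^sub>R slope \<xi>2 + c3 *\<^sub>R slope \<xi>3 = 0"
    using assms by (auto simp: slope_triple_def)
  obtain m n where mn: "slope \<xi>2 \<bullet> \<eta> = real m" "slope \<xi>3 \<bullet> \<eta> = real n"
    using slope_integral[OF assms(2) j(1) ne(1)] slope_integral[OF assms(2) j(2) ne(2)] by metis
  have "(c1 *\<^sub>R slope \<xi>1 + c2 *\<^sub>R slope \<xi>2 + c3 *\<^sub>R slope \<xi>3) \<bullet> \<eta> = 0" using sum by simp
  moreover have "slope \<xi>1 \<bullet> \<eta> = - 1" using slope_self[OF assms(2)] assms(3) by simp
  ultimately have "c1 = c2 * real m + c3 * real n" by (simp add: inner_simps mn)
  with mn show thesis by (rule that)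
qed

text \<open>If \<open>c3\<close> exceeds \<open>c1\<close>, integrality rules out that the jumps belonging to \<open>\<xi>1\<close> and \<open>\<xi>2\<close> increase the
  third level, which would then be autonomous.\<close>

lemma slope_triple_le:
  assumes tri: "slope_triple \<xi>1 \<xi>2 \<xi>3 c1 c2 c3" and le: "c1 \<le> c2" "c2 \<le> c3"
  shows "c3 \<le> c1"
proof (rule ccontr)
  assume "\<not> c3 \<le> c1"
  then have less: "c1 < c3" by simp
  have pos: "0 < c1" "0 < c2" "0 < c3" using tri by (auto simp: slope_triple_def)
  have big: "c \<le> c * real (Suc n)" if "0 < c" for c :: real and n using that by simp
  have one: "slope \<xi>3 \<bullet> \<eta> = 0 \<and> c2 \<le> c1" if \<eta>: "\<eta> \<in> jumps" "slope \<eta> = slope \<xi>1" for \<eta>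
  proof -
    obtain m n where mn: "slope \<xi>2 \<bullet> \<eta> = real m" "slope \<xi>3 \<bullet> \<eta> = real n" "c1 = c2 * real m + c3 * real n"
      by (rule slope_triple_sum[OF tri \<eta>])
    have "0 \<le> c2 * real m" using pos by simp
    then have n: "n = 0" using mn(3) less big[OF pos(3), of "n - 1"] by (cases "n = 0") auto
    then obtain m' where "m = Suc m'" using mn(3) pos by (cases m) auto
    then show ?thesis using mn n big[OF pos(2), of m'] by simp
  qed
  \<comment> \<open>The jump \<open>\<xi>1\<close> belongs to its own class, so such a jump exists
    and \<open>one\<close> is not vacuous.\<close>
  have "c2 \<le> c1" using one[of \<xi>1] tri by (auto simp: slope_triple_def)
  have two: "slope \<xi>3 \<bullet> \<eta> = 0" if \<eta>: "\<eta> \<in> jumps" "slope \<eta> = slope \<xi>2" for \<eta>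
  proof -
    obtain m n where mn: "slope \<xi>1 \<bullet> \<eta> = real m" "slope \<xi>3 \<bullet> \<eta> = real n" "c2 = c1 * real m + c3 * real n"
      by (rule slope_triple_sum[OF slope_triple_swap[OF tri] \<eta>])
    have "0 \<le> c1 * real m" using pos by simp
    then have "n = 0" using mn(3) less \<open>c2 \<le> c1\<close> big[OF pos(3), of "n - 1"] by (cases "n = 0") auto
    then show ?thesis using mn by simp
  qed
  show False
  proof (rule not_autonomous_jumps)
    show "slope \<xi>3 \<noteq> 0" using tri slope_nonzero by (auto simp: slope_triple_def)
    fix \<eta> assume \<eta>: "\<eta> \<in> jumps" "slope \<xi>3 \<bullet> \<eta> \<noteq> 0"
    then have "slope \<eta> = slope \<xi>3"
      using one[OF \<eta>(1)] two[OF \<eta>(1)] tri unfolding slope_triple_def by auto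
    then show "\<exists>r. slope \<eta> = r *\<^sub>R slope \<xi>3" by (intro exI[of _ 1]) simp
  qed
qed

text \<open>In whichever order the three weights are sorted, \<open>slope_triple_le\<close> bounds
  the largest by the smallest; all six permutations are supplied.\<close>

lemma slope_triple_equal:
  assumes tri: "slope_triple \<xi>1 \<xi>2 \<xi>3 c1 c2 c3"
  shows "c1 = c2 \<and> c2 = c3"
proof -
  have rot: "slope_triple \<xi>2 \<xi>3 \<xi>1 c2 c3 c1" "slope_triple \<xi>3 \<xi>1 \<xi>2 c3 c1 c2"
    using slope_triple_rotate[OF tri] slope_triple_rotate[OF slope_triple_rotate[OF tri]] by auto
  show ?thesis
    using slope_triple_le[OF tri] slope_triple_le[OF rot(1)] slope_triple_le[OF rot(2)]
      slope_triple_le[OF slope_triple_swap[OF tri]] slope_triple_le[OF slope_triple_swap[OF rot(1)]]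
      slope_triple_le[OF slope_triple_swap[OF rot(2)]]
    by linarith
qed

end

text \<open>A flag such as \<open>D12\<close> says that a particle of type 1 can become one of type
  2. Every type can be left and entered, so every type change is possible, directly or through the
  third type: without \<open>D12\<close>, leaving 1 gives \<open>D13\<close> and entering 2 gives
  \<open>D32\<close>. All particles are collected in type 1 and redistributed from there.\<close>

lemma simplex_full:
  fixes S :: "(nat \<times> nat \<times> nat) set"
  assumes "\<And>i j k. D12 \<Longrightarrow> (Suc i, j, k) \<in> S \<Longrightarrow> (i, Suc j, k) \<in> S"
    and "\<And>i j k. D13 \<Longrightarrow> (Suc i, j, k) \<in> S \<Longrightarrow> (i, j, Suc k) \<in> S"
    and "\<And>i j k. D21 \<Longrightarrow> (i, Suc j, k) \<in> S \<Longrightarrow> (Suc i, j, k) \<in> S"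
    and "\<And>i j k. D23 \<Longrightarrow> (i, Suc j, k) \<in> S \<Longrightarrow> (i, j, Suc k) \<in> S"
    and "\<And>i j k. D31 \<Longrightarrow> (i, j, Suc k) \<in> S \<Longrightarrow> (Suc i, j, k) \<in> S"
    and "\<And>i j k. D32 \<Longrightarrow> (i, j, Suc k) \<in> S \<Longrightarrow> (i, Suc j, k) \<in> S"
    and leave: "D12 \<or> D13" "D21 \<or> D23" "D31 \<or> D32"
    and enter: "D21 \<or> D31" "D12 \<or> D32" "D13 \<or> D23"
    and start: "(i0, j0, k0) \<in> S" and sum: "a + b + c = i0 + j0 + k0"
  shows "(a, b, c) \<in> S"
proof -
  have m12: "(i, Suc j, k) \<in> S" if "(Suc i, j, k) \<in> S" for i j k using assms that by metis
  have m13: "(i, j, Suc k) \<in> S" if "(Suc i, j, k) \<in> S" for i j k using assms that by metis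
  have m21: "(Suc i, j, k) \<in> S" if "(i, Suc j, k) \<in> S" for i j k using assms that by metis
  have m31: "(Suc i, j, k) \<in> S" if "(i, j, Suc k) \<in> S" for i j k using assms that by metis
  have r2: "(i + n, j, k) \<in> S" if "(i, j + n, k) \<in> S" for i j k n
    using that by (induction n arbitrary: i) (use m21 in fastforce)+
  have r3: "(i + n, j, k) \<in> S" if "(i, j, k + n) \<in> S" for i j k n
    using that by (induction n arbitrary: i) (use m31 in fastforce)+
  have s2: "(i, j + n, k) \<in> S" if "(i + n, j, k) \<in> S" for i j k n
    using that by (induction n arbitrary: j) (use m12 in fastforce)+
  have s3: "(i, j, k + n) \<in> S" if "(i + n, j, k) \<in> S" for i j k n
    using that by (induction n arbitrary: k) (use m13 in fastforce)+
  have "(i0 + j0 + k0, 0, 0) \<in> S"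
    using r3[of "i0 + j0" 0 0 k0] r2[of i0 0 j0 k0] start by simp
  then have "(a + c, b, 0) \<in> S" using s2[of "a + c" b 0 0] sum by (simp add: ac_simps)
  then show ?thesis using s3[of a c b 0] by simp
qed

section \<open>Jumps as changes of particle types\<close>

context affine_rates
begin

text \<open>With equal weights, \<open>slope_triple_sum\<close> says that two natural numbers add up
  to 1.\<close>

lemma jump_type:
  assumes "slope_triple \<xi>1 \<xi>2 \<xi>3 c c c" "\<eta> \<in> jumps" "slope \<eta> = slope \<xi>1"
  shows "slope \<xi>2 \<bullet> \<eta> = 1 \<and> slope \<xi>3 \<bullet> \<eta> = 0 \<or> slope \<xi>2 \<bullet> \<eta> = 0 \<and> slope \<xi>3 \<bullet> \<eta> = 1"
proof -
  obtain m n where mn: "slope \<xi>2 \<bullet> \<eta> = real m" "slope \<xi>3 \<bullet> \<eta> = real n" "c = c * real m + c * real n"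
    by (rule slope_triple_sum[OF assms])
  have "0 < c" using assms(1) by (simp add: slope_triple_def)
  have "c * real (m + n) = c * 1" using mn(3) by (simp add: distrib_left)
  then have "m + n = 1" using \<open>0 < c\<close> by (metis mult_left_cancel less_irrefl of_nat_eq_1_iff)
  then show ?thesis using mn by (auto simp: add_is_1)
qed

text \<open>Some jump increases the level of \<open>\<xi>1\<close>, by
  \<open>exists_decreasing_jump\<close> for the opposite direction; it cannot belong to the class of
  \<open>\<xi>1\<close>, whose jumps decrease it.\<close>

lemma jump_type_enter:
  assumes "slope_triple \<xi>1 \<xi>2 \<xi>3 c c c"
  shows "(\<exists>\<eta>\<in>jumps. slope \<eta> = slope \<xi>2 \<and> slope \<xi>1 \<bullet> \<eta> = 1) \<or>
    (\<exists>\<eta>\<in>jumps. slope \<eta> = slope \<xi>3 \<and> slope \<xi>1 \<bullet> \<eta> = 1)"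
proof -
  have "slope \<xi>1 \<noteq> 0" using assms slope_nonzero by (auto simp: slope_triple_def)
  then obtain \<eta> where \<eta>: "\<eta> \<in> jumps" "0 < slope \<xi>1 \<bullet> \<eta>"
    using exists_decreasing_jump[of "- slope \<xi>1"] by (auto simp: jumps_def)
  have "slope \<eta> = slope \<xi>1 \<or> slope \<eta> = slope \<xi>2 \<or> slope \<eta> = slope \<xi>3"
    using assms \<eta>(1) by (auto simp: slope_triple_def)
  moreover have "slope \<eta> \<noteq> slope \<xi>1" using slope_self[OF \<eta>(1)] \<eta>(2) by auto
  moreover have "slope \<xi>1 \<bullet> \<eta> = 1" if "slope \<eta> = slope \<xi>2"
    using jump_type[OF slope_triple_swap[OF assms] \<eta>(1) that] \<eta>(2) by auto
  moreover have "slope \<xi>1 \<bullet> \<eta> = 1" if "slope \<eta> = slope \<xi>3"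
    using jump_type[OF slope_triple_rotate[OF slope_triple_rotate[OF assms]] \<eta>(1) that] \<eta>(2) by auto
  ultimately show ?thesis using \<eta>(1) by blast
qed

end

text \<open>The jump rates of \<open>N\<close> particles of three types, of which \<open>y $ 1\<close> have type 1 and \<open>y $ 2\<close> have
  type 2; each jump changes the type of a single particle.\<close>

definition particle_rate :: "(real^2 \<Rightarrow> real) \<Rightarrow> nat \<Rightarrow> real^2 \<Rightarrow> real^2 \<Rightarrow> real" where
  "particle_rate l N y v = l v *
     (if v \<in> {vector [-1, 0], vector [-1, 1]} then y $ 1
      else if v \<in> {vector [0, -1], vector [1, -1]} then y $ 2
      else if v \<in> {vector [1, 0], vector [0, 1]} then real N - y $ 1 - y $ 2 else 0)"

context affine_rates
begin

text \<open>The new coordinates of a state are its levels for \<open>\<xi>1\<close> and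
  \<open>\<xi>2\<close>; independence of these two slopes makes \<open>L\<close> injective. The
  level for \<open>\<xi>3\<close> is what is missing from \<open>N\<close>.\<close>

theorem classification:
  obtains k :: "real^2" and L :: "real^2 \<Rightarrow> real^2" and N :: nat and l :: "real^2 \<Rightarrow> real"
  where "linear L" "inj L" "\<And>v. 0 \<le> l v"
    and "(\<lambda>x. k + L x) ` E = {x. x $ 1 \<in> \<nat> \<and> x $ 2 \<in> \<nat> \<and> x $ 1 + x $ 2 \<le> real N}"
    and "\<And>\<xi> x. rate \<xi> x = particle_rate l N (k + L x) (L \<xi>)"
proof -
  obtain \<xi>1 \<xi>2 \<xi>3 c1 c2 c3 where tri': "slope_triple \<xi>1 \<xi>2 \<xi>3 c1 c2 c3"
    and det: "perp (slope \<xi>1) \<bullet> slope \<xi>2 \<noteq> 0"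
    by (rule exists_slope_triple)
  define c where "c = c1"
  have tri: "slope_triple \<xi>1 \<xi>2 \<xi>3 c c c" using tri' slope_triple_equal[OF tri'] by (simp add: c_def)
  note rot = slope_triple_rotate[OF tri]
  note rot2 = slope_triple_rotate[OF rot]
  have j: "\<xi>1 \<in> jumps" "\<xi>2 \<in> jumps" "\<xi>3 \<in> jumps" using tri by (auto simp: slope_triple_def)
  have "c *\<^sub>R (slope \<xi>1 + slope \<xi>2 + slope \<xi>3) = 0" "c \<noteq> 0"
    using tri by (auto simp: slope_triple_def scaleR_add_right)
  then have "slope \<xi>1 + slope \<xi>2 + slope \<xi>3 = 0" by (simp only: scaleR_eq_0_iff) simp
  then have s3: "slope \<xi>3 = - slope \<xi>1 - slope \<xi>2" by (simp add: algebra_simps eq_neg_iff_add_eq_0)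
  have s: "level \<xi>3 x = K - level \<xi>1 x - level \<xi>2 x" if "K = level \<xi>1 0 + level \<xi>2 0 + level \<xi>3 0" for x K
    using that level_affine[of \<xi>1 x] level_affine[of \<xi>2 x] level_affine[of \<xi>3 x]
    by (simp add: s3 inner_simps)
  have "E \<noteq> {}" using affine_hull_E by force
  then obtain x0 where "x0 \<in> E" by blast
  obtain i0 j0 k0 where x0: "level \<xi>1 x0 = real i0" "level \<xi>2 x0 = real j0" "level \<xi>3 x0 = real k0"
    using level_chain[OF j(1) \<open>x0 \<in> E\<close>] level_chain[OF j(2) \<open>x0 \<in> E\<close>] level_chain[OF j(3) \<open>x0 \<in> E\<close>]
    by metis
  \<comment> \<open>The sum of the levels is constant because the slopes add up to 0; it is
    evaluated at one state, where the levels are natural numbers.\<close>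
  define N where "N = i0 + j0 + k0"
  have l3: "level \<xi>3 x = real N - level \<xi>1 x - level \<xi>2 x" for x
    using s[OF refl, of x] s[OF refl, of x0] x0 by (simp add: N_def)

  \<comment> \<open>The numbers of particles of the three types that are realized by states;
    \<open>D\<close> records which type changes occur as jumps.\<close>
  define S where "S = {(a, b, d). \<exists>x\<in>E. level \<xi>1 x = real a \<and> level \<xi>2 x = real b \<and> level \<xi>3 x = real d}"
  define D where "D \<xi> \<zeta> \<longleftrightarrow> (\<exists>\<eta>\<in>jumps. slope \<eta> = slope \<xi> \<and> slope \<zeta> \<bullet> \<eta> = 1)" for \<xi> \<zeta>
  have move: "\<exists>y\<in>E. level \<xi> y = real a \<and> level \<zeta> y = real (Suc b) \<and> level \<theta> y = real d"
    if tr: "slope_triple \<xi> \<zeta> \<theta> c c c" and D: "D \<xi> \<zeta>"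
      and x: "x \<in> E" "level \<xi> x = real (Suc a)" "level \<zeta> x = real b" "level \<theta> x = real d"
    for \<xi> \<zeta> \<theta> x a b d
  proof -
    obtain \<eta> where \<eta>: "\<eta> \<in> jumps" "slope \<eta> = slope \<xi>" "slope \<zeta> \<bullet> \<eta> = 1" using D by (auto simp: D_def)
    then have "slope \<theta> \<bullet> \<eta> = 0" "slope \<xi> \<bullet> \<eta> = - 1"
      using jump_type[OF tr \<eta>(1,2)] slope_self[OF \<eta>(1)] by auto
    moreover have "\<xi> \<in> jumps" using tr by (simp add: slope_triple_def)
    then have "level \<xi> = level \<eta>" using level_eqI_slope[of \<xi> \<eta>] \<eta> by simp
    then have "level \<eta> x \<noteq> 0" using x(2) by simp
    then have "x + \<eta> \<in> E" using level_support[OF \<eta>(1) x(1)] by simp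
    ultimately show ?thesis using x \<eta> by (intro bexI[of _ "x + \<eta>"]) (auto simp: level_add)
  qed
  have full: "(a, b, d) \<in> S" if "a + b + d = N" for a b d
  proof (rule simplex_full[of "D \<xi>1 \<xi>2" S "D \<xi>1 \<xi>3" "D \<xi>2 \<xi>1" "D \<xi>2 \<xi>3" "D \<xi>3 \<xi>1" "D \<xi>3 \<xi>2" i0 j0 k0])
    show "(a', Suc b', d') \<in> S" if "D \<xi>1 \<xi>2" "(Suc a', b', d') \<in> S" for a' b' d'
      using move[OF tri that(1), of _ a' b' d'] that(2) unfolding S_def by auto
    show "(a', b', Suc d') \<in> S" if "D \<xi>1 \<xi>3" "(Suc a', b', d') \<in> S" for a' b' d'
      using move[OF slope_triple_swap[OF rot2] that(1), of _ a' d' b'] that(2) unfolding S_def by auto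
    show "(Suc a', b', d') \<in> S" if "D \<xi>2 \<xi>1" "(a', Suc b', d') \<in> S" for a' b' d'
      using move[OF slope_triple_swap[OF tri] that(1), of _ b' a' d'] that(2) unfolding S_def by auto
    show "(a', b', Suc d') \<in> S" if "D \<xi>2 \<xi>3" "(a', Suc b', d') \<in> S" for a' b' d'
      using move[OF rot that(1), of _ b' d' a'] that(2) unfolding S_def by auto
    show "(Suc a', b', d') \<in> S" if "D \<xi>3 \<xi>1" "(a', b', Suc d') \<in> S" for a' b' d'
      using move[OF rot2 that(1), of _ d' a' b'] that(2) unfolding S_def by auto
    show "(a', Suc b', d') \<in> S" if "D \<xi>3 \<xi>2" "(a', b', Suc d') \<in> S" for a' b' d'
      using move[OF slope_triple_swap[OF rot] that(1), of _ d' b' a'] that(2) unfolding S_def by auto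
    show "D \<xi>1 \<xi>2 \<or> D \<xi>1 \<xi>3" using jump_type[OF tri j(1)] j(1) by (auto simp: D_def)
    show "D \<xi>2 \<xi>1 \<or> D \<xi>2 \<xi>3" using jump_type[OF rot j(2)] j(2) by (auto simp: D_def)
    show "D \<xi>3 \<xi>1 \<or> D \<xi>3 \<xi>2" using jump_type[OF rot2 j(3)] j(3) by (auto simp: D_def)
    show "D \<xi>2 \<xi>1 \<or> D \<xi>3 \<xi>1" using jump_type_enter[OF tri] by (auto simp: D_def)
    show "D \<xi>1 \<xi>2 \<or> D \<xi>3 \<xi>2" using jump_type_enter[OF rot] by (auto simp: D_def)
    show "D \<xi>1 \<xi>3 \<or> D \<xi>2 \<xi>3" using jump_type_enter[OF rot2] by (auto simp: D_def)
    show "(i0, j0, k0) \<in> S" using x0 \<open>x0 \<in> E\<close> by (auto simp: S_def)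
    show "a + b + d = i0 + j0 + k0" using that by (simp add: N_def)
  qed

  define k :: "real^2" where "k = vector [level \<xi>1 0, level \<xi>2 0]"
  define L :: "real^2 \<Rightarrow> real^2" where "L x = vector [slope \<xi>1 \<bullet> x, slope \<xi>2 \<bullet> x]" for x
  have lev: "(k + L x) $ 1 = level \<xi>1 x" "(k + L x) $ 2 = level \<xi>2 x" for x
    by (simp_all add: k_def L_def level_affine[symmetric])
  have image: "(\<lambda>x. k + L x) ` E = {x. x $ 1 \<in> \<nat> \<and> x $ 2 \<in> \<nat> \<and> x $ 1 + x $ 2 \<le> real N}"
    (is "?T ` E = ?R")
  proof (intro set_eqI iffI)
    fix y assume "y \<in> ?T ` E"
    then obtain x where x: "x \<in> E" "y = ?T x" by auto
    obtain a b d where "level \<xi>1 x = real a" "level \<xi>2 x = real b" "level \<xi>3 x = real d"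
      using level_chain[OF j(1) x(1)] level_chain[OF j(2) x(1)] level_chain[OF j(3) x(1)] by metis
    then show "y \<in> ?R" unfolding x(2) mem_Collect_eq lev using l3[of x] by simp
  next
    fix y assume y: "y \<in> ?R"
    then obtain a b where ab: "y $ 1 = real a" "y $ 2 = real b" by (auto elim!: Nats_cases)
    then have "a + b \<le> N" using y by simp
    then have "(a, b, N - a - b) \<in> S" by (intro full) simp
    then obtain x where "x \<in> E" "level \<xi>1 x = real a" "level \<xi>2 x = real b" by (auto simp: S_def)
    then show "y \<in> ?T ` E"
      using ab by (intro image_eqI[of _ _ x]) (simp_all only: vec2_eq_iff lev)
  qed
  have "linear L"
    by (rule linearI) (simp_all add: L_def vec2_eq_iff inner_add_right)
  have "inj L"
  proof (rule linear_injective_0[OF \<open>linear L\<close>, THEN iffD2], intro allI impI, rule ccontr)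
    fix x assume "L x = 0" and "x \<noteq> 0"
    then have zero: "slope \<xi>1 \<bullet> x = 0" "slope \<xi>2 \<bullet> x = 0" by (simp_all add: L_def vec2_eq_iff)
    obtain s where "slope \<xi>1 = s *\<^sub>R perp x" by (rule orthogonal_imp_parallel_perp[OF zero(1) \<open>x \<noteq> 0\<close>])
    moreover obtain t where "slope \<xi>2 = t *\<^sub>R perp x"
      by (rule orthogonal_imp_parallel_perp[OF zero(2) \<open>x \<noteq> 0\<close>])
    ultimately show False using det by (simp add: inner_vec2)
  qed
  \<comment> \<open>\<open>l\<close> transports the rate constants along \<open>L\<close>. As
    \<open>L\<close> is injective, its sum has at most one term, and it is 0 at vectors that are not
    images of jumps.\<close>
  define r where "r \<xi> = (if \<xi> \<in> jumps then - (grad \<xi> \<bullet> \<xi>) else 0)" for \<xi>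
  define l where "l v = (\<Sum>\<xi>\<in>{\<xi>\<in>jumps. L \<xi> = v}. r \<xi>)" for v
  have "0 \<le> r \<xi>" for \<xi> using grad_self_neg[of \<xi>] by (auto simp: r_def)
  then have l_nonneg: "0 \<le> l v" for v unfolding l_def by (intro sum_nonneg)
  have l: "l (L \<xi>) = r \<xi>" for \<xi>
  proof -
    have "{\<eta>\<in>jumps. L \<eta> = L \<xi>} = (if \<xi> \<in> jumps then {\<xi>} else {})" using \<open>inj L\<close> by (auto dest: injD)
    then show ?thesis by (simp add: l_def r_def)
  qed
  have formula: "rate \<xi> x = particle_rate l N (k + L x) (L \<xi>)" for \<xi> x
    unfolding particle_rate_def l lev
  proof (cases "\<xi> \<in> jumps")
    case False
    then show "rate \<xi> x = r \<xi> * (if L \<xi> \<in> {vector [-1, 0], vector [-1, 1]} then level \<xi>1 x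
        else if L \<xi> \<in> {vector [0, -1], vector [1, -1]} then level \<xi>2 x
        else if L \<xi> \<in> {vector [1, 0], vector [0, 1]} then real N - level \<xi>1 x - level \<xi>2 x else 0)"
      using rate_eq_0[OF False] by (simp add: r_def)
  next
    case True
    have rate: "rate \<xi> x = r \<xi> * level \<xi> x" using rate_eq_level[OF True, of x] True by (simp add: r_def)
    have self: "slope \<xi> \<bullet> \<xi> = - 1" using slope_self[OF True] .
    consider "slope \<xi> = slope \<xi>1" | "slope \<xi> = slope \<xi>2" | "slope \<xi> = slope \<xi>3"
      using tri True by (auto simp: slope_triple_def)
    then show "rate \<xi> x = r \<xi> * (if L \<xi> \<in> {vector [-1, 0], vector [-1, 1]} then level \<xi>1 x
        else if L \<xi> \<in> {vector [0, -1], vector [1, -1]} then level \<xi>2 x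
        else if L \<xi> \<in> {vector [1, 0], vector [0, 1]} then real N - level \<xi>1 x - level \<xi>2 x else 0)"
    proof cases
      case 1
      then have "level \<xi> x = level \<xi>1 x" using level_eqI_slope[OF True j(1)] by simp
      moreover have "slope \<xi>1 \<bullet> \<xi> = - 1" using self 1 by simp
      then have "L \<xi> \<in> {vector [-1, 0], vector [-1, 1]}"
        using jump_type[OF tri True 1] by (auto simp: L_def)
      ultimately show ?thesis using rate by (auto simp: vec2_eq_iff)
    next
      case 2
      then have "level \<xi> x = level \<xi>2 x" using level_eqI_slope[OF True j(2)] by simp
      moreover have "slope \<xi>2 \<bullet> \<xi> = - 1" using self 2 by simp
      then have "L \<xi> \<in> {vector [0, -1], vector [1, -1]}"
        using jump_type[OF rot True 2] by (auto simp: L_def)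
      ultimately show ?thesis using rate by (auto simp: vec2_eq_iff)
    next
      case 3
      then have "level \<xi> x = level \<xi>3 x" using level_eqI_slope[OF True j(3)] by simp
      then have "level \<xi> x = real N - level \<xi>1 x - level \<xi>2 x" by (simp add: l3)
      moreover have "slope \<xi>3 \<bullet> \<xi> = - 1" using self 3 by simp
      then have "L \<xi> \<in> {vector [1, 0], vector [0, 1]}"
        using jump_type[OF rot2 True 3] by (auto simp: L_def)
      ultimately show ?thesis using rate by (auto simp: vec2_eq_iff)
    qed
  qed
  show thesis
    by (rule that[OF \<open>linear L\<close> \<open>inj L\<close> l_nonneg image formula])
qed

end

section \<open>Paths with finitely many values\<close>

locale finite_valued_process =
  fixes \<Omega> :: "'w set" and X :: "real \<Rightarrow> 'w \<Rightarrow> 'a::real_normed_vector" and E :: "'a set"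
  assumes cadlag: "cadlag \<Omega> X" and finite_states: "finite E"
    and in_E: "\<And>\<omega> t. \<omega> \<in> \<Omega> \<Longrightarrow> 0 \<le> t \<Longrightarrow> X t \<omega> \<in> E"
begin

text \<open>The states other than the limit form a finite, hence closed set, so its complement is a
  neighbourhood of the limit that contains no other state.\<close>

lemma eventually_eq_limit:
  assumes "((\<lambda>s. X s \<omega>) \<longlongrightarrow> l) G" "eventually (\<lambda>s. X s \<omega> \<in> E) G" "G \<noteq> bot"
  shows "l \<in> E \<and> eventually (\<lambda>s. X s \<omega> = l) G"
proof -
  have "open (- (E - {l}))" using finite_states by (intro open_Compl finite_imp_closed) auto
  then have "eventually (\<lambda>s. X s \<omega> \<in> - (E - {l})) G" 
    using topological_tendstoD[OF assms(1), of "- (E - {l})"] by simp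
  with assms(2) have ev: "eventually (\<lambda>s. X s \<omega> = l \<and> X s \<omega> \<in> E) G" by eventually_elim auto
  then have "l \<in> E" using eventually_happens'[OF assms(3) ev] by auto
  with ev show ?thesis by (auto elim: eventually_mono)
qed

lemma right_constant:
  assumes "\<omega> \<in> \<Omega>" "0 \<le> t"
  obtains \<epsilon> where "0 < \<epsilon>" "\<And>s. t < s \<Longrightarrow> s < t + \<epsilon> \<Longrightarrow> X s \<omega> = X t \<omega>"
proof -
  have "((\<lambda>s. X s \<omega>) \<longlongrightarrow> X t \<omega>) (at_right t)"
    using cadlag assms unfolding cadlag_def continuous_within by blast
  moreover have "eventually (\<lambda>s. X s \<omega> \<in> E) (at_right t)"
    using eventually_at_right_less[of t] by eventually_elim (use assms in_E in auto)
  ultimately have "eventually (\<lambda>s. X s \<omega> = X t \<omega>) (at_right t)"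
    using eventually_eq_limit by (metis trivial_limit_at_right_real)
  then obtain b where "b > t" "\<forall>y>t. y < b \<longrightarrow> X y \<omega> = X t \<omega>"
    unfolding eventually_at_right_field by auto
  then show thesis by (intro that[of "b - t"]) auto
qed

lemma left_constant:
  assumes "\<omega> \<in> \<Omega>" "0 < t"
  obtains \<epsilon> where "0 < \<epsilon>" "\<epsilon> \<le> t" "left_limit X t \<omega> \<in> E"
    "\<And>s. t - \<epsilon> < s \<Longrightarrow> s < t \<Longrightarrow> X s \<omega> = left_limit X t \<omega>"
proof -
  obtain l where l: "((\<lambda>s. X s \<omega>) \<longlongrightarrow> l) (at_left t)"
    using cadlag assms unfolding cadlag_def by blast
  then have lim: "left_limit X t \<omega> = l"
    using assms by (simp add: left_limit_def tendsto_Lim)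
  have "eventually (\<lambda>s. 0 < s) (at_left t)" using assms(2) by (simp add: eventually_at_left_field) (use dense in blast)
  then have "eventually (\<lambda>s. X s \<omega> \<in> E) (at_left t)"
    by eventually_elim (use assms in_E in auto)
  from eventually_eq_limit[OF l this] have lE: "l \<in> E" "eventually (\<lambda>s. X s \<omega> = l) (at_left t)" by auto
  then obtain b where b: "b < t" "\<forall>y>b. y < t \<longrightarrow> X y \<omega> = l"
    unfolding eventually_at_left_field by auto
  show thesis
    by (rule that[of "min (t - b) t"]) (use lE b assms in \<open>auto simp: lim\<close>)
qed

lemma left_limit_const_left:
  assumes "u < t" "0 < t" "\<And>s. u < s \<Longrightarrow> s < t \<Longrightarrow> X s \<omega> = l"
  shows "left_limit X t \<omega> = l"
proof -
  have "((\<lambda>s. X s \<omega>) \<longlongrightarrow> l) (at_left t)"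
    by (rule tendsto_eventually) (use assms in \<open>auto simp: eventually_at_left_field\<close>)
  then show ?thesis using assms by (simp add: left_limit_def tendsto_Lim)
qed

lemma left_limit_in_E: "\<omega> \<in> \<Omega> \<Longrightarrow> left_limit X t \<omega> \<in> E"
  by (cases "0 < t") (auto elim: left_constant simp: in_E left_limit_def)

lemma local_structure:
  assumes \<omega>: "\<omega> \<in> \<Omega>" and t: "0 \<le> t"
  obtains \<epsilon> where "0 < \<epsilon>" "\<And>s. t \<le> s \<Longrightarrow> s < t + \<epsilon> \<Longrightarrow> X s \<omega> = X t \<omega>"
    "\<And>s. t < s \<Longrightarrow> s < t + \<epsilon> \<Longrightarrow> left_limit X s \<omega> = X t \<omega>"
    "\<And>s. t - \<epsilon> < s \<Longrightarrow> s < t \<Longrightarrow> 0 \<le> s \<Longrightarrow> X s \<omega> = left_limit X t \<omega>"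
    "\<And>s. t - \<epsilon> < s \<Longrightarrow> s < t \<Longrightarrow> 0 \<le> s \<Longrightarrow> left_limit X s \<omega> = left_limit X t \<omega>"
proof -
  obtain \<epsilon>1 where 1: "0 < \<epsilon>1" "\<And>s. t < s \<Longrightarrow> s < t + \<epsilon>1 \<Longrightarrow> X s \<omega> = X t \<omega>"
    using right_constant[OF \<omega> t] by blast
  have "\<exists>\<epsilon>2>0. (0 < t \<longrightarrow> \<epsilon>2 \<le> t) \<and> (\<forall>s. t - \<epsilon>2 < s \<longrightarrow> s < t \<longrightarrow> 0 \<le> s \<longrightarrow> X s \<omega> = left_limit X t \<omega>)"
  proof (cases "0 < t")
    case True
    with \<omega> show ?thesis using left_constant[OF \<omega> True] by metis
  next
    case False
    with t show ?thesis by (intro exI[of _ 1]) auto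
  qed
  then obtain \<epsilon>2 where 2: "0 < \<epsilon>2" "0 < t \<Longrightarrow> \<epsilon>2 \<le> t"
      "\<And>s. t - \<epsilon>2 < s \<Longrightarrow> s < t \<Longrightarrow> 0 \<le> s \<Longrightarrow> X s \<omega> = left_limit X t \<omega>"
    by blast
  show thesis
  proof (rule that[of "min \<epsilon>1 \<epsilon>2"])
    show "0 < min \<epsilon>1 \<epsilon>2" using 1(1) 2(1) by simp
  next
    fix s assume "t \<le> s" "s < t + min \<epsilon>1 \<epsilon>2"
    then show "X s \<omega> = X t \<omega>" using 1(2)[of s] by (cases "t = s") auto
  next
    fix s assume "t < s" "s < t + min \<epsilon>1 \<epsilon>2"
    then show "left_limit X s \<omega> = X t \<omega>"
      using t 1(2) by (intro left_limit_const_left[of t]) auto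
  next
    fix s assume "t - min \<epsilon>1 \<epsilon>2 < s" "s < t" "0 \<le> s"
    then show "X s \<omega> = left_limit X t \<omega>" using 2(3)[of s] by simp
  next
    fix s assume s: "t - min \<epsilon>1 \<epsilon>2 < s" "s < t" "0 \<le> s"
    show "left_limit X s \<omega> = left_limit X t \<omega>"
    \<comment> \<open>At time 0 the left limit is the initial value by convention, and time 0 itself
      lies in the interval of constancy.\<close>
    proof (cases "s = 0")
      case True
      then have "X s \<omega> = left_limit X t \<omega>" using 2(3)[of s] s by simp
      then show ?thesis using True by (simp add: left_limit_def)
    next
      case False
      then show ?thesis
        using s 2(3) by (intro left_limit_const_left[of "max 0 (t - \<epsilon>2)"]) auto
    qed
  qed
qed

section \<open>Jump times and sums over jumps\<close>

definition jump_times :: "real \<Rightarrow> real \<Rightarrow> 'w \<Rightarrow> real set" where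
  "jump_times a b \<omega> = {s \<in> {a<..b}. jump X s \<omega> \<noteq> 0}"

text \<open>The end values are recorded as well, so that a function of them that vanishes on the
  diagonal equals the sum of its values over the jumps in between.\<close>

definition at_most_one_jump :: "real \<Rightarrow> real \<Rightarrow> 'w \<Rightarrow> bool" where
  "at_most_one_jump a b \<omega> \<longleftrightarrow> jump_times a b \<omega> = {} \<and> X b \<omega> = X a \<omega> \<or>
     (\<exists>s. jump_times a b \<omega> = {s} \<and> left_limit X s \<omega> = X a \<omega> \<and> X b \<omega> = X s \<omega>)"

text \<open>A Lebesgue number of the neighbourhoods on which the path is constant on either side.\<close>

lemma mesh:
  assumes \<omega>: "\<omega> \<in> \<Omega>"
  obtains \<delta> where "0 < \<delta>"
    "\<And>a b. 0 \<le> a \<Longrightarrow> a \<le> b \<Longrightarrow> b \<le> t \<Longrightarrow> b - a < \<delta> \<Longrightarrow> at_most_one_jump a b \<omega>"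
proof -
  define loc where "loc u \<epsilon> \<longleftrightarrow> 0 < \<epsilon> \<and> (\<forall>s. u \<le> s \<longrightarrow> s < u + \<epsilon> \<longrightarrow> X s \<omega> = X u \<omega>) \<and>
      (\<forall>s. u < s \<longrightarrow> s < u + \<epsilon> \<longrightarrow> left_limit X s \<omega> = X u \<omega>) \<and>
      (\<forall>s. u - \<epsilon> < s \<longrightarrow> s < u \<longrightarrow> 0 \<le> s \<longrightarrow> X s \<omega> = left_limit X u \<omega>) \<and>
      (\<forall>s. u - \<epsilon> < s \<longrightarrow> s < u \<longrightarrow> 0 \<le> s \<longrightarrow> left_limit X s \<omega> = left_limit X u \<omega>)" for u \<epsilon>
  have "\<exists>\<epsilon>. loc u \<epsilon>" if "0 \<le> u" for u
    unfolding loc_def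
    by (rule local_structure[OF \<omega> that], rule exI, intro conjI allI impI)
  then have "\<forall>u. \<exists>\<epsilon>. 0 \<le> u \<longrightarrow> loc u \<epsilon>" by blast
  from choice[OF this] obtain \<epsilon> where loc: "\<And>u. 0 \<le> u \<Longrightarrow> loc u (\<epsilon> u)" by blast
  have \<epsilon>: "\<And>u. 0 \<le> u \<Longrightarrow> 0 < \<epsilon> u"
    "\<And>u s. 0 \<le> u \<Longrightarrow> u \<le> s \<Longrightarrow> s < u + \<epsilon> u \<Longrightarrow> X s \<omega> = X u \<omega>"
    "\<And>u s. 0 \<le> u \<Longrightarrow> u < s \<Longrightarrow> s < u + \<epsilon> u \<Longrightarrow> left_limit X s \<omega> = X u \<omega>"
    "\<And>u s. 0 \<le> u \<Longrightarrow> u - \<epsilon> u < s \<Longrightarrow> s < u \<Longrightarrow> 0 \<le> s \<Longrightarrow> X s \<omega> = left_limit X u \<omega>"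
    "\<And>u s. 0 \<le> u \<Longrightarrow> u - \<epsilon> u < s \<Longrightarrow> s < u \<Longrightarrow> 0 \<le> s \<Longrightarrow> left_limit X s \<omega> = left_limit X u \<omega>"
    using loc unfolding loc_def by blast+
  have local: "at_most_one_jump a b \<omega>"
    if u: "0 \<le> u" and ab: "0 \<le> a" "a \<le> b" "u - \<epsilon> u < a" "b < u + \<epsilon> u" for a b u
  proof -
    have jump0: "jump X s \<omega> = 0" if "a < s" "s \<le> b" "s \<noteq> u" for s
    proof (cases "s < u")
      case True
      then show ?thesis using \<epsilon>(4)[OF u, of s] \<epsilon>(5)[OF u, of s] that ab by (simp add: jump_def)
    next
      case False
      then show ?thesis using \<epsilon>(2)[OF u, of s] \<epsilon>(3)[OF u, of s] that ab by (simp add: jump_def)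
    qed
    show ?thesis
    proof (cases "a < u \<and> u \<le> b")
      case True
      then have "X a \<omega> = left_limit X u \<omega>" "X b \<omega> = X u \<omega>"
        using \<epsilon>(4)[OF u, of a] \<epsilon>(2)[OF u, of b] ab by auto
      moreover have "jump_times a b \<omega> = (if jump X u \<omega> = 0 then {} else {u})"
        using True jump0 by (auto simp: jump_times_def)
      ultimately show ?thesis by (auto simp: jump_def at_most_one_jump_def)
    next
      case False
      then have "jump_times a b \<omega> = {}" using jump0 by (auto simp: jump_times_def)
      moreover have "X b \<omega> = X a \<omega>"
      proof (cases "u \<le> a")
        case True
        then show ?thesis using \<epsilon>(2)[OF u, of a] \<epsilon>(2)[OF u, of b] ab by simp
      next
        case False': False
        then have "b < u" using False by simp
        then show ?thesis using False' \<epsilon>(4)[OF u, of a] \<epsilon>(4)[OF u, of b] ab by simp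
      qed
      ultimately show ?thesis by (simp add: at_most_one_jump_def)
    qed
  qed
  obtain e where e: "0 < e" "\<And>x. x \<in> {0..t} \<Longrightarrow> \<exists>G\<in>(\<lambda>u. ball u (\<epsilon> u)) ` {0..t}. ball x e \<subseteq> G"
  proof (rule Heine_Borel_lemma[of "{0..t}" "(\<lambda>u. ball u (\<epsilon> u)) ` {0..t}"])
    show "{0..t} \<subseteq> \<Union> ((\<lambda>u. ball u (\<epsilon> u)) ` {0..t})" using \<epsilon>(1) by force
  qed auto
  show thesis
  proof (rule that[OF e(1)])
    fix a b assume ab: "0 \<le> a" "a \<le> b" "b \<le> t" "b - a < e"
    then obtain u where u: "u \<in> {0..t}" "ball a e \<subseteq> ball u (\<epsilon> u)" using e(2)[of a] by auto
    have "a \<in> ball u (\<epsilon> u)" "b \<in> ball u (\<epsilon> u)"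
      using ab u e(1) by (auto simp: subset_iff dist_real_def)
    then show "at_most_one_jump a b \<omega>"
      using ab u by (intro local[of u]) (auto simp: dist_real_def abs_if split: if_splits)
  qed
qed

lemma jump_times_split:
  "a \<le> b \<Longrightarrow> b \<le> c \<Longrightarrow> jump_times a c \<omega> = jump_times a b \<omega> \<union> jump_times b c \<omega>"
  "jump_times a b \<omega> \<inter> jump_times b c \<omega> = {}"
  by (auto simp: jump_times_def)

text \<open>Once the partition is finer than the number from \<open>mesh\<close>, every interval
  contains at most one jump, which leads from the left end value to the right one; an interval
  without jump contributes \<open>g x x = 0\<close>. The partition sums depend on finitely many
  values of the path, which later gives adaptedness of jump counts.\<close>

lemma jump_sum_partition_aux:
  fixes g :: "'a \<Rightarrow> 'a \<Rightarrow> real" and t :: real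
  assumes \<omega>: "\<omega> \<in> \<Omega>" and t: "0 \<le> t"
  shows "finite (jump_times 0 t \<omega>) \<and>
    ((\<forall>x. g x x = 0) \<longrightarrow> (\<forall>\<^sub>F n in sequentially.
      (\<Sum>i<n. g (X (t * i / n) \<omega>) (X (t * Suc i / n) \<omega>))
      = (\<Sum>s\<in>jump_times 0 t \<omega>. g (left_limit X s \<omega>) (X s \<omega>))))"
proof -
  obtain \<delta> where \<delta>: "0 < \<delta>"
    "\<And>a b. 0 \<le> a \<Longrightarrow> a \<le> b \<Longrightarrow> b \<le> t \<Longrightarrow> b - a < \<delta> \<Longrightarrow> at_most_one_jump a b \<omega>"
    using mesh[OF \<omega>] by blast
  have main: "finite (jump_times 0 (t * m / n) \<omega>) \<and> ((\<forall>x. g x x = 0) \<longrightarrow>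
      (\<Sum>i<m. g (X (t * i / n) \<omega>) (X (t * Suc i / n) \<omega>))
      = (\<Sum>s\<in>jump_times 0 (t * m / n) \<omega>. g (left_limit X s \<omega>) (X s \<omega>)))"
    if n: "0 < n" "t / n < \<delta>" and "m \<le> n" for m n :: nat
    using that(3)
  proof (induction m)
    case 0
    then show ?case by (simp add: jump_times_def)
  next
    case (Suc m)
    define a where "a = t * m / n"
    define b where "b = t * Suc m / n"
    have ab: "0 \<le> a" "a \<le> b" "b \<le> t" "b - a < \<delta>"
    proof -
      show "0 \<le> a" "a \<le> b" using t by (auto simp: a_def b_def divide_right_mono mult_left_mono)
      have "t * Suc m \<le> t * n" using t Suc.prems by (intro mult_left_mono) auto
      then show "b \<le> t" using n by (simp add: b_def divide_simps)
      have "b - a = t / n" by (simp add: a_def b_def diff_divide_distrib[symmetric] algebra_simps)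
      then show "b - a < \<delta>" using n by simp
    qed
    have IH: "finite (jump_times 0 a \<omega>)" "(\<forall>x. g x x = 0) \<Longrightarrow>
      (\<Sum>i<m. g (X (t * i / n) \<omega>) (X (t * Suc i / n) \<omega>))
      = (\<Sum>s\<in>jump_times 0 a \<omega>. g (left_limit X s \<omega>) (X s \<omega>))"
      using Suc by (auto simp: a_def)
    note split = jump_times_split(1)[OF ab(1,2), of \<omega>] jump_times_split(2)[of 0 a \<omega> b]
    from \<delta>(2)[OF ab, unfolded at_most_one_jump_def] have fin: "finite (jump_times a b \<omega>)"
      and step: "(\<forall>x. g x x = 0) \<Longrightarrow> g (X a \<omega>) (X b \<omega>) = (\<Sum>s\<in>jump_times a b \<omega>. g (left_limit X s \<omega>) (X s \<omega>))"
      by auto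
    have "(\<Sum>i<Suc m. g (X (t * i / n) \<omega>) (X (t * Suc i / n) \<omega>))
        = (\<Sum>s\<in>jump_times 0 b \<omega>. g (left_limit X s \<omega>) (X s \<omega>))" if "\<forall>x. g x x = 0"
      using IH(2)[OF that] step[OF that] IH(1) fin split
      by (simp add: sum.union_disjoint a_def[symmetric] b_def[symmetric] del: of_nat_Suc)
    then show ?case using IH fin split by (simp add: b_def[symmetric] del: of_nat_Suc)
  qed
  obtain k :: nat where k: "t / \<delta> < real k" using reals_Archimedean2 by blast
  have ok: "0 < n \<and> t / n < \<delta>" if "k \<le> n" for n :: nat
  proof -
    have "0 \<le> t / \<delta>" using t \<delta> by simp
    moreover have "t / \<delta> < real n" using k that by simp
    ultimately have "t / \<delta> < real n" "0 < n" by linarith+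
    then show ?thesis using \<delta> by (simp add: field_simps)
  qed
  have "finite (jump_times 0 t \<omega>)" using main[of k k] ok[of k] by simp
  moreover have "\<forall>\<^sub>F n in sequentially.
      (\<Sum>i<n. g (X (t * i / n) \<omega>) (X (t * Suc i / n) \<omega>))
      = (\<Sum>s\<in>jump_times 0 t \<omega>. g (left_limit X s \<omega>) (X s \<omega>))" if "\<forall>x. g x x = 0"
    unfolding eventually_sequentially
  proof (intro exI[of _ k] allI impI)
    fix n assume "k \<le> n"
    from ok[OF this] show "(\<Sum>i<n. g (X (t * i / n) \<omega>) (X (t * Suc i / n) \<omega>))
      = (\<Sum>s\<in>jump_times 0 t \<omega>. g (left_limit X s \<omega>) (X s \<omega>))"
      using main[of n n] that by simp
  qed
  ultimately show ?thesis by blast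
qed

lemma finite_jump_times:
  assumes "\<omega> \<in> \<Omega>"
  shows "finite (jump_times 0 t \<omega>)"
proof (cases "0 \<le> t")
  case True
  from jump_sum_partition_aux[OF assms this] show ?thesis by (rule conjunct1)
next
  case False
  then have "jump_times 0 t \<omega> = {}" unfolding jump_times_def by auto
  then show ?thesis by simp
qed

lemma jump_sum_partition:
  fixes g :: "'a \<Rightarrow> 'a \<Rightarrow> real" and t :: real
  assumes "\<omega> \<in> \<Omega>" "0 \<le> t" "\<And>x. g x x = 0"
  shows "\<forall>\<^sub>F n in sequentially. (\<Sum>i<n. g (X (t * i / n) \<omega>) (X (t * Suc i / n) \<omega>))
      = (\<Sum>s\<in>jump_times 0 t \<omega>. g (left_limit X s \<omega>) (X s \<omega>))"
  by (rule jump_sum_partition_aux[OF assms(1,2), THEN conjunct2, rule_format]) (rule assms(3))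

text \<open>For increments of \<open>\<phi>\<close> every partition sum telescopes, and by
  \<open>jump_sum_partition\<close> a fine one equals the sum over the jumps.\<close>

lemma jump_sum_telescope:
  fixes \<phi> :: "'a \<Rightarrow> real" and t :: real
  assumes "\<omega> \<in> \<Omega>" "0 \<le> t"
  shows "(\<Sum>s\<in>jump_times 0 t \<omega>. \<phi> (X s \<omega>) - \<phi> (left_limit X s \<omega>)) = \<phi> (X t \<omega>) - \<phi> (X 0 \<omega>)"
proof -
  have "\<forall>\<^sub>F n in sequentially. n > 0 \<and> (\<Sum>i<n. \<phi> (X (t * Suc i / n) \<omega>) - \<phi> (X (t * i / n) \<omega>))
      = (\<Sum>s\<in>jump_times 0 t \<omega>. \<phi> (X s \<omega>) - \<phi> (left_limit X s \<omega>))"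
    using jump_sum_partition[OF assms, of "\<lambda>x y. \<phi> y - \<phi> x"] eventually_gt_at_top[of 0]
    by (simp add: eventually_conj_iff)
  from eventually_happens'[OF sequentially_bot this] obtain n :: nat where n: "n > 0"
      "(\<Sum>i<n. \<phi> (X (t * Suc i / n) \<omega>) - \<phi> (X (t * i / n) \<omega>))
      = (\<Sum>s\<in>jump_times 0 t \<omega>. \<phi> (X s \<omega>) - \<phi> (left_limit X s \<omega>))"
    by blast
  have "(\<Sum>i<n. \<phi> (X (t * Suc i / n) \<omega>) - \<phi> (X (t * i / n) \<omega>)) = \<phi> (X t \<omega>) - \<phi> (X 0 \<omega>)"
    using sum_lessThan_telescope[of "\<lambda>i. \<phi> (X (t * real i / n) \<omega>)" n] n(1) by simp
  with n show ?thesis by simp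
qed

end

section \<open>Predictable processes and cadlag paths\<close>

lemma predictable_sigma_generator:
  "{{(\<omega>, t) \<in> space (Ft 0) \<times> {0..}. H t \<omega> \<in> U} | (H :: real \<Rightarrow> 'w \<Rightarrow> real) U.
        adapted Ft H \<and> (\<forall>\<omega>\<in>space (Ft 0). \<forall>t>0. continuous (at_left t) (\<lambda>s. H s \<omega>)) \<and>
        U \<in> sets borel} \<subseteq> Pow (space (Ft 0) \<times> {0..})"
  by auto

lemma space_predictable_sigma [simp]: "space (predictable_sigma Ft) = space (Ft 0) \<times> {0..}"
  unfolding predictable_sigma_def by (rule space_measure_of[OF predictable_sigma_generator])

lemma measurable_predictable_sigma:
  fixes H :: "real \<Rightarrow> 'w \<Rightarrow> real"
  assumes "adapted Ft H"
    and "\<And>\<omega> t. \<omega> \<in> space (Ft 0) \<Longrightarrow> 0 < t \<Longrightarrow> continuous (at_left t) (\<lambda>s. H s \<omega>)"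
  shows "(\<lambda>(\<omega>, t). H t \<omega>) \<in> borel_measurable (predictable_sigma Ft)"
proof (rule measurableI)
  fix U :: "real set" assume "U \<in> sets borel"
  then have "{(\<omega>, t) \<in> space (Ft 0) \<times> {0..}. H t \<omega> \<in> U} \<in> sets (predictable_sigma Ft)"
    unfolding predictable_sigma_def sets_measure_of[OF predictable_sigma_generator]
    using assms by (intro sigma_sets.Basic) blast
  also have "{(\<omega>, t) \<in> space (Ft 0) \<times> {0..}. H t \<omega> \<in> U}
      = (\<lambda>(\<omega>, t). H t \<omega>) -` U \<inter> space (predictable_sigma Ft)" by auto
  finally show "(\<lambda>(\<omega>, t). H t \<omega>) -` U \<inter> space (predictable_sigma Ft) \<in> sets (predictable_sigma Ft)" .
qed simp

lemma measurable_into_predictable_sigma: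
  assumes "f \<in> space N \<rightarrow> space (Ft 0) \<times> {0..}"
    and sets: "\<And>(H :: real \<Rightarrow> 'w \<Rightarrow> real) U. adapted Ft H \<Longrightarrow>
      \<forall>\<omega>\<in>space (Ft 0). \<forall>t>0. continuous (at_left t) (\<lambda>s. H s \<omega>) \<Longrightarrow> U \<in> sets borel \<Longrightarrow>
      (\<lambda>x. H (snd (f x)) (fst (f x))) -` U \<inter> space N \<in> sets N"
  shows "f \<in> N \<rightarrow>\<^sub>M predictable_sigma Ft"
  unfolding predictable_sigma_def
proof (rule measurable_measure_of[OF predictable_sigma_generator])
  show "f \<in> space N \<rightarrow> space (Ft 0) \<times> {0..}" by (rule assms(1))
  fix Y assume "Y \<in> {{(\<omega>, t) \<in> space (Ft 0) \<times> {0..}. H t \<omega> \<in> U} | (H :: real \<Rightarrow> 'w \<Rightarrow> real) U.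
        adapted Ft H \<and> (\<forall>\<omega>\<in>space (Ft 0). \<forall>t>0. continuous (at_left t) (\<lambda>s. H s \<omega>)) \<and>
        U \<in> sets borel}"
  then obtain H :: "real \<Rightarrow> 'w \<Rightarrow> real" and U
    where Y: "Y = {(\<omega>, t) \<in> space (Ft 0) \<times> {0..}. H t \<omega> \<in> U}"
      and H: "adapted Ft H" "\<forall>\<omega>\<in>space (Ft 0). \<forall>t>0. continuous (at_left t) (\<lambda>s. H s \<omega>)" "U \<in> sets borel"
    by blast
  have "f -` Y \<inter> space N = (\<lambda>x. H (snd (f x)) (fst (f x))) -` U \<inter> space N"
    using assms(1) by (force simp: Y Pi_iff)
  with sets[OF H] show "f -` Y \<inter> space N \<in> sets N" by simp
qed

text \<open>Composition with this section shows that predictable processes are adapted.\<close>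

lemma adapted_section_measurable:
  assumes "0 \<le> t" "space (Ft t) = space (Ft 0)"
  shows "(\<lambda>\<omega>. (\<omega>, t)) \<in> Ft t \<rightarrow>\<^sub>M predictable_sigma Ft"
proof (rule measurable_into_predictable_sigma)
  show "(\<lambda>\<omega>. (\<omega>, t)) \<in> space (Ft t) \<rightarrow> space (Ft 0) \<times> {0..}" using assms by auto
  fix H :: "real \<Rightarrow> 'a \<Rightarrow> real" and U :: "real set" assume "adapted Ft H" and U: "U \<in> sets borel"
  then have "H t \<in> borel_measurable (Ft t)" using assms by (simp add: adapted_def)
  from measurable_sets[OF this U]
  show "(\<lambda>\<omega>. H (snd (\<omega>, t)) (fst (\<omega>, t))) -` U \<inter> space (Ft t) \<in> sets (Ft t)" by simp
qed

lemma left_continuous_measurable: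
  fixes f :: "real \<Rightarrow> real"
  assumes cont: "\<And>t. 0 < t \<Longrightarrow> continuous (at_left t) f"
  shows "f \<in> borel_measurable (restrict_space borel {0..})"
proof (rule borel_measurable_LIMSEQ_real)
  \<comment> \<open>The last grid point strictly before \<open>s\<close>; only values to the left
    may be used. The maximum with 0 takes effect only at \<open>s = 0\<close>.\<close>
  define r where "r n s = max 0 ((of_int \<lceil>real (Suc n) * s\<rceil> - 1) / real (Suc n))" for n s
  show "(\<lambda>n. f (r n s)) \<longlonglongrightarrow> f s" if s: "s \<in> space (restrict_space borel {0..})" for s
  proof (cases "s = 0")
    case True
    then show ?thesis by (simp add: r_def)
  next
    case False
    then have s: "0 < s" using s by (simp add: space_restrict_space)
    have r: "r n s < s \<and> s - 1 / real (Suc n) \<le> r n s" for n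
    proof -
      have "of_int \<lceil>real (Suc n) * s\<rceil> - 1 < real (Suc n) * s" "real (Suc n) * s \<le> of_int \<lceil>real (Suc n) * s\<rceil>"
        by linarith+
      then show ?thesis using s by (auto simp: r_def field_simps less_max_iff_disj simp del: of_nat_Suc)
    qed
    have "(\<lambda>n. s - 1 / real (Suc n)) \<longlonglongrightarrow> s - 0"
      by (intro tendsto_intros LIMSEQ_Suc lim_1_over_n)
    then have lim: "(\<lambda>n. s - 1 / real (Suc n)) \<longlonglongrightarrow> s" by simp
    have "\<forall>\<^sub>F n in sequentially. s - 1 / real (Suc n) \<le> r n s" "\<forall>\<^sub>F n in sequentially. r n s \<le> s"
      using r by (intro always_eventually allI; metis less_imp_le)+
    then have "(\<lambda>n. r n s) \<longlonglongrightarrow> s"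
      using lim tendsto_const by (rule tendsto_sandwich)
    moreover have "\<forall>\<^sub>F n in sequentially. r n s \<in> {..<s} \<and> r n s \<noteq> s"
      using r by (intro always_eventually allI) (metis lessThan_iff less_irrefl)
    ultimately have "filterlim (\<lambda>n. r n s) (at_left s) sequentially"
      unfolding filterlim_at by simp
    moreover have "(f \<longlongrightarrow> f s) (at_left s)" using cont[OF s] by (simp add: continuous_within)
    ultimately show ?thesis by (rule filterlim_compose[rotated])
  qed
  show "(\<lambda>s. f (r n s)) \<in> borel_measurable (restrict_space borel {0..})" for n
  proof -
    have "(\<lambda>s. \<lceil>real (Suc n) * s\<rceil>) \<in> restrict_space borel {0..} \<rightarrow>\<^sub>M count_space UNIV"
      by (intro measurable_restrict_space1) simp
    from measurable_compose[OF this, of "\<lambda>k. f (max 0 ((of_int k - 1) / real (Suc n)))" borel]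
    show ?thesis by (simp add: r_def)
  qed
qed

text \<open>Along a fixed outcome each generator is a left-continuous function of time and hence
  Borel.\<close>

lemma path_section_measurable:
  assumes "\<omega> \<in> space (Ft 0)"
  shows "(\<lambda>s. (\<omega>, s)) \<in> restrict_space borel {0..} \<rightarrow>\<^sub>M predictable_sigma Ft"
proof (rule measurable_into_predictable_sigma)
  show "(\<lambda>s. (\<omega>, s)) \<in> space (restrict_space borel {0..}) \<rightarrow> space (Ft 0) \<times> {0..}"
    using assms by (auto simp: space_restrict_space)
  fix H :: "real \<Rightarrow> 'a \<Rightarrow> real" and U :: "real set"
  assume H: "\<forall>\<omega>\<in>space (Ft 0). \<forall>t>0. continuous (at_left t) (\<lambda>s. H s \<omega>)" and U: "U \<in> sets borel"
  have "(\<lambda>s. H s \<omega>) \<in> borel_measurable (restrict_space borel {0..})"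
    using H assms by (intro left_continuous_measurable) blast
  from measurable_sets[OF this U]
  show "(\<lambda>s. H (snd (\<omega>, s)) (fst (\<omega>, s))) -` U \<inter> space (restrict_space borel {0..})
      \<in> sets (restrict_space borel {0..})" by simp
qed

section \<open>Closure properties of cadlag processes\<close>

lemma cadlag_continuous:
  assumes "\<And>\<omega>. \<omega> \<in> \<Omega> \<Longrightarrow> continuous_on {0..} (\<lambda>t. Z t \<omega>)"
  shows "cadlag \<Omega> Z"
  unfolding cadlag_def
proof (intro ballI conjI allI impI)
  fix \<omega> t assume \<omega>: "\<omega> \<in> \<Omega>" and t: "0 \<le> (t::real)"
  then have "continuous (at t within {0..}) (\<lambda>t. Z t \<omega>)" using assms by (simp add: continuous_on_eq_continuous_within)
  then show "continuous (at_right t) (\<lambda>s. Z s \<omega>)" by (rule continuous_within_subset) (use t in auto)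
next
  fix \<omega> t assume \<omega>: "\<omega> \<in> \<Omega>" and t: "0 < (t::real)"
  then have "continuous (at t within {0..}) (\<lambda>t. Z t \<omega>)" using assms by (simp add: continuous_on_eq_continuous_within)
  then have "((\<lambda>t. Z t \<omega>) \<longlongrightarrow> Z t \<omega>) (at t within {0..})" by (simp add: continuous_within)
  moreover have "at t within {0..} = at t" using t by (intro at_within_interior) simp
  ultimately have "((\<lambda>t. Z t \<omega>) \<longlongrightarrow> Z t \<omega>) (at t)" by simp
  then have "((\<lambda>t. Z t \<omega>) \<longlongrightarrow> Z t \<omega>) (at_left t)" by (rule tendsto_within_subset) simp
  then show "\<exists>l. ((\<lambda>s. Z s \<omega>) \<longlongrightarrow> l) (at_left t)" by blast
qed

lemma cadlag_compose:
  assumes "cadlag \<Omega> Z" "continuous_on UNIV f"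
  shows "cadlag \<Omega> (\<lambda>t \<omega>. f (Z t \<omega>))"
proof -
  have f: "((\<lambda>s. f (Z s \<omega>)) \<longlongrightarrow> f l) G" if "((\<lambda>s. Z s \<omega>) \<longlongrightarrow> l) G" for l G \<omega>
    using continuous_on_tendsto_compose[OF assms(2) that] by simp
  show ?thesis
    using assms(1) unfolding cadlag_def continuous_within by (blast intro: f)
qed

lemma cadlag_const: "cadlag \<Omega> (\<lambda>t \<omega>. c)"
  unfolding cadlag_def using continuous_const tendsto_const by blast

lemma cadlag_add:
  fixes Y Z :: "real \<Rightarrow> 'w \<Rightarrow> 'a::real_normed_vector"
  assumes "cadlag \<Omega> Y" "cadlag \<Omega> Z"
  shows "cadlag \<Omega> (\<lambda>t \<omega>. Y t \<omega> + Z t \<omega>)"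
  unfolding cadlag_def
proof (intro ballI conjI allI impI)
  fix \<omega> t assume "\<omega> \<in> \<Omega>" "0 \<le> (t::real)"
  then show "continuous (at_right t) (\<lambda>s. Y s \<omega> + Z s \<omega>)"
    using assms unfolding cadlag_def by (intro continuous_add) blast+
next
  fix \<omega> t assume *: "\<omega> \<in> \<Omega>" "0 < (t::real)"
  obtain k where k: "((\<lambda>s. Y s \<omega>) \<longlongrightarrow> k) (at_left t)" using assms(1) * unfolding cadlag_def by blast
  obtain l where l: "((\<lambda>s. Z s \<omega>) \<longlongrightarrow> l) (at_left t)" using assms(2) * unfolding cadlag_def by blast
  from tendsto_add[OF k l] show "\<exists>l. ((\<lambda>s. Y s \<omega> + Z s \<omega>) \<longlongrightarrow> l) (at_left t)" by (rule exI)
qed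

lemma cadlag_cmult:
  fixes Z :: "real \<Rightarrow> 'w \<Rightarrow> real"
  assumes "cadlag \<Omega> Z"
  shows "cadlag \<Omega> (\<lambda>t \<omega>. c * Z t \<omega>)"
  using assms by (rule cadlag_compose) (intro continuous_intros)

lemma cadlag_cong:
  assumes "\<And>\<omega> t. \<omega> \<in> \<Omega> \<Longrightarrow> 0 \<le> t \<Longrightarrow> Y t \<omega> = Z t \<omega>" "cadlag \<Omega> Y"
  shows "cadlag \<Omega> Z"
  unfolding cadlag_def
proof (intro ballI conjI allI impI)
  fix \<omega> t assume \<omega>: "\<omega> \<in> \<Omega>" and t: "0 \<le> (t::real)"
  then have "((\<lambda>s. Y s \<omega>) \<longlongrightarrow> Y t \<omega>) (at_right t)"
    using assms(2) unfolding cadlag_def continuous_within by blast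
  moreover have "\<forall>\<^sub>F s in at_right t. Y s \<omega> = Z s \<omega>"
    using eventually_at_right_less[of t] by eventually_elim (use assms(1) \<omega> t in auto)
  ultimately have "((\<lambda>s. Z s \<omega>) \<longlongrightarrow> Y t \<omega>) (at_right t)" by (rule Lim_transform_eventually)
  then show "continuous (at_right t) (\<lambda>s. Z s \<omega>)"
    using assms(1)[OF \<omega> t] by (simp add: continuous_within)
next
  fix \<omega> t assume \<omega>: "\<omega> \<in> \<Omega>" and t: "0 < (t::real)"
  then obtain l where "((\<lambda>s. Y s \<omega>) \<longlongrightarrow> l) (at_left t)"
    using assms(2) unfolding cadlag_def by blast
  moreover have "\<forall>\<^sub>F s in at_left t. 0 < s"
    using t by (simp add: eventually_at_left_field) (use dense in blast)
  then have "\<forall>\<^sub>F s in at_left t. Y s \<omega> = Z s \<omega>"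
    by eventually_elim (use assms(1) \<omega> in auto)
  ultimately have "((\<lambda>s. Z s \<omega>) \<longlongrightarrow> l) (at_left t)" by (rule Lim_transform_eventually)
  then show "\<exists>l. ((\<lambda>s. Z s \<omega>) \<longlongrightarrow> l) (at_left t)" by blast
qed

section \<open>Counting jumps and occupation times\<close>

context finite_valued_process
begin

text \<open>The set of jump times up to \<open>t\<close> does not change immediately after
  \<open>t\<close>, and immediately before \<open>t\<close> it lacks only \<open>t\<close> itself.
  Hence an arbitrary functional of it is locally constant on both sides.\<close>

lemma cadlag_jump_functional:
  fixes h :: "real set \<Rightarrow> 'w \<Rightarrow> 'b::t2_space"
  shows "cadlag \<Omega> (\<lambda>t \<omega>. h (jump_times 0 t \<omega>) \<omega>)"
  unfolding cadlag_def
proof (intro ballI conjI allI impI)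
  fix \<omega> t assume \<omega>: "\<omega> \<in> \<Omega>" and t: "0 \<le> (t::real)"
  obtain \<epsilon> where \<epsilon>: "0 < \<epsilon>" "\<And>s. t \<le> s \<Longrightarrow> s < t + \<epsilon> \<Longrightarrow> X s \<omega> = X t \<omega>"
    "\<And>s. t < s \<Longrightarrow> s < t + \<epsilon> \<Longrightarrow> left_limit X s \<omega> = X t \<omega>"
    using local_structure[OF \<omega> t] by metis
  have no_jump: "jump X r \<omega> = 0" if "t < r" "r < t + \<epsilon>" for r
    using \<epsilon>(2)[of r] \<epsilon>(3)[of r] that by (simp add: jump_def)
  have const: "jump_times 0 s \<omega> = jump_times 0 t \<omega>" if "t < s" "s < t + \<epsilon>" for s
  proof -
    have "jump_times t s \<omega> = {}" using no_jump that by (auto simp: jump_times_def)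
    then show ?thesis using jump_times_split(1)[of 0 t s \<omega>] t that by simp
  qed
  have "((\<lambda>s. h (jump_times 0 s \<omega>) \<omega>) \<longlongrightarrow> h (jump_times 0 t \<omega>) \<omega>) (at_right t)"
    by (rule tendsto_eventually, unfold eventually_at_right_field)
      (rule exI[of _ "t + \<epsilon>"], use \<epsilon>(1) const in auto)
  then show "continuous (at_right t) (\<lambda>s. h (jump_times 0 s \<omega>) \<omega>)" by (simp add: continuous_within)
next
  fix \<omega> t assume \<omega>: "\<omega> \<in> \<Omega>" and t: "0 < (t::real)"
  obtain \<epsilon> where \<epsilon>: "0 < \<epsilon>"
    "\<And>s. t - \<epsilon> < s \<Longrightarrow> s < t \<Longrightarrow> 0 \<le> s \<Longrightarrow> X s \<omega> = left_limit X t \<omega>"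
    "\<And>s. t - \<epsilon> < s \<Longrightarrow> s < t \<Longrightarrow> 0 \<le> s \<Longrightarrow> left_limit X s \<omega> = left_limit X t \<omega>"
    using local_structure[OF \<omega> less_imp_le[OF t]] by metis
  have no_jump: "jump X r \<omega> = 0" if "t - \<epsilon> < r" "r < t" "0 \<le> r" for r
    using \<epsilon>(2)[of r] \<epsilon>(3)[of r] that by (simp add: jump_def)
  have const: "jump_times 0 s \<omega> = jump_times 0 t \<omega> - {t}" if "max 0 (t - \<epsilon>) < s" "s < t" for s
  proof -
    have "jump_times s t \<omega> \<subseteq> {t}"
    proof
      fix r assume "r \<in> jump_times s t \<omega>"
      then have "s < r" "r \<le> t" "jump X r \<omega> \<noteq> 0" by (auto simp: jump_times_def)
      then show "r \<in> {t}" using no_jump[of r] that by (cases "r = t") auto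
    qed
    moreover have "t \<notin> jump_times 0 s \<omega>" using that by (simp add: jump_times_def)
    ultimately show ?thesis using jump_times_split(1)[of 0 s t \<omega>] that by auto
  qed
  have "((\<lambda>s. h (jump_times 0 s \<omega>) \<omega>) \<longlongrightarrow> h (jump_times 0 t \<omega> - {t}) \<omega>) (at_left t)"
    by (rule tendsto_eventually, unfold eventually_at_left_field)
      (rule exI[of _ "max 0 (t - \<epsilon>)"], use \<epsilon>(1) t const in auto)
  then show "\<exists>l. ((\<lambda>s. h (jump_times 0 s \<omega>) \<omega>) \<longlongrightarrow> l) (at_left t)" by blast
qed

text \<open>Visits are recorded by left limits: this makes them predictable and matches the kernel,
  which is evaluated at the left limit.\<close>

definition visit_times :: "'a \<Rightarrow> real \<Rightarrow> real \<Rightarrow> 'w \<Rightarrow> real set" where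
  "visit_times x u t \<omega> = {s \<in> {u<..t}. left_limit X s \<omega> = x}"

definition jumps_from :: "'a \<Rightarrow> 'a set \<Rightarrow> real \<Rightarrow> real \<Rightarrow> 'w \<Rightarrow> real set" where
  "jumps_from x D u t \<omega> = {s \<in> jump_times u t \<omega>. left_limit X s \<omega> = x \<and> jump X s \<omega> \<in> D}"

lemma finite_jump_times': "\<omega> \<in> \<Omega> \<Longrightarrow> 0 \<le> u \<Longrightarrow> finite (jump_times u t \<omega>)"
  by (rule finite_subset[OF _ finite_jump_times[of \<omega> t]]) (auto simp: jump_times_def)

end

text \<open>One law \<open>Q\<close> with the compensator of the jumps for a general kernel
  \<open>K\<close>. It serves both to read rates off the compensator and to build the
  characteristics of linear functionals.\<close>

locale finite_jump_process =
  fixes M Q :: "'w measure" and Ft :: "real \<Rightarrow> 'w measure"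
    and X :: "real \<Rightarrow> 'w \<Rightarrow> 'a::euclidean_space" and E :: "'a set"
    and K :: "'a \<Rightarrow> 'a measure" and \<nu> :: "'w \<Rightarrow> (real \<times> 'a) measure"
  assumes filtration: "right_continuous_filtration M Ft"
    and adapted_X: "adapted Ft X" and cadlag_X: "cadlag (space M) X"
    and X_in_E: "\<And>\<omega> t. \<omega> \<in> space M \<Longrightarrow> 0 \<le> t \<Longrightarrow> X t \<omega> \<in> E" and finite_E: "finite E"
    and prob_Q: "prob_space Q" and sets_Q: "sets Q = sets M"
    and comp: "compensator Q Ft (jump_measure X) \<nu>"
    and kernel: "\<And>\<omega> A. \<omega> \<in> space Q \<Longrightarrow> A \<in> sets borel \<Longrightarrow> emeasure (\<nu> \<omega>) A =
        (\<integral>\<^sup>+ t. emeasure (K (left_limit X t \<omega>)) {\<xi>. (t, \<xi>) \<in> A} * indicator {0..} t \<partial>lborel)"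
begin

sublocale finite_valued_process "space M" X E
  by unfold_locales (use cadlag_X X_in_E finite_E in auto)

sublocale prob_space Q by (rule prob_Q)

lemma space_Q: "space Q = space M"
  using sets_eq_imp_space_eq[OF sets_Q] .

lemma subalgebra_Ft: "0 \<le> t \<Longrightarrow> subalgebra M (Ft t)"
  using filtration[unfolded right_continuous_filtration_def, THEN conjunct1] by simp

lemma space_Ft: "0 \<le> t \<Longrightarrow> space (Ft t) = space M"
  using subalgebra_Ft by (simp add: subalgebra_def)

lemma sets_Ft: "0 \<le> t \<Longrightarrow> sets (Ft t) \<subseteq> sets M"
  using subalgebra_Ft by (simp add: subalgebra_def)

lemma sets_Ft_mono: "0 \<le> s \<Longrightarrow> s \<le> t \<Longrightarrow> sets (Ft s) \<subseteq> sets (Ft t)"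
  using filtration[unfolded right_continuous_filtration_def, THEN conjunct2, THEN conjunct1] by simp

lemma measurable_Ft_Q: "0 \<le> t \<Longrightarrow> f \<in> Ft t \<rightarrow>\<^sub>M N \<Longrightarrow> f \<in> Q \<rightarrow>\<^sub>M N"
  using sets_Ft[of t] space_Ft[of t] space_Q sets_Q by (auto simp: measurable_def)

lemma measurable_Ft_mono: "0 \<le> s \<Longrightarrow> s \<le> t \<Longrightarrow> f \<in> Ft s \<rightarrow>\<^sub>M N \<Longrightarrow> f \<in> Ft t \<rightarrow>\<^sub>M N"
  using sets_Ft_mono[of s t] space_Ft[of s] space_Ft[of t] by (auto simp: measurable_def)

lemma X_measurable:
  assumes "0 \<le> s" "s \<le> t"
  shows "X s \<in> Ft t \<rightarrow>\<^sub>M count_space E"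
proof (rule measurable_Ft_mono[OF assms])
  have "X s \<in> borel_measurable (Ft s)" using adapted_X assms by (simp add: adapted_def)
  then have "X s -` {a} \<inter> space (Ft s) \<in> sets (Ft s)" for a by (rule measurable_sets) simp
  then show "X s \<in> Ft s \<rightarrow>\<^sub>M count_space E"
    using assms X_in_E by (simp add: measurable_count_space_eq2[OF finite_E] space_Ft)
qed

text \<open>The path is constant just before \<open>t\<close>, so the left limit equals the values
  at earlier times \<open>r n\<close> for all large \<open>n\<close>; its level sets are countable
  unions of countable intersections.\<close>

lemma left_limit_measurable:
  assumes "0 \<le> t"
  shows "left_limit X t \<in> Ft t \<rightarrow>\<^sub>M count_space E"
proof (cases "t = 0")
  case True
  then have "left_limit X t = X 0" by (auto simp: left_limit_def)
  then show ?thesis using X_measurable[of 0 t] assms by simp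
next
  case False
  then have t: "0 < t" using assms by simp
  define r where "r n = t - t / real (Suc n)" for n
  have r: "0 \<le> r n" "r n \<le> t" "r n < t" for n using t by (auto simp: r_def divide_simps)
  have ev: "\<forall>\<^sub>F n in sequentially. X (r n) \<omega> = left_limit X t \<omega>" if \<omega>: "\<omega> \<in> space M" for \<omega>
  proof -
    obtain \<epsilon> where \<epsilon>: "0 < \<epsilon>" "\<And>s. t - \<epsilon> < s \<Longrightarrow> s < t \<Longrightarrow> X s \<omega> = left_limit X t \<omega>"
      using left_constant[OF \<omega> t] by metis
    have "(\<lambda>n. t - t * (1 / real (Suc n))) \<longlonglongrightarrow> t - t * 0"
      by (intro tendsto_intros LIMSEQ_Suc lim_1_over_n)
    then have "r \<longlonglongrightarrow> t" by (simp add: r_def[abs_def])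
    then have "\<forall>\<^sub>F n in sequentially. t - \<epsilon> < r n" using \<epsilon>(1) by (intro order_tendstoD) auto
    then show ?thesis by eventually_elim (use \<epsilon>(2) r in auto)
  qed
  have "left_limit X t -` {a} \<inter> space (Ft t) = (\<Union>m. \<Inter>n\<in>{m..}. X (r n) -` {a} \<inter> space (Ft t))" for a
  proof (intro set_eqI)
    fix \<omega>
    show "\<omega> \<in> left_limit X t -` {a} \<inter> space (Ft t) \<longleftrightarrow> \<omega> \<in> (\<Union>m. \<Inter>n\<in>{m..}. X (r n) -` {a} \<inter> space (Ft t))"
    proof (cases "\<omega> \<in> space M")
      case True
      obtain N where N: "\<And>n. N \<le> n \<Longrightarrow> X (r n) \<omega> = left_limit X t \<omega>"
        using ev[OF True] by (auto simp: eventually_sequentially)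
      have "(\<exists>m. \<forall>n\<ge>m. X (r n) \<omega> = a) \<longleftrightarrow> left_limit X t \<omega> = a"
      proof
        assume "\<exists>m. \<forall>n\<ge>m. X (r n) \<omega> = a"
        then obtain m where "\<forall>n\<ge>m. X (r n) \<omega> = a" by blast
        then have "X (r (max m N)) \<omega> = a" by simp
        then show "left_limit X t \<omega> = a" using N[of "max m N"] by simp
      next
        assume "left_limit X t \<omega> = a"
        then show "\<exists>m. \<forall>n\<ge>m. X (r n) \<omega> = a" using N by (intro exI[of _ N]) simp
      qed
      then show ?thesis using True assms by (auto simp: space_Ft)
    next
      case False
      then show ?thesis using assms by (auto simp: space_Ft)
    qed
  qed
  note eq = this
  have mem: "X (r n) -` {a} \<inter> space (Ft t) \<in> sets (Ft t)" for n a
  proof -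
    have "{a} \<inter> E \<in> sets (count_space E)" by simp
    from measurable_sets[OF X_measurable[OF r(1,2)] this]
    have "X (r n) -` ({a} \<inter> E) \<inter> space (Ft t) \<in> sets (Ft t)" .
    also have "X (r n) -` ({a} \<inter> E) \<inter> space (Ft t) = X (r n) -` {a} \<inter> space (Ft t)"
      using X_in_E r assms by (auto simp: space_Ft)
    finally show ?thesis .
  qed
  have "left_limit X t -` {a} \<inter> space (Ft t) \<in> sets (Ft t)" for a
    unfolding eq by (rule sets.countable_UN) (auto intro!: sets.countable_INT' simp: mem simp del: INT_simps UN_simps)
  then show ?thesis
    using assms left_limit_in_E by (simp add: measurable_count_space_eq2[OF finite_E] space_Ft)
qed

section \<open>Testing the compensator on visits to a state\<close>

definition visit_set :: "'w set \<Rightarrow> real \<Rightarrow> real \<Rightarrow> 'a \<Rightarrow> ('w \<times> real) set" where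
  "visit_set A u T x = {(\<omega>, s). \<omega> \<in> A \<and> 0 \<le> s \<and> u < s \<and> s \<le> T \<and> left_limit X s \<omega> = x}"

text \<open>The indicator is left-continuous, since left limits are locally constant from the left
  and the time interval contains its right end. It is adapted because \<open>A\<close> only matters
  at times after \<open>u\<close>.\<close>

lemma visit_set_predictable:
  assumes u: "0 \<le> u" and A: "A \<in> sets (Ft u)"
  shows "visit_set A u T x \<in> sets (predictable_sigma Ft)"
proof -
  define H :: "real \<Rightarrow> 'w \<Rightarrow> real"
    where "H s \<omega> = of_bool (u < s \<and> s \<le> T \<and> \<omega> \<in> A \<and> left_limit X s \<omega> = x)" for s \<omega>
  have AM: "A \<subseteq> space M" using A sets.sets_into_space[OF A] u by (simp add: space_Ft)
  have "adapted Ft H"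
    unfolding adapted_def
  proof (intro allI impI)
    fix s :: real assume s: "0 \<le> s"
    show "H s \<in> borel_measurable (Ft s)"
    proof (cases "u < s \<and> s \<le> T")
      case True
      have "left_limit X s -` ({x} \<inter> E) \<inter> space (Ft s) \<in> sets (Ft s)"
        by (rule measurable_sets[OF left_limit_measurable[OF s]]) simp
      moreover have "A \<in> sets (Ft s)" using A sets_Ft_mono[of u s] u True by auto
      ultimately have "A \<inter> (left_limit X s -` ({x} \<inter> E) \<inter> space (Ft s)) \<in> sets (Ft s)" by blast
      moreover have "H s = indicator (A \<inter> (left_limit X s -` ({x} \<inter> E) \<inter> space (Ft s)))"
        using True AM left_limit_in_E s by (auto simp: H_def fun_eq_iff space_Ft indicator_def)
      ultimately show ?thesis by simp
    next
      case False
      then have "H s = (\<lambda>_. 0)" by (auto simp: H_def)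
      then show ?thesis by simp
    qed
  qed
  moreover have "continuous (at_left t) (\<lambda>s. H s \<omega>)" if "\<omega> \<in> space (Ft 0)" and t: "0 < t" for \<omega> t
  proof -
    have \<omega>: "\<omega> \<in> space M" using that by (simp add: space_Ft)
    obtain \<epsilon> where \<epsilon>: "0 < \<epsilon>"
      "\<And>s. t - \<epsilon> < s \<Longrightarrow> s < t \<Longrightarrow> 0 \<le> s \<Longrightarrow> left_limit X s \<omega> = left_limit X t \<omega>"
      using local_structure[OF \<omega> less_imp_le[OF t]] by metis
    \<comment> \<open>If \<open>u\<close> or \<open>T\<close> lies to the left of \<open>t\<close>,
      the interval from \<open>b\<close> to \<open>t\<close> avoids it, so the time constraints do
      not change there.\<close>
    define b where "b = max (max 0 (t - \<epsilon>)) (max (if u < t then u else 0) (if T < t then T else 0))"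
    have "b < t" using t \<epsilon>(1) by (simp add: b_def)
    moreover have "H s \<omega> = H t \<omega>" if "b < s" "s < t" for s
    proof -
      have "left_limit X s \<omega> = left_limit X t \<omega>" using that \<epsilon> by (auto simp: b_def)
      moreover have "u < s \<longleftrightarrow> u < t" "s \<le> T \<longleftrightarrow> t \<le> T" using that by (auto simp: b_def split: if_splits)
      ultimately show ?thesis by (simp add: H_def)
    qed
    ultimately have "\<forall>\<^sub>F s in at_left t. H s \<omega> = H t \<omega>" unfolding eventually_at_left_field by blast
    then show ?thesis unfolding continuous_within by (rule tendsto_eventually)
  qed
  ultimately have "(\<lambda>(\<omega>, t). H t \<omega>) \<in> borel_measurable (predictable_sigma Ft)"
    by (rule measurable_predictable_sigma)
  then have "(\<lambda>(\<omega>, t). H t \<omega>) -` {1} \<inter> space (predictable_sigma Ft) \<in> sets (predictable_sigma Ft)"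
    by (rule measurable_sets) simp
  also have "(\<lambda>(\<omega>, t). H t \<omega>) -` {1} \<inter> space (predictable_sigma Ft) = visit_set A u T x"
    using AM by (auto simp: H_def visit_set_def space_Ft)
  finally show ?thesis .
qed

lemma visit_times_borel:
  assumes "\<omega> \<in> space M" "0 \<le> u"
  shows "visit_times x u T \<omega> \<in> sets borel"
proof -
  have "space M \<in> sets (Ft u)" using sets.top[of "Ft u"] assms by (simp add: space_Ft)
  note G = visit_set_predictable[OF assms(2) this, of T x]
  have "\<omega> \<in> space (Ft 0)" using assms by (simp add: space_Ft)
  from measurable_sets[OF path_section_measurable[of \<omega> Ft, OF this] G]
  have "(\<lambda>s. (\<omega>, s)) -` visit_set (space M) u T x \<inter> {0..} \<in> sets borel"
    by (simp add: space_restrict_space sets_restrict_space_iff)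
  also have "(\<lambda>s. (\<omega>, s)) -` visit_set (space M) u T x \<inter> {0..} = visit_times x u T \<omega>"
    using assms by (auto simp: visit_set_def visit_times_def)
  finally show ?thesis .
qed

lemma visit_integrand:
  assumes "\<omega> \<in> space M" "0 \<le> u"
  shows "indicator (visit_set A u T x) (\<omega>, s) * indicator D \<xi> * indicator {0..} s
    = (indicator A \<omega> * indicator (visit_times x u T \<omega> \<times> D) (s, \<xi>) :: ennreal)"
  using assms by (auto simp: visit_set_def visit_times_def indicator_def)

lemma jump_measure_visits:
  assumes \<omega>: "\<omega> \<in> space M" and u: "0 \<le> u" and D: "D \<in> sets borel"
  shows "random_integral (\<lambda>(p, \<xi>). indicator (visit_set A u T x) p * indicator D \<xi>) (jump_measure X) {0..} \<omega>
    = indicator A \<omega> * of_nat (card (jumps_from x D u T \<omega>))"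
proof -
  have VD: "visit_times x u T \<omega> \<times> D \<in> sets borel"
    using visit_times_borel[OF \<omega> u, of x T] D by (metis borel_prod pair_measureI)
  have "random_integral (\<lambda>(p, \<xi>). indicator (visit_set A u T x) p * indicator D \<xi>) (jump_measure X) {0..} \<omega>
      = (\<integral>\<^sup>+ p. indicator A \<omega> * indicator (visit_times x u T \<omega> \<times> D) p \<partial>jump_measure X \<omega>)"
    unfolding random_integral_def
    by (intro nn_integral_cong) (simp add: visit_integrand[OF \<omega> u] split: prod.splits)
  also have "\<dots> = indicator A \<omega> * emeasure (jump_measure X \<omega>) (visit_times x u T \<omega> \<times> D)"
    using VD by (intro nn_integral_cmult_indicator) (simp add: jump_measure_def)
  also have "emeasure (jump_measure X \<omega>) (visit_times x u T \<omega> \<times> D) =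
      emeasure (count_space {t. 0 < t \<and> jump X t \<omega> \<noteq> 0})
        (jumps_from x D u T \<omega>)"
    unfolding jump_measure_def using VD u
    by (subst emeasure_distr) (auto simp: jumps_from_def jump_times_def visit_times_def intro!: arg_cong2[where f = emeasure])
  also have "\<dots> = of_nat (card (jumps_from x D u T \<omega>))"
    using u by (intro emeasure_count_space_finite finite_subset[OF _ finite_jump_times'[OF \<omega> u, of T]])
      (auto simp: jumps_from_def jump_times_def)
  finally show ?thesis .
qed

text \<open>During visits to \<open>x\<close> the kernel is constantly \<open>K x\<close>, so the
  compensator reduces to a rate multiplied by the time spent in \<open>x\<close>.\<close>

lemma compensator_visits:
  assumes \<omega>: "\<omega> \<in> space M" and u: "0 \<le> u" and D: "D \<in> sets borel"
  shows "random_integral (\<lambda>(p, \<xi>). indicator (visit_set A u T x) p * indicator D \<xi>) \<nu> {0..} \<omega>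
    = indicator A \<omega> * (emeasure (K x) D * emeasure lborel (visit_times x u T \<omega>))"
proof -
  have VD: "visit_times x u T \<omega> \<times> D \<in> sets borel"
    using visit_times_borel[OF \<omega> u, of x T] D by (metis borel_prod pair_measureI)
  have sets: "sets (\<nu> \<omega>) = sets borel" using comp \<omega> by (simp add: compensator_def space_Q)
  have "random_integral (\<lambda>(p, \<xi>). indicator (visit_set A u T x) p * indicator D \<xi>) \<nu> {0..} \<omega>
      = (\<integral>\<^sup>+ p. indicator A \<omega> * indicator (visit_times x u T \<omega> \<times> D) p \<partial>\<nu> \<omega>)"
    unfolding random_integral_def
    by (intro nn_integral_cong) (simp add: visit_integrand[OF \<omega> u] split: prod.splits)
  also have "\<dots> = indicator A \<omega> * emeasure (\<nu> \<omega>) (visit_times x u T \<omega> \<times> D)"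
    using VD by (intro nn_integral_cmult_indicator) (simp add: sets)
  also have "emeasure (\<nu> \<omega>) (visit_times x u T \<omega> \<times> D) =
     (\<integral>\<^sup>+ t. emeasure (K (left_limit X t \<omega>)) {\<xi>. (t, \<xi>) \<in> visit_times x u T \<omega> \<times> D} * indicator {0..} t \<partial>lborel)"
    using \<omega> VD by (intro kernel) (simp_all add: space_Q)
  also have "\<dots> = (\<integral>\<^sup>+ t. emeasure (K x) D * indicator (visit_times x u T \<omega>) t \<partial>lborel)"
    using u by (intro nn_integral_cong) (auto simp: visit_times_def indicator_def)
  also have "\<dots> = emeasure (K x) D * emeasure lborel (visit_times x u T \<omega>)"
    using visit_times_borel[OF \<omega> u] by (intro nn_integral_cmult_indicator) simp
  finally show ?thesis .
qed

lemma visit_weight_measurable: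
  assumes "0 \<le> u" "A \<in> sets (Ft u)" "D \<in> sets borel"
  shows "(\<lambda>(p, \<xi>). indicator (visit_set A u T x) p * indicator D \<xi> :: ennreal)
    \<in> borel_measurable (predictable_sigma Ft \<Otimes>\<^sub>M borel)"
  using visit_set_predictable[OF assms(1,2), of T x] assms(3) by measurable

text \<open>The compensator identity for the weight that restricts to the event \<open>A\<close>, to
  visits of \<open>x\<close> and to jump sizes in \<open>D\<close>. Allowing \<open>A\<close> from
  \<open>Ft u\<close> gives a conditional statement, the source of the martingale property
  below.\<close>

lemma expected_jumps:
  assumes u: "0 \<le> u" and A: "A \<in> sets (Ft u)" and D: "D \<in> sets borel"
  shows "(\<integral>\<^sup>+ \<omega>. indicator A \<omega> * of_nat (card (jumps_from x D u T \<omega>)) \<partial>Q)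
    = (\<integral>\<^sup>+ \<omega>. indicator A \<omega> * (emeasure (K x) D * emeasure lborel (visit_times x u T \<omega>)) \<partial>Q)" (is "?L = ?R")
proof -
  let ?W = "\<lambda>(p, \<xi>). indicator (visit_set A u T x) p * indicator D \<xi> :: ennreal"
  have "?L = (\<integral>\<^sup>+ \<omega>. random_integral ?W (jump_measure X) {0..} \<omega> \<partial>Q)"
    by (intro nn_integral_cong, subst jump_measure_visits) (use u D in \<open>auto simp: space_Q\<close>)
  also have "\<dots> = (\<integral>\<^sup>+ \<omega>. random_integral ?W \<nu> {0..} \<omega> \<partial>Q)"
    using comp visit_weight_measurable[OF assms] unfolding compensator_def by metis
  also have "\<dots> = ?R"
    by (intro nn_integral_cong, subst compensator_visits) (use u D in \<open>auto simp: space_Q\<close>)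
  finally show ?thesis .
qed

text \<open>The weight vanishes after time \<open>t\<close>, so its compensator integral up to
  \<open>t\<close> is already the full one. The former is predictable by definition of the
  compensator, hence adapted.\<close>

lemma compensator_visits_measurable:
  assumes t: "0 \<le> t" and D: "D \<in> sets borel"
  shows "(\<lambda>\<omega>. emeasure (K x) D * emeasure lborel (visit_times x 0 t \<omega>)) \<in> borel_measurable (Ft t)"
proof -
  let ?W = "\<lambda>(p, \<xi>). indicator (visit_set (space M) 0 t x) p * indicator D \<xi> :: ennreal"
  have "space M \<in> sets (Ft 0)" using sets.top[of "Ft 0"] by (simp add: space_Ft)
  then have "?W \<in> borel_measurable (predictable_sigma Ft \<Otimes>\<^sub>M borel)"
    using D by (intro visit_weight_measurable) auto
  then have "predictable Ft (\<lambda>t. random_integral ?W \<nu> {0..t})"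
    using comp unfolding compensator_def by blast
  then have "(\<lambda>(\<omega>, t). random_integral ?W \<nu> {0..t} \<omega>) \<in> borel_measurable (predictable_sigma Ft)"
    by (simp add: predictable_def)
  from measurable_compose[OF adapted_section_measurable this, of t]
  have "(\<lambda>\<omega>. random_integral ?W \<nu> {0..t} \<omega>) \<in> borel_measurable (Ft t)"
    using t by (simp add: space_Ft)
  also have "?this \<longleftrightarrow> ?thesis"
  proof (rule measurable_cong)
    fix \<omega> assume "\<omega> \<in> space (Ft t)"
    then have \<omega>: "\<omega> \<in> space M" using t by (simp add: space_Ft)
    have "random_integral ?W \<nu> {0..t} \<omega> = random_integral ?W \<nu> {0..} \<omega>"
      unfolding random_integral_def
      by (intro nn_integral_cong) (auto simp: visit_set_def indicator_def)
    then show "random_integral ?W \<nu> {0..t} \<omega> = emeasure (K x) D * emeasure lborel (visit_times x 0 t \<omega>)"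
      using compensator_visits[OF \<omega> _ D, of 0 "space M" t x] \<omega> by simp
  qed
  finally show ?thesis .
qed

end

lemma lipschitz_paths_continuous:
  fixes Z :: "real \<Rightarrow> 'w \<Rightarrow> real"
  assumes "\<And>\<omega> u t. \<omega> \<in> \<Omega> \<Longrightarrow> 0 \<le> u \<Longrightarrow> u \<le> t \<Longrightarrow> \<bar>Z t \<omega> - Z u \<omega>\<bar> \<le> C * (t - u)"
  shows "\<omega> \<in> \<Omega> \<Longrightarrow> continuous_on {0..} (\<lambda>t. Z t \<omega>)"
proof -
  assume \<omega>: "\<omega> \<in> \<Omega>"
  have "0 \<le> C" using assms[OF \<omega>, of 0 1] by simp
  moreover have "\<bar>Z t \<omega> - Z u \<omega>\<bar> \<le> C * \<bar>t - u\<bar>" if "0 \<le> t" "0 \<le> u" for t u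
    using assms[OF \<omega>, of u t] assms[OF \<omega>, of t u] that by (cases "u \<le> t") (auto simp: abs_minus_commute)
  ultimately have "C-lipschitz_on {0..} (\<lambda>t. Z t \<omega>)"
    by (intro lipschitz_onI) (auto simp: dist_real_def)
  then show ?thesis by (rule lipschitz_on_continuous_on)
qed

context finite_jump_process
begin

lemma subalgebra_Q: "0 \<le> t \<Longrightarrow> subalgebra Q (Ft t)"
  using subalgebra_Ft[of t] sets_Q by (simp add: subalgebra_def space_Q)

lemma sigma_finite_subalgebra_Q: "0 \<le> t \<Longrightarrow> sigma_finite_subalgebra Q (Ft t)"
  by (intro finite_measure_subalgebra_is_sigma_finite finite_measure_subalgebra.intro
      finite_measure_axioms finite_measure_subalgebra_axioms.intro subalgebra_Q)

lemma visit_times_measure: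
  assumes "\<omega> \<in> space M" "0 \<le> u" "u \<le> t"
  shows "emeasure lborel (visit_times x u t \<omega>) = ennreal (measure lborel (visit_times x u t \<omega>))"
    and "measure lborel (visit_times x u t \<omega>) \<le> t - u"
proof -
  have sub: "visit_times x u t \<omega> \<subseteq> {u<..t}" by (auto simp: visit_times_def)
  then have le: "emeasure lborel (visit_times x u t \<omega>) \<le> ennreal (t - u)"
    using emeasure_mono[OF sub, of lborel] assms by simp
  then have "emeasure lborel (visit_times x u t \<omega>) < top" by (simp add: le_less_trans)
  then show *: "emeasure lborel (visit_times x u t \<omega>) = ennreal (measure lborel (visit_times x u t \<omega>))"
    by (simp add: emeasure_eq_ennreal_measure)
  show "measure lborel (visit_times x u t \<omega>) \<le> t - u"
    using le assms unfolding * by simp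
qed

section \<open>Compensated jump counts\<close>

definition jump_count :: "'a \<Rightarrow> 'a \<Rightarrow> real \<Rightarrow> 'w \<Rightarrow> real" where
  "jump_count x y t \<omega> = real (card {s \<in> jump_times 0 t \<omega>. left_limit X s \<omega> = x \<and> X s \<omega> = y})"

definition occupation :: "'a \<Rightarrow> real \<Rightarrow> 'w \<Rightarrow> real" where
  "occupation x t \<omega> = measure lborel (visit_times x 0 t \<omega>)"

definition compensated_count :: "'a \<Rightarrow> 'a \<Rightarrow> real \<Rightarrow> 'w \<Rightarrow> real" where
  "compensated_count x y t \<omega> = jump_count x y t \<omega> - measure (K x) {y - x} * occupation x t \<omega>"

lemma jump_target: "left_limit X s \<omega> = x \<and> X s \<omega> = y \<longleftrightarrow> left_limit X s \<omega> = x \<and> jump X s \<omega> \<in> {y - x}"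
  by (auto simp: jump_def)

lemma jump_count_diff:
  assumes "\<omega> \<in> space M" "0 \<le> u" "u \<le> t"
  shows "jump_count x y t \<omega> - jump_count x y u \<omega>
    = real (card (jumps_from x {y - x} u t \<omega>))"
proof -
  have "{s \<in> jump_times 0 t \<omega>. left_limit X s \<omega> = x \<and> X s \<omega> = y}
      = {s \<in> jump_times 0 u \<omega>. left_limit X s \<omega> = x \<and> X s \<omega> = y}
        \<union> {s \<in> jump_times u t \<omega>. left_limit X s \<omega> = x \<and> X s \<omega> = y}"
    using jump_times_split(1)[OF assms(2,3), of \<omega>] by auto
  moreover have "card ({s \<in> jump_times 0 u \<omega>. left_limit X s \<omega> = x \<and> X s \<omega> = y}
        \<union> {s \<in> jump_times u t \<omega>. left_limit X s \<omega> = x \<and> X s \<omega> = y})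
      = card {s \<in> jump_times 0 u \<omega>. left_limit X s \<omega> = x \<and> X s \<omega> = y}
        + card {s \<in> jump_times u t \<omega>. left_limit X s \<omega> = x \<and> X s \<omega> = y}"
    using finite_jump_times'[OF assms(1), of 0 u] finite_jump_times'[OF assms(1,2), of t]
      jump_times_split(2)[of 0 u \<omega> t]
    by (intro card_Un_disjoint) auto
  ultimately show ?thesis unfolding jump_count_def jumps_from_def jump_target by simp
qed

lemma occupation_diff:
  assumes "\<omega> \<in> space M" "0 \<le> u" "u \<le> t"
  shows "occupation x t \<omega> - occupation x u \<omega> = measure lborel (visit_times x u t \<omega>)"
proof -
  have "visit_times x 0 t \<omega> = visit_times x 0 u \<omega> \<union> visit_times x u t \<omega>"
    using assms by (auto simp: visit_times_def)
  moreover have "measure lborel (visit_times x 0 u \<omega> \<union> visit_times x u t \<omega>)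
      = measure lborel (visit_times x 0 u \<omega>) + measure lborel (visit_times x u t \<omega>)"
    using assms visit_times_borel[OF assms(1)] visit_times_measure(1)[OF assms(1)]
    by (intro measure_Union) (auto simp: visit_times_def)
  ultimately show ?thesis by (simp add: occupation_def)
qed

lemma occupation_lipschitz:
  assumes "\<omega> \<in> space M" "0 \<le> u" "u \<le> t"
  shows "\<bar>occupation x t \<omega> - occupation x u \<omega>\<bar> \<le> t - u"
  using visit_times_measure(2)[OF assms, of x] by (simp add: occupation_diff[OF assms])

text \<open>The count is the limit of partition sums that involve only states at times up to
  \<open>t\<close>. The hypothesis \<open>x \<noteq> y\<close> makes intervals without jump
  contribute 0.\<close>

lemma jump_count_adapted:
  assumes "x \<noteq> y" "0 \<le> t"
  shows "jump_count x y t \<in> borel_measurable (Ft t)"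
proof -
  define g :: "'a \<Rightarrow> 'a \<Rightarrow> real" where "g a b = of_bool (a = x) * of_bool (b = y)" for a b
  show ?thesis
  proof (rule borel_measurable_LIMSEQ_real)
    fix \<omega> assume "\<omega> \<in> space (Ft t)"
    then have \<omega>: "\<omega> \<in> space M" using assms by (simp add: space_Ft)
    have "(\<Sum>s\<in>jump_times 0 t \<omega>. g (left_limit X s \<omega>) (X s \<omega>))
        = (\<Sum>s\<in>jump_times 0 t \<omega>. if left_limit X s \<omega> = x \<and> X s \<omega> = y then 1 else 0)"
      by (intro sum.cong) (auto simp: g_def)
    also have "\<dots> = jump_count x y t \<omega>"
      using finite_jump_times[OF \<omega>] by (simp add: jump_count_def sum.If_cases Int_def)
    finally have "jump_count x y t \<omega> = (\<Sum>s\<in>jump_times 0 t \<omega>. g (left_limit X s \<omega>) (X s \<omega>))" ..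
    moreover have "g a a = 0" for a using assms(1) by (simp add: g_def)
    ultimately show "(\<lambda>n. \<Sum>i<n. g (X (t * i / n) \<omega>) (X (t * Suc i / n) \<omega>)) \<longlonglongrightarrow> jump_count x y t \<omega>"
      using jump_sum_partition[OF \<omega> assms(2), of g] by (intro tendsto_eventually) simp
  next
    fix n
    have "(\<lambda>\<omega>. of_bool (X r \<omega> = z) :: real) \<in> borel_measurable (Ft t)" if "0 \<le> r" "r \<le> t" for r z
      using measurable_compose[OF X_measurable[OF that], of "\<lambda>a. of_bool (a = z)" borel] by simp
    moreover have "0 \<le> t * real i / real n" "t * real i / real n \<le> t" if "i \<le> n" for i
      using that assms(2) mult_left_mono[of "real i" "real n" t] by (cases "n = 0"; simp add: divide_simps)+
    ultimately show "(\<lambda>\<omega>. \<Sum>i<n. g (X (t * i / n) \<omega>) (X (t * Suc i / n) \<omega>)) \<in> borel_measurable (Ft t)"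
      unfolding g_def by (intro borel_measurable_sum borel_measurable_times) (simp_all only: lessThan_iff less_imp_le Suc_leI)
  qed
qed

lemma rate_occupation_adapted:
  assumes "0 \<le> t" "D \<in> sets borel"
  shows "(\<lambda>\<omega>. measure (K x) D * occupation x t \<omega>) \<in> borel_measurable (Ft t)"
proof -
  have "(\<lambda>\<omega>. enn2real (emeasure (K x) D * emeasure lborel (visit_times x 0 t \<omega>))) \<in> borel_measurable (Ft t)"
    using compensator_visits_measurable[OF assms] by (rule measurable_compose) simp
  then show ?thesis
    by (simp add: enn2real_mult measure_def occupation_def)
qed

text \<open>This is the martingale property of \<open>compensated_count\<close> tested on
  \<open>A\<close>, in the form of nonnegative integrals, where integrability is not yet an
  issue.\<close>

lemma integral_increment:
  assumes "0 \<le> u" "u \<le> t" "x \<noteq> y" and A: "A \<in> sets (Ft u)"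
    and fin: "emeasure (K x) {y - x} < \<infinity>"
  shows "(\<integral>\<^sup>+ \<omega>. ennreal (indicator A \<omega> * (jump_count x y t \<omega> - jump_count x y u \<omega>)) \<partial>Q)
      = (\<integral>\<^sup>+ \<omega>. ennreal (indicator A \<omega> * (measure (K x) {y - x} * (occupation x t \<omega> - occupation x u \<omega>))) \<partial>Q)"
    (is "?L = ?R")
proof -
  have K: "emeasure (K x) {y - x} = ennreal (measure (K x) {y - x})"
    using fin by (simp add: emeasure_eq_ennreal_measure)
  have "?L = (\<integral>\<^sup>+ \<omega>. indicator A \<omega> * of_nat (card (jumps_from x {y - x} u t \<omega>)) \<partial>Q)"
    by (intro nn_integral_cong, subst jump_count_diff)
      (use assms in \<open>auto simp: space_Q ennreal_of_nat_eq_real_of_nat indicator_def\<close>)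
  also have "\<dots> = (\<integral>\<^sup>+ \<omega>. indicator A \<omega> * (emeasure (K x) {y - x} * emeasure lborel (visit_times x u t \<omega>)) \<partial>Q)"
    by (rule expected_jumps) (use assms in auto)
  also have "\<dots> = ?R"
    by (intro nn_integral_cong, subst visit_times_measure, simp_all add: assms space_Q K)
      (subst occupation_diff, simp_all add: assms ennreal_mult indicator_def)
  finally show ?thesis .
qed

lemma occupation_0: "occupation x 0 \<omega> = 0" and jump_count_0: "jump_count x y 0 \<omega> = 0"
  by (simp_all add: occupation_def visit_times_def jump_count_def jump_times_def)

lemma integrable_rate_occupation:
  assumes "0 \<le> t"
  shows "integrable Q (\<lambda>\<omega>. measure (K x) {y - x} * occupation x t \<omega>)"
proof (rule integrable_const_bound)
  have "\<bar>occupation x t \<omega>\<bar> \<le> t" if "\<omega> \<in> space M" for \<omega>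
    using occupation_lipschitz[OF that, of 0 t x] assms by (simp add: occupation_0)
  then show "AE \<omega> in Q. norm (measure (K x) {y - x} * occupation x t \<omega>) \<le> measure (K x) {y - x} * t"
    by (intro AE_I2) (simp add: abs_mult space_Q mult_left_mono)
  show "(\<lambda>\<omega>. measure (K x) {y - x} * occupation x t \<omega>) \<in> borel_measurable Q"
    using assms by (intro measurable_Ft_Q[of t] rate_occupation_adapted) auto
qed

lemma nn_integral_jump_count:
  assumes "0 \<le> t" "x \<noteq> y" and fin: "emeasure (K x) {y - x} < \<infinity>"
  shows "(\<integral>\<^sup>+ \<omega>. ennreal (jump_count x y t \<omega>) \<partial>Q)
      = (\<integral>\<^sup>+ \<omega>. ennreal (measure (K x) {y - x} * occupation x t \<omega>) \<partial>Q)"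
proof -
  have top: "space M \<in> sets (Ft 0)" using sets.top[of "Ft 0"] by (simp add: space_Ft)
  have "(\<integral>\<^sup>+ \<omega>. ennreal (jump_count x y t \<omega>) \<partial>Q)
      = (\<integral>\<^sup>+ \<omega>. ennreal (indicator (space M) \<omega> * (jump_count x y t \<omega> - jump_count x y 0 \<omega>)) \<partial>Q)"
    by (intro nn_integral_cong) (simp add: space_Q jump_count_0)
  also have "\<dots> = (\<integral>\<^sup>+ \<omega>. ennreal (indicator (space M) \<omega> * (measure (K x) {y - x} * (occupation x t \<omega> - occupation x 0 \<omega>))) \<partial>Q)"
    using assms top by (intro integral_increment) auto
  also have "\<dots> = (\<integral>\<^sup>+ \<omega>. ennreal (measure (K x) {y - x} * occupation x t \<omega>) \<partial>Q)"
    by (intro nn_integral_cong) (simp add: space_Q occupation_0)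
  finally show ?thesis .
qed

text \<open>The number of jumps has no deterministic bound, but its expectation is that of a rate
  times an occupation time, which is at most \<open>t\<close>.\<close>

lemma integrable_jump_count:
  assumes "0 \<le> t" "x \<noteq> y" and fin: "emeasure (K x) {y - x} < \<infinity>"
  shows "integrable Q (jump_count x y t)"
proof (rule integrableI_nonneg)
  show "jump_count x y t \<in> borel_measurable Q"
    using assms by (intro measurable_Ft_Q[of t] jump_count_adapted) auto
  show "AE \<omega> in Q. 0 \<le> jump_count x y t \<omega>" by (simp add: jump_count_def)
  show "(\<integral>\<^sup>+ \<omega>. ennreal (jump_count x y t \<omega>) \<partial>Q) < \<infinity>"
    unfolding nn_integral_jump_count[OF assms]
    by (subst nn_integral_eq_integral[OF integrable_rate_occupation[OF assms(1)]]) (auto simp: occupation_def)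
qed

lemma martingale_compensated_count:
  assumes "x \<noteq> y" and fin: "emeasure (K x) {y - x} < \<infinity>"
  shows "martingale Q Ft (compensated_count x y)"
  unfolding martingale_def
proof (intro conjI allI impI)
  have meas: "compensated_count x y t \<in> borel_measurable (Ft t)" if "0 \<le> t" for t
    unfolding compensated_count_def[abs_def]
    using assms that by (intro borel_measurable_diff jump_count_adapted rate_occupation_adapted) auto
  then show "adapted Ft (compensated_count x y)" by (simp add: adapted_def)
  have int: "integrable Q (compensated_count x y t)" if "0 \<le> t" for t
    unfolding compensated_count_def[abs_def]
    using assms that by (intro Bochner_Integration.integrable_diff integrable_jump_count integrable_rate_occupation)
  then show "integrable Q (compensated_count x y t)" if "0 \<le> t" for t using that .
  have "cadlag (space M) (jump_count x y)"
    unfolding jump_count_def[abs_def]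
    by (rule cadlag_jump_functional[of "\<lambda>J \<omega>. real (card {s \<in> J. left_limit X s \<omega> = x \<and> X s \<omega> = y})"])
  moreover have "cadlag (space M) (occupation x)"
    by (intro cadlag_continuous lipschitz_paths_continuous[of "space M" _ 1]) (use occupation_lipschitz in auto)
  ultimately have "cadlag (space M) (\<lambda>t \<omega>. jump_count x y t \<omega> + (- measure (K x) {y - x}) * occupation x t \<omega>)"
    by (intro cadlag_add cadlag_cmult)
  then show "cadlag (space Q) (compensated_count x y)"
    by (simp add: compensated_count_def[abs_def] space_Q)
  fix s t :: real assume st: "0 \<le> s \<and> s \<le> t"
  interpret sub: sigma_finite_subalgebra Q "Ft s" using st by (intro sigma_finite_subalgebra_Q) simp
  show "AE \<omega> in Q. real_cond_exp Q (Ft s) (compensated_count x y t) \<omega> = compensated_count x y s \<omega>"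
  proof (rule sub.real_cond_exp_charact)
    fix A assume A: "A \<in> sets (Ft s)"
    then have AQ: "A \<in> sets Q" using sets_Ft[of s] st sets_Q by auto
    \<comment> \<open>\<open>N\<close> and \<open>L\<close> are the increments of the count and of
      its compensator on \<open>A\<close>. Both are nonnegative, so equality of the nonnegative
      integrals carries over to the Bochner integrals.\<close>
    define N where "N \<omega> = indicator A \<omega> * (jump_count x y t \<omega> - jump_count x y s \<omega>)" for \<omega>
    define L where "L \<omega> = indicator A \<omega> * (measure (K x) {y - x} * occupation x t \<omega> - measure (K x) {y - x} * occupation x s \<omega>)" for \<omega>
    have ind: "integrable Q (\<lambda>\<omega>. indicator A \<omega> * f \<omega>)" if "integrable Q f" for f :: "'w \<Rightarrow> real"
      using integrable_real_mult_indicator[OF AQ that] by (simp add: mult.commute)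
    have intN: "integrable Q N" unfolding N_def
      using assms st by (intro ind Bochner_Integration.integrable_diff integrable_jump_count) auto
    have intL: "integrable Q L" unfolding L_def
      using st by (intro ind Bochner_Integration.integrable_diff integrable_rate_occupation) auto
    have nnN: "AE \<omega> in Q. 0 \<le> N \<omega>" 
      using st by (intro AE_I2) (simp add: N_def space_Q jump_count_diff)
    have nnL: "AE \<omega> in Q. 0 \<le> L \<omega>" 
      using st by (intro AE_I2) (simp add: L_def space_Q occupation_diff right_diff_distrib[symmetric])
    have "integral\<^sup>L Q N = integral\<^sup>L Q L"
      using integral_increment[of s t x y A] st assms A
      by (simp add: integral_eq_nn_integral borel_measurable_integrable intN intL nnN nnL)
        (simp add: N_def L_def right_diff_distrib)
    then have 0: "integral\<^sup>L Q (\<lambda>\<omega>. N \<omega> - L \<omega>) = 0" using intN intL by simp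
    have i: "integrable Q (\<lambda>\<omega>. indicator A \<omega> * compensated_count x y r \<omega>)" if "0 \<le> r" for r
      using int[OF that] by (rule ind)
    have "(LINT \<omega>:A|Q. compensated_count x y t \<omega>) - (LINT \<omega>:A|Q. compensated_count x y s \<omega>)
        = integral\<^sup>L Q (\<lambda>\<omega>. indicator A \<omega> * compensated_count x y t \<omega> - indicator A \<omega> * compensated_count x y s \<omega>)"
      unfolding set_lebesgue_integral_def using i[of t] i[of s] st by simp
    also have "(\<lambda>\<omega>. indicator A \<omega> * compensated_count x y t \<omega> - indicator A \<omega> * compensated_count x y s \<omega>) = (\<lambda>\<omega>. N \<omega> - L \<omega>)"
      by (simp add: fun_eq_iff N_def L_def compensated_count_def algebra_simps)
    finally show "(LINT \<omega>:A|Q. compensated_count x y t \<omega>) = (LINT \<omega>:A|Q. compensated_count x y s \<omega>)"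
      using 0 by simp
  qed (use int meas st in auto)
qed

section \<open>Closure properties of martingales\<close>

lemma martingale_add:
  assumes "martingale Q Ft Y" "martingale Q Ft Z"
  shows "martingale Q Ft (\<lambda>t \<omega>. Y t \<omega> + Z t \<omega>)"
  unfolding martingale_def
proof (intro conjI allI impI)
  show "adapted Ft (\<lambda>t \<omega>. Y t \<omega> + Z t \<omega>)" "cadlag (space Q) (\<lambda>t \<omega>. Y t \<omega> + Z t \<omega>)"
    "\<And>t. 0 \<le> t \<Longrightarrow> integrable Q (\<lambda>\<omega>. Y t \<omega> + Z t \<omega>)"
    using assms by (auto simp: martingale_def adapted_def intro!: cadlag_add borel_measurable_add)
  fix s t :: real assume st: "0 \<le> s \<and> s \<le> t"
  interpret sub: sigma_finite_subalgebra Q "Ft s" using st by (intro sigma_finite_subalgebra_Q) simp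
  have "AE \<omega> in Q. real_cond_exp Q (Ft s) (Y t) \<omega> = Y s \<omega>" "AE \<omega> in Q. real_cond_exp Q (Ft s) (Z t) \<omega> = Z s \<omega>"
    using assms st by (auto simp: martingale_def)
  moreover have "AE \<omega> in Q. real_cond_exp Q (Ft s) (\<lambda>\<omega>. Y t \<omega> + Z t \<omega>) \<omega> = real_cond_exp Q (Ft s) (Y t) \<omega> + real_cond_exp Q (Ft s) (Z t) \<omega>"
    using assms st by (intro sub.real_cond_exp_add) (auto simp: martingale_def)
  ultimately show "AE \<omega> in Q. real_cond_exp Q (Ft s) (\<lambda>\<omega>. Y t \<omega> + Z t \<omega>) \<omega> = Y s \<omega> + Z s \<omega>"
    by eventually_elim simp
qed

lemma martingale_cmult:
  assumes "martingale Q Ft Z"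
  shows "martingale Q Ft (\<lambda>t \<omega>. c * Z t \<omega>)"
  unfolding martingale_def
proof (intro conjI allI impI)
  show "adapted Ft (\<lambda>t \<omega>. c * Z t \<omega>)" "cadlag (space Q) (\<lambda>t \<omega>. c * Z t \<omega>)"
    "\<And>t. 0 \<le> t \<Longrightarrow> integrable Q (\<lambda>\<omega>. c * Z t \<omega>)"
    using assms by (auto simp: martingale_def adapted_def intro!: cadlag_cmult borel_measurable_times)
  fix s t :: real assume st: "0 \<le> s \<and> s \<le> t"
  interpret sub: sigma_finite_subalgebra Q "Ft s" using st by (intro sigma_finite_subalgebra_Q) simp
  have "AE \<omega> in Q. real_cond_exp Q (Ft s) (Z t) \<omega> = Z s \<omega>"
    using assms st by (auto simp: martingale_def)
  moreover have "AE \<omega> in Q. real_cond_exp Q (Ft s) (\<lambda>\<omega>. c * Z t \<omega>) \<omega> = c * real_cond_exp Q (Ft s) (Z t) \<omega>"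
    using assms st by (intro sub.real_cond_exp_cmult) (auto simp: martingale_def)
  ultimately show "AE \<omega> in Q. real_cond_exp Q (Ft s) (\<lambda>\<omega>. c * Z t \<omega>) \<omega> = c * Z s \<omega>"
    by eventually_elim simp
qed

lemma martingale_zero: "martingale Q Ft (\<lambda>_ _. 0)"
  unfolding martingale_def
proof (intro conjI allI impI)
  fix s t :: real assume st: "0 \<le> s \<and> s \<le> t"
  interpret sub: sigma_finite_subalgebra Q "Ft s" using st by (intro sigma_finite_subalgebra_Q) simp
  show "AE \<omega> in Q. real_cond_exp Q (Ft s) (\<lambda>_. 0) \<omega> = 0" by (rule sub.real_cond_exp_F_meas) auto
qed (auto simp: adapted_def intro: cadlag_const)

lemma martingale_sum:
  assumes "finite I" "\<And>i. i \<in> I \<Longrightarrow> martingale Q Ft (Z i)"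
  shows "martingale Q Ft (\<lambda>t \<omega>. \<Sum>i\<in>I. Z i t \<omega>)"
  using assms by (induction I) (auto intro: martingale_zero martingale_add)

lemma martingale_cong:
  assumes eq: "\<And>\<omega> t. \<omega> \<in> space M \<Longrightarrow> 0 \<le> t \<Longrightarrow> Y t \<omega> = Z t \<omega>" and "martingale Q Ft Y"
  shows "martingale Q Ft Z"
  unfolding martingale_def
proof (intro conjI allI impI)
  have int: "integrable Q (Y t)" "Y t \<in> borel_measurable (Ft t)" if "0 \<le> t" for t
    using assms that by (auto simp: martingale_def adapted_def)
  have int': "integrable Q (Z t)" if "0 \<le> t" for t
    by (rule Bochner_Integration.integrable_cong[THEN iffD1, OF refl _ int(1)[OF that]]) (use eq that in \<open>simp add: space_Q\<close>)
  then show "integrable Q (Z t)" if "0 \<le> t" for t using that .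
  have "Z t \<in> borel_measurable (Ft t)" if "0 \<le> t" for t
    by (rule measurable_cong[THEN iffD1, OF _ int(2)[OF that]]) (use eq that in \<open>simp add: space_Ft\<close>)
  then show "adapted Ft Z" by (simp add: adapted_def)
  show "cadlag (space Q) Z"
    by (rule cadlag_cong[of _ Y]) (use assms in \<open>auto simp: space_Q martingale_def\<close>)
  fix s t :: real assume st: "0 \<le> s \<and> s \<le> t"
  interpret sub: sigma_finite_subalgebra Q "Ft s" using st by (intro sigma_finite_subalgebra_Q) simp
  have "AE \<omega> in Q. real_cond_exp Q (Ft s) (Z t) \<omega> = real_cond_exp Q (Ft s) (Y t) \<omega>"
    using st int[of t] int'[of t] eq by (intro sub.real_cond_exp_cong AE_I2) (auto simp: space_Q)
  moreover have "AE \<omega> in Q. real_cond_exp Q (Ft s) (Y t) \<omega> = Y s \<omega>" using assms st by (auto simp: martingale_def)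
  moreover have "AE \<omega> in Q. Y s \<omega> = Z s \<omega>" using eq st by (intro AE_I2) (auto simp: space_Q)
  ultimately show "AE \<omega> in Q. real_cond_exp Q (Ft s) (Z t) \<omega> = Z s \<omega>" by eventually_elim simp
qed

lemma local_martingale_if_martingale:
  assumes "martingale Q Ft Z"
  shows "local_martingale Q Ft Z"
  unfolding local_martingale_def
proof (intro conjI exI[of _ "\<lambda>_ _. \<infinity>"] allI)
  have "stopped (\<lambda>_. \<infinity>) Z = Z" by (simp add: stopped_def fun_eq_iff)
  then show "martingale Q Ft (stopped (\<lambda>_. \<infinity>) Z)" using assms by simp
qed (use assms in \<open>auto simp: martingale_def ext_stopping_time_def incseq_def\<close>)

section \<open>Consequences for the kernel and for reachable states\<close>

lemma start_AE:
  assumes "measure Q {\<omega> \<in> space M. X 0 \<omega> = x} = 1"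
  shows "AE \<omega> in Q. X 0 \<omega> = x"
proof -
  have "X 0 -` ({x} \<inter> E) \<inter> space (Ft 0) \<in> sets (Ft 0)"
    by (rule measurable_sets[OF X_measurable[of 0 0]]) auto
  also have "X 0 -` ({x} \<inter> E) \<inter> space (Ft 0) = {\<omega> \<in> space Q. X 0 \<omega> = x}"
    using X_in_E by (auto simp: space_Ft space_Q)
  finally have "{\<omega> \<in> space Q. X 0 \<omega> = x} \<in> sets Q" using sets_Ft[of 0] sets_Q by auto
  then show ?thesis
    by (rule prob_Collect_eq_1[THEN iffD1]) (use assms in \<open>simp only: space_Q\<close>)
qed

text \<open>No jump can lead out of \<open>E\<close>, so the expected time spent in
  \<open>x\<close>, weighted by \<open>emeasure (K x) D\<close>, is 0. Under \<open>Q\<close> the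
  path starts in \<open>x\<close> and stays there for a while, so this time is almost surely
  positive.\<close>

lemma kernel_concentrated:
  assumes start: "measure Q {\<omega> \<in> space M. X 0 \<omega> = x} = 1"
    and D: "D \<in> sets borel" "\<And>\<xi>. \<xi> \<in> D \<Longrightarrow> x + \<xi> \<notin> E"
  shows "emeasure (K x) D = 0"
proof -
  have top: "space M \<in> sets (Ft 0)" using sets.top[of "Ft 0"] by (simp add: space_Ft)
  have none: "jumps_from x D 0 1 \<omega> = {}" if "\<omega> \<in> space M" for \<omega>
  proof -
    have "X s \<omega> \<in> E" if "0 < s" for s using X_in_E[OF \<open>\<omega> \<in> space M\<close>, of s] that by simp
    then show ?thesis using D(2) by (force simp: jumps_from_def jump_times_def jump_def)
  qed
  have "(\<integral>\<^sup>+ \<omega>. emeasure (K x) D * emeasure lborel (visit_times x 0 1 \<omega>) \<partial>Q)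
      = (\<integral>\<^sup>+ \<omega>. indicator (space M) \<omega> * (emeasure (K x) D * emeasure lborel (visit_times x 0 1 \<omega>)) \<partial>Q)"
    by (intro nn_integral_cong) (simp add: space_Q)
  also have "\<dots> = (\<integral>\<^sup>+ \<omega>. indicator (space M) \<omega> * of_nat (card (jumps_from x D 0 1 \<omega>)) \<partial>Q)"
    using top D(1) by (intro expected_jumps[symmetric]) auto
  also have "\<dots> = (\<integral>\<^sup>+ \<omega>. 0 \<partial>Q)"
    by (intro nn_integral_cong, subst none) (auto simp: space_Q)
  finally have "(\<integral>\<^sup>+ \<omega>. emeasure (K x) D * emeasure lborel (visit_times x 0 1 \<omega>) \<partial>Q) = 0" by simp
  moreover have "(\<lambda>\<omega>. emeasure (K x) D * emeasure lborel (visit_times x 0 1 \<omega>)) \<in> borel_measurable Q"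
    using D(1) by (intro measurable_Ft_Q[of 1] compensator_visits_measurable) auto
  ultimately have "AE \<omega> in Q. emeasure (K x) D * emeasure lborel (visit_times x 0 1 \<omega>) = 0"
    by (simp only: nn_integral_0_iff_AE)
  then have "AE \<omega> in Q. emeasure (K x) D = 0"
    using start_AE[OF start] AE_space
  proof eventually_elim
    case (elim \<omega>)
    then have \<omega>: "\<omega> \<in> space M" by (simp add: space_Q)
    obtain \<epsilon> where \<epsilon>: "0 < \<epsilon>" "\<And>s. 0 < s \<Longrightarrow> s < 0 + \<epsilon> \<Longrightarrow> left_limit X s \<omega> = X 0 \<omega>"
      using local_structure[OF \<omega> order_refl] by metis
    have "{0<..<min \<epsilon> 1} \<subseteq> visit_times x 0 1 \<omega>"
      using \<epsilon> elim(2) by (auto simp: visit_times_def)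
    then have "emeasure lborel {0<..<min \<epsilon> 1} \<le> emeasure lborel (visit_times x 0 1 \<omega>)"
      using visit_times_borel[OF \<omega>, of 0 x 1] by (intro emeasure_mono) auto
    moreover have "0 < emeasure lborel {0<..<min \<epsilon> 1}" using \<epsilon>(1) by simp
    ultimately have "emeasure lborel (visit_times x 0 1 \<omega>) \<noteq> 0" by auto
    then show ?case using elim(1) by simp
  qed
  then show ?thesis by simp
qed

text \<open>Each of the finitely many transitions out of \<open>A\<close> has expected number 0 up
  to every integer time. Almost surely the indicator of \<open>A\<close> therefore never decreases
  at a jump, and by telescoping it never decreases at all.\<close>

lemma stays_in_closed_set:
  assumes start: "measure Q {\<omega> \<in> space M. X 0 \<omega> = x0} = 1" and x0: "x0 \<in> A" "A \<subseteq> E"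
    and closed: "\<And>x y. x \<in> A \<Longrightarrow> y \<in> E - A \<Longrightarrow> emeasure (K x) {y - x} = 0"
    and y: "y \<notin> A"
  shows "measure Q {\<omega> \<in> space M. \<exists>t\<ge>0. X t \<omega> = y} = 0"
proof -
  have "AE \<omega> in Q. jump_count x y (real n) \<omega> = 0" if "x \<in> A" "y \<in> E - A" for x y and n :: nat
  proof -
    have K: "emeasure (K x) {y - x} = 0" using closed[OF that] .
    have ne: "x \<noteq> y" using that by auto
    have "(\<integral>\<^sup>+ \<omega>. ennreal (jump_count x y (real n) \<omega>) \<partial>Q) = 0"
      using nn_integral_jump_count[of "real n" x y] K ne by (simp add: measure_def)
    moreover have "(\<lambda>\<omega>. ennreal (jump_count x y (real n) \<omega>)) \<in> borel_measurable Q"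
      by (intro measurable_compose[OF _ measurable_ennreal] measurable_Ft_Q[of "real n"] jump_count_adapted) (use ne in auto)
    ultimately have "AE \<omega> in Q. ennreal (jump_count x y (real n) \<omega>) = 0"
      by (simp only: nn_integral_0_iff_AE)
    then show ?thesis by eventually_elim (simp add: jump_count_def)
  qed
  then have "AE \<omega> in Q. \<forall>x\<in>A. \<forall>y\<in>E - A. \<forall>n::nat. jump_count x y (real n) \<omega> = 0"
    using finite_E finite_subset[OF x0(2)] by (intro AE_finite_allI AE_all_countable[THEN iffD2] allI) auto
  then have "AE \<omega> in Q. \<forall>t\<ge>0. X t \<omega> \<in> A"
    using start_AE[OF start] AE_space
  proof eventually_elim
    case (elim \<omega>)
    then have \<omega>: "\<omega> \<in> space M" by (simp add: space_Q)
    show ?case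
    proof (intro allI impI)
      fix t :: real assume t: "0 \<le> t"
      define \<phi> where "\<phi> x = (of_bool (x \<in> A) :: real)" for x
      have "0 \<le> \<phi> (X s \<omega>) - \<phi> (left_limit X s \<omega>)" if s: "s \<in> jump_times 0 t \<omega>" for s
      proof (rule ccontr)
        assume "\<not> ?thesis"
        then have A: "left_limit X s \<omega> \<in> A" "X s \<omega> \<notin> A" by (auto simp: \<phi>_def)
        have "0 < s" using s by (simp add: jump_times_def)
        then have "X s \<omega> \<in> E - A" using A X_in_E[OF \<omega>, of s] by simp
        moreover obtain n :: nat where n: "t \<le> real n" using real_arch_simple by blast
        ultimately have zero: "jump_count (left_limit X s \<omega>) (X s \<omega>) (real n) \<omega> = 0" using elim(1) A(1) by blast
        define R where "R = {r \<in> jump_times 0 (real n) \<omega>. left_limit X r \<omega> = left_limit X s \<omega> \<and> X r \<omega> = X s \<omega>}"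
        have "s \<in> R" using s n by (simp add: jump_times_def R_def)
        moreover have "finite R" using finite_jump_times[OF \<omega>] by (simp add: R_def)
        moreover have "card R = 0" using zero by (simp only: jump_count_def R_def of_nat_eq_0_iff)
        ultimately show False by simp
      qed
      then have "0 \<le> (\<Sum>s\<in>jump_times 0 t \<omega>. \<phi> (X s \<omega>) - \<phi> (left_limit X s \<omega>))"
        by (rule sum_nonneg)
      then have "0 \<le> \<phi> (X t \<omega>) - \<phi> (X 0 \<omega>)"
        using jump_sum_telescope[OF \<omega> t, of \<phi>] by simp
      then show "X t \<omega> \<in> A" using elim(2) x0(1) by (cases "X t \<omega> \<in> A") (simp_all add: \<phi>_def)
    qed
  qed
  then have AE: "AE \<omega> in Q. \<omega> \<notin> {\<omega> \<in> space M. \<exists>t\<ge>0. X t \<omega> = y}"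
    by eventually_elim (use y in auto)
  show ?thesis
  \<comment> \<open>\<open>measure\<close> is 0 on nonmeasurable sets by convention, so both cases
    give the claim.\<close>
  proof (cases "{\<omega> \<in> space M. \<exists>t\<ge>0. X t \<omega> = y} \<in> sets Q")
    case True
    then show ?thesis using AE AE_iff_null_sets[of "{\<omega> \<in> space M. \<exists>t\<ge>0. X t \<omega> = y}" Q]
      by (simp add: measure_eq_0_null_sets)
  qed (rule measure_notin_sets)
qed

end

section \<open>Jump rates of a finite affine process\<close>

lemma affine_function_on_spanning_set:
  fixes h :: "'a::euclidean_space"
  assumes "affine hull E = UNIV" "\<And>x. x \<in> E \<Longrightarrow> h \<bullet> x = k"
  shows "h = 0"
proof -
  have "affine {x. h \<bullet> x = k}" by (rule affine_hyperplane)
  moreover have "E \<subseteq> {x. h \<bullet> x = k}" using assms(2) by blast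
  ultimately have "affine hull E \<subseteq> {x. h \<bullet> x = k}" by (rule hull_minimal[rotated])
  then have *: "h \<bullet> x = k" for x by (auto simp: assms(1))
  from *[of 0] *[of h] show ?thesis by simp
qed

lemma signed_value_not_bounded: "\<not> punctured_bounded B \<Longrightarrow> signed_value m B = 0"
  using signed_value[of m] by (auto simp: radon_difference_def)

lemma punctured_bounded_singleton: "\<xi> \<noteq> 0 \<Longrightarrow> punctured_bounded {\<xi>}"
  unfolding punctured_bounded_def by (intro conjI exI[of _ "{\<xi>}"]) auto

lemma not_punctured_bounded_0: "\<not> punctured_bounded {0}"
  by (auto simp: punctured_bounded_def)

text \<open>Evaluation at a fixed set is a linear functional of signed measures; the gradient
  represents the resulting linear functional on the state space.\<close>

lemma signed_value_affine:
  fixes F :: "real^'n \<Rightarrow> 'b::euclidean_space signed_radon"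
  assumes "affine_map F"
  obtains g where "\<And>x. signed_value (F x) B = signed_value (F 0) B + g \<bullet> x"
proof -
  define L where "L x = F x - F 0" for x
  have lin: "linear L" using assms by (simp add: affine_map_def L_def[abs_def])
  define l where "l x = signed_value (L x) B" for x
  have "linear l"
    by (rule linearI) (simp_all add: l_def linear_add[OF lin] linear_scale[OF lin] plus_signed_radon.rep_eq scaleR_signed_radon.rep_eq)
  then have "l x = adjoint l 1 \<bullet> x" for x
    using adjoint_works[of l x 1] by (simp add: inner_commute)
  moreover have "signed_value (F x) B = signed_value (F 0) B + l x" for x
  proof -
    have "F x = F 0 + L x" by (simp add: L_def)
    then show ?thesis by (simp add: l_def plus_signed_radon.rep_eq)
  qed
  ultimately show thesis using that by metis
qed

locale finite_affine_process =
  fixes M :: "'w measure" and Ft :: "real \<Rightarrow> 'w measure" and P :: "real^'n \<Rightarrow> 'w measure"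
    and E :: "(real^'n) set" and X :: "real \<Rightarrow> 'w \<Rightarrow> real^'n"
    and b :: "real^'n \<Rightarrow> real^'n" and c :: "real^'n \<Rightarrow> real^'n^'n"
    and F :: "real^'n \<Rightarrow> (real^'n) signed_radon"
  assumes affine_process: "affine_process M Ft P E X b c F"
    and finite_E: "finite E"
begin

definition kernel :: "real^'n \<Rightarrow> (real^'n) measure" where
  "kernel x = radon_measure_of (F x)"

text \<open>Read off the signed measure and not off \<open>kernel\<close>, so that it is affine on
  the whole space; on \<open>E\<close> the two agree.\<close>

definition rate :: "real^'n \<Rightarrow> real^'n \<Rightarrow> real" where
  "rate \<xi> x = signed_value (F x) {\<xi>}"

lemma setting: "stochastic_setting M Ft P E X"
  and characteristics: "affine_characteristics Ft (P ` E) E X b c F"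
  using affine_process by (auto simp: affine_process_def)

lemma finite_jump_process:
  assumes "x \<in> E"
  obtains \<nu> where "finite_jump_process M (P x) Ft X E kernel \<nu>"
proof -
  have "P x \<in> P ` E" using assms by blast
  from bspec[OF characteristics[unfolded affine_characteristics_def, THEN conjunct2, THEN conjunct2,
      THEN conjunct2, THEN conjunct2, THEN conjunct2] this]
  obtain \<nu> where \<nu>: "semimartingale_characteristics (P x) Ft X
        (\<lambda>t \<omega>. LINT s:{0..t}|lborel. b (left_limit X s \<omega>))
        (\<lambda>t \<omega>. LINT s:{0..t}|lborel. c (left_limit X s \<omega>)) \<nu>"
      "\<forall>\<omega>\<in>space (P x). \<forall>A\<in>sets borel. emeasure (\<nu> \<omega>) A =
           (\<integral>\<^sup>+ t. emeasure (radon_measure_of (F (left_limit X t \<omega>))) {\<xi>. (t, \<xi>) \<in> A}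
              * indicator {0..} t \<partial>lborel)"
    by (elim exE conjE)
  have "finite_jump_process M (P x) Ft X E kernel \<nu>"
  proof (rule finite_jump_process.intro)
    show "right_continuous_filtration M Ft" "adapted Ft X" "cadlag (space M) X" "finite E"
      "prob_space (P x)" "sets (P x) = sets M"
      using setting assms finite_E unfolding stochastic_setting_def by simp_all
    show "X t \<omega> \<in> E" if "\<omega> \<in> space M" "0 \<le> t" for \<omega> t
      using setting that unfolding stochastic_setting_def by simp
    show "compensator (P x) Ft (jump_measure X) \<nu>"
      using \<nu>(1) by (simp add: semimartingale_characteristics_def)
    show "emeasure (\<nu> \<omega>) A = (\<integral>\<^sup>+ t. emeasure (kernel (left_limit X t \<omega>)) {\<xi>. (t, \<xi>) \<in> A}
        * indicator {0..} t \<partial>lborel)" if "\<omega> \<in> space (P x)" "A \<in> sets borel" for \<omega> A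
      using \<nu>(2) that unfolding kernel_def by simp
  qed
  then show thesis by (rule that)
qed

lemma start: "x \<in> E \<Longrightarrow> measure (P x) {\<omega> \<in> space M. X 0 \<omega> = x} = 1"
  using setting by (simp add: stochastic_setting_def)

lemma represents_kernel:
  assumes "x \<in> E"
  shows "represents (kernel x) (F x)"
proof -
  have "levy_measure (F x)" using characteristics assms by (simp add: affine_characteristics_def)
  then obtain \<mu> where "represents \<mu> (F x)" by (auto simp: levy_measure_def)
  with radon_measure_of_eqI[OF this] show ?thesis by (simp add: kernel_def)
qed

lemma sets_kernel: "x \<in> E \<Longrightarrow> sets (kernel x) = sets borel"
  using represents_kernel by (simp add: represents_def punctured_radon_def)

text \<open>The singleton of the origin is not contained in a compact subset of the punctured space,
  so the default value of signed measures applies.\<close>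

lemma rate_0: "rate 0 x = 0"
  unfolding rate_def by (rule signed_value_not_bounded[OF not_punctured_bounded_0])

lemma kernel_singleton:
  assumes "x \<in> E"
  shows "emeasure (kernel x) {\<xi>} = ennreal (rate \<xi> x) \<and> 0 \<le> rate \<xi> x"
proof (cases "\<xi> = 0")
  case True
  then show ?thesis
    using represents_kernel[OF assms] by (simp add: rate_0 represents_def punctured_radon_def)
next
  case False
  note pb = punctured_bounded_singleton[OF False]
  have "rate \<xi> x = measure (kernel x) {\<xi>}"
    using represents_kernel[OF assms] pb by (simp add: rate_def represents_def)
  moreover have "emeasure (kernel x) {\<xi>} < \<infinity>"
    using represents_kernel[OF assms] punctured_radon_finite[OF _ pb] by (simp add: represents_def)
  ultimately show ?thesis by (simp add: emeasure_eq_ennreal_measure)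
qed

lemma rate_nonneg: "x \<in> E \<Longrightarrow> 0 \<le> rate \<xi> x"
  using kernel_singleton by blast

lemma kernel_outside:
  assumes "x \<in> E" "D \<in> sets borel" "\<And>\<xi>. \<xi> \<in> D \<Longrightarrow> x + \<xi> \<notin> E"
  shows "emeasure (kernel x) D = 0"
proof -
  obtain \<nu> where "finite_jump_process M (P x) Ft X E kernel \<nu>" by (rule finite_jump_process[OF assms(1)])
  then show ?thesis using start[OF assms(1)] assms(2,3) by (rule finite_jump_process.kernel_concentrated)
qed

lemma rate_support:
  assumes "x \<in> E" "rate \<xi> x \<noteq> 0"
  shows "x + \<xi> \<in> E"
proof (rule ccontr)
  assume "x + \<xi> \<notin> E"
  then have "emeasure (kernel x) {\<xi>} = 0" using assms(1) by (intro kernel_outside) auto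
  then show False using kernel_singleton[OF assms(1), of \<xi>] assms(2) by (simp add: ennreal_eq_0_iff)
qed

definition steps :: "(real^'n) set" where
  "steps = (\<lambda>(x, y). y - x) ` (E \<times> E)"

lemma finite_steps: "finite steps"
  using finite_E by (simp add: steps_def)

lemma step: "x \<in> E \<Longrightarrow> x + \<xi> \<in> E \<Longrightarrow> \<xi> \<in> steps"
  unfolding steps_def by (rule image_eqI[of _ _ "(x, x + \<xi>)"]) auto

text \<open>A jump size that is not a difference of two states would lead out of \<open>E\<close>,
  so by \<open>kernel_outside\<close> the kernel lives on the finite set
  \<open>steps\<close>.\<close>

lemma kernel_eq:
  assumes "x \<in> E" "B \<in> sets borel"
  shows "emeasure (kernel x) B = ennreal (\<Sum>\<xi>\<in>steps. rate \<xi> x * indicator B \<xi>)"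
proof -
  have fin: "finite (B \<inter> steps)" using finite_steps by simp
  have "emeasure (kernel x) (B - steps) = 0"
    using assms step finite_steps by (intro kernel_outside) (auto simp: finite_imp_closed)
  moreover have "emeasure (kernel x) B = emeasure (kernel x) (B \<inter> steps) + emeasure (kernel x) (B - steps)"
  proof -
    have "B \<inter> steps \<in> sets (kernel x)" "B - steps \<in> sets (kernel x)"
      using assms finite_steps by (auto simp: sets_kernel finite_imp_closed)
    from plus_emeasure[OF this] show ?thesis by (simp add: Int_Diff_Un Int_Diff_disjoint)
  qed
  ultimately have "emeasure (kernel x) B = emeasure (kernel x) (B \<inter> steps)" by simp
  also have "\<dots> = (\<Sum>\<xi>\<in>B \<inter> steps. emeasure (kernel x) {\<xi>})"
    using fin assms(1) by (intro emeasure_eq_sum_singleton) (auto simp: sets_kernel)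
  also have "\<dots> = (\<Sum>\<xi>\<in>B \<inter> steps. ennreal (rate \<xi> x))"
    using kernel_singleton[OF assms(1)] by simp
  also have "\<dots> = ennreal (\<Sum>\<xi>\<in>B \<inter> steps. rate \<xi> x)"
    using rate_nonneg[OF assms(1)] by (simp add: sum_ennreal)
  also have "(\<Sum>\<xi>\<in>B \<inter> steps. rate \<xi> x) = (\<Sum>\<xi>\<in>steps. rate \<xi> x * indicator B \<xi>)"
    by (subst Int_commute, subst sum.inter_restrict[OF finite_steps]) (auto simp: indicator_def intro!: sum.cong)
  finally show ?thesis .
qed

definition rate_gradient :: "real^'n \<Rightarrow> real^'n" where
  "rate_gradient \<xi> = (SOME g. \<forall>x. rate \<xi> x = rate \<xi> 0 + g \<bullet> x)"

lemma rate_affine: "rate \<xi> x = rate \<xi> 0 + rate_gradient \<xi> \<bullet> x"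
proof -
  have "affine_map F" using characteristics by (simp add: affine_characteristics_def)
  then obtain g where "\<And>x. rate \<xi> x = rate \<xi> 0 + g \<bullet> x"
    unfolding rate_def using signed_value_affine by blast
  then have "\<exists>g. \<forall>x. rate \<xi> x = rate \<xi> 0 + g \<bullet> x" by blast
  from someI_ex[OF this] show ?thesis unfolding rate_gradient_def by blast
qed

text \<open>If no jump decreased \<open>a\<close>, the states where \<open>a\<close> is maximal
  could not be left. As \<open>E\<close> spans the space, there is a state outside this set, and
  irreducibility is violated.\<close>

lemma exists_decreasing_jump:
  assumes irr: "irreducible_state_space M P E X" and span: "affine hull E = UNIV" and a: "a \<noteq> 0"
  shows "\<exists>\<xi>. (\<exists>x\<in>E. rate \<xi> x \<noteq> 0) \<and> a \<bullet> \<xi> < 0"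
proof (rule ccontr)
  assume "\<not> ?thesis"
  then have nn: "0 \<le> a \<bullet> \<xi>" if "x \<in> E" "rate \<xi> x \<noteq> 0" for x \<xi> using that by force
  have "E \<noteq> {}" using span by force
  define m where "m = Max ((\<lambda>x. a \<bullet> x) ` E)"
  have m: "a \<bullet> x \<le> m" if "x \<in> E" for x using that finite_E by (simp add: m_def)
  have "m \<in> (\<lambda>x. a \<bullet> x) ` E" unfolding m_def using finite_E \<open>E \<noteq> {}\<close> by (intro Max_in) auto
  then obtain x0 where x0: "x0 \<in> E" "a \<bullet> x0 = m" by auto
  define A where "A = {x \<in> E. a \<bullet> x = m}"
  have "E - A \<noteq> {}"
  proof
    assume "E - A = {}"
    then have "a \<bullet> x = m" if "x \<in> E" for x using that by (auto simp: A_def)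
    then have "a = 0" by (rule affine_function_on_spanning_set[OF span])
    then show False using a by contradiction
  qed
  then obtain y where y: "y \<in> E" "y \<notin> A" by blast
  obtain \<nu> where "finite_jump_process M (P x0) Ft X E kernel \<nu>" by (rule finite_jump_process[OF x0(1)])
  then interpret finite_jump_process M "P x0" Ft X E kernel \<nu> .
  have "measure (P x0) {\<omega> \<in> space M. \<exists>t\<ge>0. X t \<omega> = y} = 0"
  proof (rule stays_in_closed_set[OF start[OF x0(1)], of A])
    show "x0 \<in> A" "A \<subseteq> E" "y \<notin> A" using x0 y by (auto simp: A_def)
    fix x z assume xz: "x \<in> A" "z \<in> E - A"
    then have "x \<in> E" "a \<bullet> x = m" "a \<bullet> z < m" using m[of z] by (auto simp: A_def less_le)
    then have "rate (z - x) x = 0" using nn[of x "z - x"] by (force simp: inner_diff_right)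
    then show "emeasure (kernel x) {z - x} = 0" using kernel_singleton[OF \<open>x \<in> E\<close>, of "z - x"] by simp
  qed
  moreover have "x0 \<noteq> y" using x0 y by (auto simp: A_def)
  then have "0 < measure (P x0) {\<omega> \<in> space M. \<exists>t\<ge>0. X t \<omega> = y}"
    using irr x0(1) y(1) unfolding irreducible_state_space_def by simp
  ultimately show False by simp
qed

end

section \<open>Linear functionals of the process\<close>

text \<open>The premise makes \<open>g\<close> nondecreasing up to \<open>t\<close>, so the sums of
  its increments telescope to at most \<open>g t - g 0\<close>.\<close>

lemma finite_variation_onI:
  assumes "\<And>u v. 0 \<le> u \<Longrightarrow> u \<le> v \<Longrightarrow> v \<le> t \<Longrightarrow> \<bar>a v - a u\<bar> \<le> g v - (g u :: real)"
  shows "finite_variation_on t a"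
  unfolding finite_variation_on_def
proof (intro exI allI impI)
  fix n and p :: "nat \<Rightarrow> real" assume p: "mono p \<and> 0 \<le> p 0 \<and> p n \<le> t"
  have le: "p i \<le> p j" if "i \<le> j" for i j using p that by (simp add: mono_def)
  have "(\<Sum>i<n. \<bar>a (p (Suc i)) - a (p i)\<bar>) \<le> (\<Sum>i<n. g (p (Suc i)) - g (p i))"
  proof (rule sum_mono)
    fix i assume "i \<in> {..<n}"
    then show "\<bar>a (p (Suc i)) - a (p i)\<bar> \<le> g (p (Suc i)) - g (p i)"
      using p le[of 0 i] le[of i "Suc i"] le[of "Suc i" n] by (intro assms) auto
  qed
  also have "\<dots> = g (p n) - g (p 0)" by (rule sum_lessThan_telescope)
  also have "\<dots> \<le> g t - g 0"
    using assms[of 0 "p 0"] assms[of "p n" t] p le[of 0 n] by linarith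
  finally show "(\<Sum>i<n. \<bar>a (p (Suc i)) - a (p i)\<bar>) \<le> g t - g 0" .
qed

lemma path_integrand_measurable:
  fixes W :: "('w \<times> real) \<times> 'b::euclidean_space \<Rightarrow> ennreal"
  assumes W: "W \<in> borel_measurable (predictable_sigma Ft \<Otimes>\<^sub>M borel)"
    and \<omega>: "\<omega> \<in> space (Ft 0)" and I: "I \<in> sets borel" "I \<subseteq> {0..}"
  shows "(\<lambda>(s, \<xi>). W ((\<omega>, s), \<xi>) * indicator I s) \<in> borel_measurable borel"
proof -
  \<comment> \<open>Predictable sets live on nonnegative times; negative times are mapped to 0 and
    later cancelled by the indicator of \<open>I\<close>.\<close>
  have "(\<lambda>s::real. max 0 s) \<in> borel \<rightarrow>\<^sub>M restrict_space borel {0..}"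
    by (rule measurable_restrict_space2) auto
  from measurable_compose[OF this path_section_measurable[of \<omega> Ft, OF \<omega>]]
  have [measurable]: "(\<lambda>s. (\<omega>, max 0 s)) \<in> borel \<rightarrow>\<^sub>M predictable_sigma Ft" .
  have "(\<lambda>(s, \<xi>). W ((\<omega>, max 0 s), \<xi>) * indicator I s) \<in> borel_measurable (borel \<Otimes>\<^sub>M borel)"
    using W I(1) by measurable
  also have "(\<lambda>(s, \<xi>). W ((\<omega>, max 0 s), \<xi>) * indicator I s) = (\<lambda>(s, \<xi>). W ((\<omega>, s), \<xi>) * indicator I s)"
    using I(2) by (auto simp: fun_eq_iff indicator_def max_def)
  finally show ?thesis by (simp add: borel_prod)
qed

lemma emeasure_distr_restricted:
  fixes \<mu> :: "'a::topological_space measure" and h :: "'a \<Rightarrow> 'b::topological_space"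
  assumes \<mu>: "sets \<mu> = sets borel" and S: "S \<in> sets borel"
    and h: "h \<in> borel \<rightarrow>\<^sub>M borel" and A: "A \<in> sets borel"
  shows "emeasure (distr (density \<mu> (indicator S)) borel h) A = emeasure \<mu> (S \<inter> h -` A)"
proof -
  have hA: "h -` A \<in> sets borel" using measurable_sets[OF h A] by simp
  have "emeasure (distr (density \<mu> (indicator S)) borel h) A
      = emeasure (density \<mu> (indicator S)) (h -` A \<inter> space (density \<mu> (indicator S)))"
    using h A by (intro emeasure_distr) (simp_all add: \<mu> cong: measurable_cong_sets)
  also have "h -` A \<inter> space (density \<mu> (indicator S)) = h -` A"
    using sets_eq_imp_space_eq[OF \<mu>] by simp
  also have "emeasure (density \<mu> (indicator S)) (h -` A) = (\<integral>\<^sup>+ x. indicator S x * indicator (h -` A) x \<partial>\<mu>)"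
    using S hA by (intro emeasure_density) (simp_all add: \<mu> cong: measurable_cong_sets)
  also have "\<dots> = (\<integral>\<^sup>+ x. indicator (S \<inter> h -` A) x \<partial>\<mu>)"
    by (simp add: indicator_inter_arith)
  also have "\<dots> = emeasure \<mu> (S \<inter> h -` A)"
    using S hA by (intro nn_integral_indicator) (simp add: \<mu>)
  finally show ?thesis .
qed

definition linear_image :: "'a::euclidean_space \<Rightarrow> 'a \<Rightarrow> real^1" where
  "linear_image a x = vec (a \<bullet> x)"

text \<open>The truncation acts on the jump of the image process, hence cuts at the size of
  \<open>a \<bullet> \<xi>\<close> and not at the norm of \<open>\<xi>\<close>.\<close>

definition truncated_image :: "'a::euclidean_space \<Rightarrow> 'a \<Rightarrow> real" where
  "truncated_image a \<xi> = truncation (linear_image a \<xi>) $ 1"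

lemma linear_image_component [simp]: "linear_image a x $ i = a \<bullet> x"
  by (simp add: linear_image_def)

lemma linear_image_diff: "linear_image a (x - y) = linear_image a x - linear_image a y"
  by (simp add: vec_eq_iff inner_diff_right)

lemma linear_image_eq_0_iff [simp]: "linear_image a x = 0 \<longleftrightarrow> a \<bullet> x = 0"
  by (simp add: vec_eq_iff)

lemma continuous_linear_image: "continuous_on UNIV (linear_image a)"
  unfolding linear_image_def[abs_def] vec_def by (intro continuous_on_vec_lambda continuous_intros)

lemma linear_image_measurable [measurable]: "linear_image a \<in> borel_measurable borel"
  by (rule borel_measurable_continuous_onI[OF continuous_linear_image])

context finite_jump_process
begin

context
  fixes a :: 'a
begin

abbreviation functional :: "'a \<Rightarrow> real^1" where
  "functional \<equiv> linear_image a"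

abbreviation truncated_functional :: "'a \<Rightarrow> real" where
  "truncated_functional \<equiv> truncated_image a"

abbreviation Y :: "real \<Rightarrow> 'w \<Rightarrow> real^1" where
  "Y \<equiv> \<lambda>t \<omega>. functional (X t \<omega>)"

lemma left_limit_image:
  assumes "\<omega> \<in> space M"
  shows "left_limit Y t \<omega> = functional (left_limit X t \<omega>)"
proof (cases "0 < t")
  case True
  obtain \<epsilon> where \<epsilon>: "0 < \<epsilon>" "\<And>s. t - \<epsilon> < s \<Longrightarrow> s < t \<Longrightarrow> X s \<omega> = left_limit X t \<omega>"
    using left_constant[OF assms True] by metis
  have "((\<lambda>s. Y s \<omega>) \<longlongrightarrow> functional (left_limit X t \<omega>)) (at_left t)"
    by (rule tendsto_eventually, unfold eventually_at_left_field)
      (rule exI[of _ "t - \<epsilon>"], use \<epsilon> in auto)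
  then show ?thesis using True by (simp add: left_limit_def tendsto_Lim)
qed (simp add: left_limit_def)

lemma jump_image: "\<omega> \<in> space M \<Longrightarrow> jump Y t \<omega> = functional (jump X t \<omega>)"
  unfolding jump_def by (subst left_limit_image) (simp_all add: linear_image_diff)

lemma adapted_image: "adapted Ft Y"
  using adapted_X unfolding adapted_def by (auto intro: measurable_compose[OF _ linear_image_measurable])

lemma cadlag_image: "cadlag (space M) Y"
  by (rule cadlag_compose[OF cadlag_X continuous_linear_image])

text \<open>The increments of the functional are sums of its jumps, and the sum of the absolute
  jumps up to time \<open>t\<close> dominates them.\<close>

lemma finite_variation_image: "finite_variation_process Q Ft (\<lambda>t \<omega>. Y t \<omega> $ i - Y 0 \<omega> $ i)"
  unfolding finite_variation_process_def
proof (intro conjI ballI allI impI)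
  have "(\<lambda>\<omega>. Y t \<omega> $ i - Y 0 \<omega> $ i) \<in> borel_measurable (Ft t)" if t: "0 \<le> t" for t
    using measurable_compose[OF X_measurable[OF t order_refl], of "\<lambda>x. a \<bullet> x" borel]
      measurable_compose[OF X_measurable[OF order_refl t], of "\<lambda>x. a \<bullet> x" borel] by simp
  then show "adapted Ft (\<lambda>t \<omega>. Y t \<omega> $ i - Y 0 \<omega> $ i)" by (simp add: adapted_def)
  have "cadlag (space M) (\<lambda>t \<omega>. a \<bullet> X t \<omega>)"
    by (rule cadlag_compose[OF cadlag_X]) (intro continuous_intros)
  \<comment> \<open>One path at a time, so that the initial value to be subtracted is a
    constant.\<close>
  then have "cadlag {\<omega>} (\<lambda>t \<omega>. a \<bullet> X t \<omega>)" if "\<omega> \<in> space M" for \<omega>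
    using that unfolding cadlag_def by simp
  then have "cadlag {\<omega>} (\<lambda>t \<omega>'. a \<bullet> X t \<omega>' + - (a \<bullet> X 0 \<omega>))" if "\<omega> \<in> space M" for \<omega>
    using that by (intro cadlag_add cadlag_const)
  then show "cadlag (space Q) (\<lambda>t \<omega>. Y t \<omega> $ i - Y 0 \<omega> $ i)"
    unfolding cadlag_def space_Q by simp
  fix \<omega> assume "\<omega> \<in> space Q"
  then have \<omega>: "\<omega> \<in> space M" by (simp add: space_Q)
  show "Y 0 \<omega> $ i - Y 0 \<omega> $ i = 0" by simp
  fix t :: real assume "0 \<le> t"
  define V where "V t = (\<Sum>s\<in>jump_times 0 t \<omega>. \<bar>a \<bullet> X s \<omega> - a \<bullet> left_limit X s \<omega>\<bar>)" for t
  show "finite_variation_on t (\<lambda>s. Y s \<omega> $ i - Y 0 \<omega> $ i)"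
  proof (rule finite_variation_onI[where g = V])
    fix u v assume uv: "0 \<le> u" "u \<le> v" "v \<le> t"
    have split: "(\<Sum>s\<in>jump_times 0 v \<omega>. h s) = (\<Sum>s\<in>jump_times 0 u \<omega>. h s) + (\<Sum>s\<in>jump_times u v \<omega>. h s)" for h :: "real \<Rightarrow> real"
      using jump_times_split(1)[OF uv(1,2), of \<omega>] finite_jump_times'[OF \<omega>] uv(1) jump_times_split(2)[of 0 u \<omega> v]
      by (simp add: sum.union_disjoint)
    have "a \<bullet> X v \<omega> - a \<bullet> X u \<omega> = (\<Sum>s\<in>jump_times u v \<omega>. a \<bullet> X s \<omega> - a \<bullet> left_limit X s \<omega>)"
      using jump_sum_telescope[OF \<omega>, of v "\<lambda>x. a \<bullet> x"] jump_sum_telescope[OF \<omega>, of u "\<lambda>x. a \<bullet> x"]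
        split[of "\<lambda>s. a \<bullet> X s \<omega> - a \<bullet> left_limit X s \<omega>"] uv by simp
    then have "\<bar>a \<bullet> X v \<omega> - a \<bullet> X u \<omega>\<bar> \<le> (\<Sum>s\<in>jump_times u v \<omega>. \<bar>a \<bullet> X s \<omega> - a \<bullet> left_limit X s \<omega>\<bar>)"
      by (simp only: sum_abs)
    then show "\<bar>(Y v \<omega> $ i - Y 0 \<omega> $ i) - (Y u \<omega> $ i - Y 0 \<omega> $ i)\<bar> \<le> V v - V u"
      unfolding V_def by (subst split) simp
  qed
qed

lemma semimartingale_image: "semimartingale Q Ft Y"
  unfolding semimartingale_def
proof (intro conjI allI)
  show "adapted Ft Y" by (rule adapted_image)
  show "cadlag (space Q) Y" using cadlag_image by (simp add: space_Q)
  fix i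
  show "\<exists>Z A. local_martingale Q Ft Z \<and> (\<forall>\<omega>\<in>space Q. Z 0 \<omega> = 0) \<and> finite_variation_process Q Ft A \<and>
      (AE \<omega> in Q. \<forall>t\<ge>0. Y t \<omega> $ i = Y 0 \<omega> $ i + Z t \<omega> + A t \<omega>)"
    using local_martingale_if_martingale[OF martingale_zero] finite_variation_image[of i]
    by (intro exI[of _ "\<lambda>_ _. 0"] exI[of _ "\<lambda>t \<omega>. Y t \<omega> $ i - Y 0 \<omega> $ i"]) simp
qed

lemma finite_variation_zero: "finite_variation_process Q Ft (\<lambda>_ _. 0)"
  unfolding finite_variation_process_def
  by (auto simp: adapted_def intro: cadlag_const finite_variation_onI[where g = "\<lambda>_. 0"])

text \<open>Since \<open>Y - Y 0\<close> has finite variation, the zero process serves as continuous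
  martingale part and also as purely discontinuous part.\<close>

lemma second_characteristic_image: "second_characteristic Q Ft Y (\<lambda>t \<omega>. 0)"
  unfolding second_characteristic_def
proof (intro exI[of _ "\<lambda>_ _ _. 0"] conjI allI)
  note zero = local_martingale_if_martingale[OF martingale_zero]
  fix i j :: 1
  have "purely_discontinuous Q Ft (\<lambda>_ _. 0)"
    using zero by (simp add: purely_discontinuous_def)
  then show "continuous_martingale_part Q Ft (\<lambda>t \<omega>. Y t \<omega> $ i) (\<lambda>_ _. 0)"
    using zero finite_variation_image[of i] unfolding continuous_martingale_part_def
    by (intro conjI exI[of _ "\<lambda>_ _. 0"] exI[of _ "\<lambda>t \<omega>. Y t \<omega> $ i - Y 0 \<omega> $ i"]) (simp_all add: continuous_paths_def)
  have "predictable Ft (\<lambda>_ _. 0 :: real)" by (simp add: predictable_def)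
  then show "predictable_covariation Q Ft (\<lambda>_ _. 0) (\<lambda>_ _. 0) (\<lambda>t \<omega>. (0 :: real^1^1) $ i $ j)"
    using zero finite_variation_zero by (simp add: predictable_covariation_def)
qed

text \<open>Jumps orthogonal to \<open>a\<close> are removed before the push-forward: they are no
  jumps of the image process and would place mass at the origin.\<close>

definition image_compensator :: "'w \<Rightarrow> (real \<times> (real^1)) measure" where
  "image_compensator \<omega> = distr (density (\<nu> \<omega>) (indicator {(t, \<xi>). a \<bullet> \<xi> \<noteq> 0})) borel
     (\<lambda>(t, \<xi>). (t, functional \<xi>))"

lemma sets_\<nu>: "\<omega> \<in> space M \<Longrightarrow> sets (\<nu> \<omega>) = sets borel"
  using comp by (simp add: compensator_def space_Q)

lemma nonzero_set_borel: "{(t :: real, \<xi>). a \<bullet> \<xi> \<noteq> 0} \<in> sets borel"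
proof -
  have "open {p :: real \<times> 'a. a \<bullet> snd p \<noteq> 0}" by (intro open_Collect_neq continuous_intros)
  then show ?thesis by (simp add: case_prod_unfold borel_open)
qed

lemma functional_pair_measurable: "(\<lambda>(t :: real, \<xi>). (t, functional \<xi>)) \<in> borel \<rightarrow>\<^sub>M borel"
  unfolding borel_prod[symmetric] by measurable

lemma emeasure_image_compensator:
  assumes \<omega>: "\<omega> \<in> space M" and A: "A \<in> sets borel"
  shows "emeasure (image_compensator \<omega>) A = (\<integral>\<^sup>+ t. emeasure (K (left_limit X t \<omega>))
    {\<xi>. a \<bullet> \<xi> \<noteq> 0 \<and> (t, functional \<xi>) \<in> A} * indicator {0..} t \<partial>lborel)"
proof -
  define S where "S = {(t :: real, \<xi>). a \<bullet> \<xi> \<noteq> 0}"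
  define h where "h = (\<lambda>(t :: real, \<xi>). (t, functional \<xi>))"
  have S: "S \<in> sets borel" using nonzero_set_borel by (simp add: S_def)
  have h: "h -` A \<in> sets borel"
    using measurable_sets[OF functional_pair_measurable A] by (simp add: h_def)
  have "emeasure (image_compensator \<omega>) A = emeasure (\<nu> \<omega>) (S \<inter> h -` A)"
    unfolding image_compensator_def S_def[symmetric] h_def[symmetric]
    by (intro emeasure_distr_restricted sets_\<nu> \<omega> S A) (simp add: h_def functional_pair_measurable)
  also have "\<dots> = (\<integral>\<^sup>+ t. emeasure (K (left_limit X t \<omega>)) {\<xi>. (t, \<xi>) \<in> S \<inter> h -` A} * indicator {0..} t \<partial>lborel)"
    using \<omega> S h by (intro kernel) (simp_all add: space_Q)
  also have "\<dots> = (\<integral>\<^sup>+ t. emeasure (K (left_limit X t \<omega>))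
    {\<xi>. a \<bullet> \<xi> \<noteq> 0 \<and> (t, functional \<xi>) \<in> A} * indicator {0..} t \<partial>lborel)"
    by (simp add: S_def h_def)
  finally show ?thesis .
qed

context
  fixes W :: "('w \<times> real) \<times> (real^1) \<Rightarrow> ennreal"
  assumes W: "W \<in> borel_measurable (predictable_sigma Ft \<Otimes>\<^sub>M borel)"
begin

text \<open>Turns a weight on jumps of the image into a weight on jumps of \<open>X\<close>. Both
  integrals in the compensator property of the image are thereby reduced to those for
  \<open>X\<close>.\<close>

definition pullback :: "('w \<times> real) \<times> 'a \<Rightarrow> ennreal" where
  "pullback = (\<lambda>(p, \<xi>). W (p, functional \<xi>) * indicator {\<xi>. a \<bullet> \<xi> \<noteq> 0} \<xi>)"

lemma pullback_measurable: "pullback \<in> borel_measurable (predictable_sigma Ft \<Otimes>\<^sub>M borel)"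
proof -
  have [measurable]: "{\<xi>. a \<bullet> \<xi> \<noteq> 0} \<in> sets borel"
    by (intro borel_open open_Collect_neq continuous_intros)
  show ?thesis unfolding pullback_def using W by measurable
qed

lemma integral_image_compensator:
  assumes \<omega>: "\<omega> \<in> space M" and I: "I \<in> sets borel" "I \<subseteq> {0..}"
  shows "random_integral W image_compensator I \<omega> = random_integral pullback \<nu> I \<omega>"
proof -
  define S where "S = {(t :: real, \<xi>). a \<bullet> \<xi> \<noteq> 0}"
  define h where "h = (\<lambda>(t :: real, \<xi>). (t, functional \<xi>))"
  define w where "w = (\<lambda>(s, \<eta>). W ((\<omega>, s), \<eta>) * indicator I s)"
  have S: "S \<in> sets borel" using nonzero_set_borel by (simp add: S_def)
  have h: "h \<in> borel \<rightarrow>\<^sub>M borel" using functional_pair_measurable by (simp add: h_def)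
  have w: "w \<in> borel_measurable borel" unfolding w_def
    using path_integrand_measurable[OF W _ I] \<omega> by (simp add: space_Ft)
  have h': "h \<in> density (\<nu> \<omega>) (indicator S) \<rightarrow>\<^sub>M borel"
    using h by (simp add: sets_\<nu>[OF \<omega>] cong: measurable_cong_sets)
  have "random_integral W image_compensator I \<omega> = (\<integral>\<^sup>+ p. w p \<partial>distr (density (\<nu> \<omega>) (indicator S)) borel h)"
    by (simp add: random_integral_def image_compensator_def w_def S_def h_def)
  also have "\<dots> = (\<integral>\<^sup>+ p. w (h p) \<partial>density (\<nu> \<omega>) (indicator S))"
    using h' w by (intro nn_integral_distr) simp_all
  also have "\<dots> = (\<integral>\<^sup>+ p. indicator S p * w (h p) \<partial>\<nu> \<omega>)"
    using S measurable_compose[OF h w]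
    by (intro nn_integral_density) (simp_all add: sets_\<nu>[OF \<omega>] cong: measurable_cong_sets)
  also have "\<dots> = random_integral pullback \<nu> I \<omega>"
    unfolding random_integral_def
    by (intro nn_integral_cong) (auto simp: pullback_def w_def S_def h_def indicator_def)
  finally show ?thesis .
qed

text \<open>Both sides are sums over jump times. The jump times of \<open>Y\<close> are those of
  \<open>X\<close> at which the jump is not orthogonal to \<open>a\<close>, and these are selected
  by the indicator in \<open>pullback\<close>.\<close>

lemma integral_image_jump_measure:
  assumes \<omega>: "\<omega> \<in> space M" and I: "I \<in> sets borel" "I \<subseteq> {0..}"
  shows "random_integral W (jump_measure Y) I \<omega> = random_integral pullback (jump_measure X) I \<omega>"
proof -
  have \<omega>0: "\<omega> \<in> space (Ft 0)" using \<omega> by (simp add: space_Ft)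
  have "random_integral W (jump_measure Y) I \<omega>
      = (\<integral>\<^sup>+ t. W ((\<omega>, t), jump Y t \<omega>) * indicator I t \<partial>count_space {t. 0 < t \<and> jump Y t \<omega> \<noteq> 0})"
    unfolding random_integral_def jump_measure_def
    by (subst nn_integral_distr) (use path_integrand_measurable[OF W \<omega>0 I] in auto)
  also have "\<dots> = (\<integral>\<^sup>+ t. W ((\<omega>, t), jump Y t \<omega>) * indicator I t * indicator {t. 0 < t \<and> jump Y t \<omega> \<noteq> 0} t \<partial>count_space UNIV)"
    by (rule nn_integral_count_space_indicator) simp
  also have "\<dots> = (\<integral>\<^sup>+ t. pullback ((\<omega>, t), jump X t \<omega>) * indicator I t * indicator {t. 0 < t \<and> jump X t \<omega> \<noteq> 0} t \<partial>count_space UNIV)"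
    by (intro nn_integral_cong) (auto simp: pullback_def jump_image[OF \<omega>] indicator_def)
  also have "\<dots> = (\<integral>\<^sup>+ t. pullback ((\<omega>, t), jump X t \<omega>) * indicator I t \<partial>count_space {t. 0 < t \<and> jump X t \<omega> \<noteq> 0})"
    by (rule nn_integral_count_space_indicator[symmetric]) simp
  also have "\<dots> = random_integral pullback (jump_measure X) I \<omega>"
    unfolding random_integral_def jump_measure_def
    by (subst nn_integral_distr) (use path_integrand_measurable[OF pullback_measurable \<omega>0 I] in auto)
  finally show ?thesis .
qed

end

lemma compensator_image: "compensator Q Ft (jump_measure Y) image_compensator"
  unfolding compensator_def
proof (intro conjI ballI)
  show "sets (image_compensator \<omega>) = sets borel" for \<omega> by (simp add: image_compensator_def)
  fix W :: "('w \<times> real) \<times> (real^1) \<Rightarrow> ennreal"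
  assume W: "W \<in> borel_measurable (predictable_sigma Ft \<Otimes>\<^sub>M borel)"
  have "predictable Ft (\<lambda>t. random_integral (pullback W) \<nu> {0..t})"
    using comp pullback_measurable[OF W] unfolding compensator_def by blast
  then have "(\<lambda>(\<omega>, t). random_integral (pullback W) \<nu> {0..t} \<omega>) \<in> borel_measurable (predictable_sigma Ft)"
    by (simp add: predictable_def)
  also have "?this \<longleftrightarrow> (\<lambda>(\<omega>, t). random_integral W image_compensator {0..t} \<omega>) \<in> borel_measurable (predictable_sigma Ft)"
    by (rule measurable_cong) (auto simp: space_Ft integral_image_compensator[OF W])
  finally show "predictable Ft (\<lambda>t. random_integral W image_compensator {0..t})"
    by (simp add: predictable_def)
  have "(\<integral>\<^sup>+ \<omega>. random_integral W image_compensator {0..} \<omega> \<partial>Q) = (\<integral>\<^sup>+ \<omega>. random_integral (pullback W) \<nu> {0..} \<omega> \<partial>Q)"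
    by (intro nn_integral_cong integral_image_compensator[OF W]) (auto simp: space_Q)
  also have "\<dots> = (\<integral>\<^sup>+ \<omega>. random_integral (pullback W) (jump_measure X) {0..} \<omega> \<partial>Q)"
    using comp pullback_measurable[OF W] unfolding compensator_def by blast
  also have "\<dots> = (\<integral>\<^sup>+ \<omega>. random_integral W (jump_measure Y) {0..} \<omega> \<partial>Q)"
    by (intro nn_integral_cong integral_image_jump_measure[OF W, symmetric]) (auto simp: space_Q)
  finally show "(\<integral>\<^sup>+ \<omega>. random_integral W image_compensator {0..} \<omega> \<partial>Q)
      = (\<integral>\<^sup>+ \<omega>. random_integral W (jump_measure Y) {0..} \<omega> \<partial>Q)" .
qed

section \<open>The drift of the truncated image process\<close>

definition pairs :: "('a \<times> 'a) set" where
  "pairs = {(x, y) \<in> E \<times> E. x \<noteq> y}"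

lemma finite_pairs: "finite pairs"
  unfolding pairs_def by (rule finite_subset[OF _ finite_cartesian_product[OF finite_E finite_E]]) auto

text \<open>A candidate for the first characteristic. As a finite combination of occupation times it
  is Lipschitz in time, hence continuous and predictable.\<close>

definition drift :: "real \<Rightarrow> 'w \<Rightarrow> real" where
  "drift t \<omega> = (\<Sum>(x, y)\<in>pairs. truncated_functional (y - x) * (measure (K x) {y - x} * occupation x t \<omega>))"

text \<open>The process is its initial value plus all its jumps; removing the excess of large jumps
  leaves the truncated jumps, which are then grouped by source and target.\<close>

lemma truncated_process_image:
  assumes \<omega>: "\<omega> \<in> space M" and t: "0 \<le> t"
  shows "truncated_process Y t \<omega> $ 1 - Y 0 \<omega> $ 1
    = (\<Sum>(x, y)\<in>pairs. truncated_functional (y - x) * jump_count x y t \<omega>)"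
proof -
  define J where "J = jump_times 0 t \<omega>"
  have J: "finite J" using finite_jump_times[OF \<omega>] by (simp add: J_def)
  have "(\<Sum>s\<in>{s\<in>{0<..t}. jump Y s \<omega> \<noteq> truncation (jump Y s \<omega>)}. jump Y s \<omega> - truncation (jump Y s \<omega>))
      = (\<Sum>s\<in>J. jump Y s \<omega> - truncation (jump Y s \<omega>))"
  proof (rule sum.mono_neutral_left[OF J])
    show "{s\<in>{0<..t}. jump Y s \<omega> \<noteq> truncation (jump Y s \<omega>)} \<subseteq> J"
    proof
      fix s assume s: "s \<in> {s\<in>{0<..t}. jump Y s \<omega> \<noteq> truncation (jump Y s \<omega>)}"
      then have "jump Y s \<omega> \<noteq> 0" by (auto simp: truncation_def)
      then have "jump X s \<omega> \<noteq> 0" using jump_image[OF \<omega>, of s] by auto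
      then show "s \<in> J" using s by (simp add: J_def jump_times_def)
    qed
  qed (auto simp: J_def jump_times_def)
  then have "truncated_process Y t \<omega> $ 1 - Y 0 \<omega> $ 1
      = (a \<bullet> X t \<omega> - a \<bullet> X 0 \<omega>) - (\<Sum>s\<in>J. a \<bullet> jump X s \<omega> - truncated_functional (jump X s \<omega>))"
    by (simp add: truncated_process_def jump_image[OF \<omega>] truncated_image_def)
  also have "a \<bullet> X t \<omega> - a \<bullet> X 0 \<omega> = (\<Sum>s\<in>J. a \<bullet> jump X s \<omega>)"
    using jump_sum_telescope[OF \<omega> t, of "\<lambda>x. a \<bullet> x"] by (simp add: J_def jump_def inner_diff_right)
  finally have eq: "truncated_process Y t \<omega> $ 1 - Y 0 \<omega> $ 1 = (\<Sum>s\<in>J. truncated_functional (jump X s \<omega>))"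
    by (simp add: sum_subtractf)
  \<comment> \<open>Each jump time belongs to exactly one pair of states, so after exchanging the
    sums the inner sum has a single nonzero candidate.\<close>
  have "(\<Sum>(x, y)\<in>pairs. truncated_functional (y - x) * jump_count x y t \<omega>)
      = (\<Sum>(x, y)\<in>pairs. \<Sum>s\<in>J. if (x, y) = (left_limit X s \<omega>, X s \<omega>) then truncated_functional (y - x) else 0)"
  proof (intro sum.cong refl, clarify)
    fix x y
    have "(\<Sum>s\<in>J. if (x, y) = (left_limit X s \<omega>, X s \<omega>) then truncated_functional (y - x) else 0)
        = (\<Sum>s\<in>{s\<in>J. left_limit X s \<omega> = x \<and> X s \<omega> = y}. truncated_functional (y - x))"
      unfolding sum.inter_filter[OF J] by (intro sum.cong) auto
    then show "truncated_functional (y - x) * jump_count x y t \<omega>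
        = (\<Sum>s\<in>J. if (x, y) = (left_limit X s \<omega>, X s \<omega>) then truncated_functional (y - x) else 0)"
      by (simp add: jump_count_def J_def)
  qed
  also have "\<dots> = (\<Sum>p\<in>pairs. \<Sum>s\<in>J. if p = (left_limit X s \<omega>, X s \<omega>) then truncated_functional (snd p - fst p) else 0)"
    by (simp add: case_prod_unfold prod_eq_iff)
  also have "\<dots> = (\<Sum>s\<in>J. \<Sum>p\<in>pairs. if p = (left_limit X s \<omega>, X s \<omega>) then truncated_functional (snd p - fst p) else 0)"
    by (rule sum.swap)
  also have "\<dots> = (\<Sum>s\<in>J. truncated_functional (jump X s \<omega>))"
  proof (rule sum.cong[OF refl])
    fix s assume "s \<in> J"
    then have "0 < s" "jump X s \<omega> \<noteq> 0" by (auto simp: J_def jump_times_def)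
    then have "(left_limit X s \<omega>, X s \<omega>) \<in> pairs"
      using left_limit_in_E[OF \<omega>] X_in_E[OF \<omega>, of s] by (auto simp: pairs_def jump_def)
    then show "(\<Sum>p\<in>pairs. if p = (left_limit X s \<omega>, X s \<omega>) then truncated_functional (snd p - fst p) else 0)
        = truncated_functional (jump X s \<omega>)"
      using finite_pairs by (simp add: jump_def)
  qed
  finally show ?thesis using eq by simp
qed

lemma drift_adapted: "0 \<le> t \<Longrightarrow> drift t \<in> borel_measurable (Ft t)"
  unfolding drift_def[abs_def] case_prod_unfold
  by (intro borel_measurable_sum borel_measurable_times borel_measurable_const rate_occupation_adapted) auto

lemma drift_0: "drift 0 \<omega> = 0"
  by (simp add: drift_def occupation_0)

definition drift_bound :: real where
  "drift_bound = (\<Sum>(x, y)\<in>pairs. \<bar>truncated_functional (y - x)\<bar> * measure (K x) {y - x})"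

lemma drift_lipschitz:
  assumes "\<omega> \<in> space M" "0 \<le> u" "u \<le> t"
  shows "\<bar>drift t \<omega> - drift u \<omega>\<bar> \<le> drift_bound * (t - u)"
proof -
  have "drift t \<omega> - drift u \<omega> = (\<Sum>(x, y)\<in>pairs. truncated_functional (y - x) * measure (K x) {y - x} * (occupation x t \<omega> - occupation x u \<omega>))"
    by (simp add: drift_def sum_subtractf[symmetric] case_prod_unfold algebra_simps)
  also have "\<bar>\<dots>\<bar> \<le> (\<Sum>(x, y)\<in>pairs. \<bar>truncated_functional (y - x) * measure (K x) {y - x} * (occupation x t \<omega> - occupation x u \<omega>)\<bar>)"
    unfolding case_prod_unfold by (rule sum_abs)
  also have "\<dots> \<le> (\<Sum>(x, y)\<in>pairs. \<bar>truncated_functional (y - x)\<bar> * measure (K x) {y - x} * (t - u))"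
    using occupation_lipschitz[OF assms]
    by (intro sum_mono) (auto simp: abs_mult intro!: mult_left_mono)
  also have "\<dots> = drift_bound * (t - u)"
    by (simp add: drift_bound_def sum_distrib_right case_prod_unfold)
  finally show ?thesis .
qed

lemma drift_continuous: "\<omega> \<in> space M \<Longrightarrow> continuous_on {0..} (\<lambda>t. drift t \<omega>)"
  using drift_lipschitz by (rule lipschitz_paths_continuous)

lemma drift_predictable: "predictable Ft drift"
  unfolding predictable_def
proof (rule measurable_predictable_sigma)
  show "adapted Ft drift" using drift_adapted by (simp add: adapted_def)
  fix \<omega> and t :: real assume "\<omega> \<in> space (Ft 0)" and t: "0 < t"
  then have "continuous_on {0..} (\<lambda>t. drift t \<omega>)" by (intro drift_continuous) (simp add: space_Ft)
  then have "continuous (at t within {0..}) (\<lambda>t. drift t \<omega>)"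
    using t by (simp add: continuous_on_eq_continuous_within)
  moreover have "at t within {0..} = at t" using t by (intro at_within_interior) simp
  ultimately have "continuous (at t) (\<lambda>t. drift t \<omega>)" by simp
  then show "continuous (at_left t) (\<lambda>t. drift t \<omega>)" by (rule continuous_within_subset) simp
qed

lemma integral_left_limit:
  fixes g :: "'a \<Rightarrow> real^1"
  assumes \<omega>: "\<omega> \<in> space M" and t: "0 \<le> t"
  shows "(LINT s:{0..t}|lborel. g (left_limit X s \<omega>)) = (\<Sum>x\<in>E. occupation x t \<omega> *\<^sub>R g x)"
proof -
  \<comment> \<open>The visit times of the states partition the interval that is open at 0 and
    closed at \<open>t\<close>; the point 0 is added separately and has measure zero.\<close>
  have eq: "indicator {0..t} s *\<^sub>R g (left_limit X s \<omega>)
      = (\<Sum>x\<in>E. indicator (visit_times x 0 t \<omega>) s *\<^sub>R g x) + indicator {0} s *\<^sub>R g (X 0 \<omega>)" for s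
  proof (cases "0 < s \<and> s \<le> t")
    case True
    have "(\<Sum>x\<in>E. indicator (visit_times x 0 t \<omega>) s *\<^sub>R g x) = (\<Sum>x\<in>E. if x = left_limit X s \<omega> then g x else 0)"
      using True by (intro sum.cong) (auto simp: visit_times_def indicator_def)
    also have "\<dots> = g (left_limit X s \<omega>)" using left_limit_in_E[OF \<omega>] finite_E by simp
    finally show ?thesis using True by simp
  next
    case False
    then have "s \<notin> visit_times x 0 t \<omega>" for x by (auto simp: visit_times_def)
    then show ?thesis using False t by (auto simp: indicator_def left_limit_def)
  qed
  have int: "integrable lborel (\<lambda>s. indicator (visit_times x 0 t \<omega>) s *\<^sub>R g x)" for x
    using visit_times_borel[OF \<omega>, of 0 x t] visit_times_measure(1)[OF \<omega> order_refl t, of x]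
    by (intro integrable_scaleR_left) (simp add: integrable_indicator_iff)
  have "(LINT s:{0..t}|lborel. g (left_limit X s \<omega>))
      = (LINT s|lborel. (\<Sum>x\<in>E. indicator (visit_times x 0 t \<omega>) s *\<^sub>R g x) + indicator {0} s *\<^sub>R g (X 0 \<omega>))"
    unfolding set_lebesgue_integral_def eq ..
  also have "\<dots> = (LINT s|lborel. (\<Sum>x\<in>E. indicator (visit_times x 0 t \<omega>) s *\<^sub>R g x)) + (LINT s|lborel. indicator {0::real} s *\<^sub>R g (X 0 \<omega>))"
    by (rule Bochner_Integration.integral_add)
      (use int in \<open>auto intro!: Bochner_Integration.integrable_sum integrable_scaleR_left simp: integrable_indicator_iff\<close>)
  also have "(LINT s|lborel. indicator {0::real} s *\<^sub>R g (X 0 \<omega>)) = 0"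
    by (subst integral_scaleR_left) (simp_all add: integrable_indicator_iff)
  also have "(LINT s|lborel. (\<Sum>x\<in>E. indicator (visit_times x 0 t \<omega>) s *\<^sub>R g x))
      = (\<Sum>x\<in>E. (LINT s|lborel. indicator (visit_times x 0 t \<omega>) s *\<^sub>R g x))"
    using int by (intro Bochner_Integration.integral_sum)
  also have "\<dots> = (\<Sum>x\<in>E. occupation x t \<omega> *\<^sub>R g x)"
    using visit_times_borel[OF \<omega>, of 0 _ t] visit_times_measure(1)[OF \<omega> order_refl t]
    by (intro sum.cong refl, subst integral_scaleR_left) (simp_all add: integrable_indicator_iff occupation_def)
  finally show ?thesis by simp
qed

text \<open>The premise on \<open>b\<close> prescribes the expected truncated displacement per unit
  of time, so its time integral is \<open>drift\<close>. Subtracting it from the truncated process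
  leaves a finite combination of the martingales \<open>compensated_count\<close>.\<close>

lemma semimartingale_characteristics_image:
  fixes b :: "real^1 \<Rightarrow> real^1"
  assumes K: "\<And>x y. x \<in> E \<Longrightarrow> y \<in> E \<Longrightarrow> x \<noteq> y \<Longrightarrow> emeasure (K x) {y - x} < \<infinity>"
    and b: "\<And>x. x \<in> E \<Longrightarrow> b (functional x) $ 1 = (\<Sum>y\<in>E - {x}. truncated_functional (y - x) * measure (K x) {y - x})"
  shows "semimartingale_characteristics Q Ft Y (\<lambda>t \<omega>. LINT s:{0..t}|lborel. b (left_limit Y s \<omega>))
    (\<lambda>t \<omega>. LINT s:{0..t}|lborel. (0 :: real^1^1)) image_compensator"
proof -
  define B where "B = (\<lambda>t \<omega>. LINT s:{0..t}|lborel. b (left_limit Y s \<omega>))"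
  have B: "B t \<omega> $ i = drift t \<omega>" if \<omega>: "\<omega> \<in> space M" and t: "0 \<le> t" for t \<omega> i
  proof -
    have "B t \<omega> = (\<Sum>x\<in>E. occupation x t \<omega> *\<^sub>R b (functional x))"
      using integral_left_limit[OF \<omega> t, of "\<lambda>x. b (functional x)"] by (simp add: B_def left_limit_image[OF \<omega>])
    then have "B t \<omega> $ 1 = (\<Sum>x\<in>E. occupation x t \<omega> * (\<Sum>y\<in>E - {x}. truncated_functional (y - x) * measure (K x) {y - x}))"
      by (simp add: b)
    also have "\<dots> = (\<Sum>x\<in>E. \<Sum>y\<in>E - {x}. truncated_functional (y - x) * (measure (K x) {y - x} * occupation x t \<omega>))"
      by (simp add: sum_distrib_left algebra_simps)
    also have "\<dots> = (\<Sum>(x, y)\<in>Sigma E (\<lambda>x. E - {x}). truncated_functional (y - x) * (measure (K x) {y - x} * occupation x t \<omega>))"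
      using finite_E by (intro sum.Sigma) auto
    also have "Sigma E (\<lambda>x. E - {x}) = pairs" by (auto simp: pairs_def)
    finally have "B t \<omega> $ 1 = drift t \<omega>" by (simp add: drift_def)
    then show ?thesis unfolding num1_eq1[of i] .
  qed
  have "first_characteristic Q Ft Y B"
    unfolding first_characteristic_def
  proof (intro allI conjI)
    fix i :: 1
    show "finite_variation_process Q Ft (\<lambda>t \<omega>. B t \<omega> $ i)"
      unfolding finite_variation_process_def
    proof (intro conjI ballI allI impI)
      have "(\<lambda>\<omega>. B t \<omega> $ i) \<in> borel_measurable (Ft t)" if t: "0 \<le> t" for t
        by (rule measurable_cong[THEN iffD1, OF _ drift_adapted[OF t]]) (use B t in \<open>simp add: space_Ft\<close>)
      then show "adapted Ft (\<lambda>t \<omega>. B t \<omega> $ i)" by (simp add: adapted_def)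
      show "cadlag (space Q) (\<lambda>t \<omega>. B t \<omega> $ i)"
        by (rule cadlag_cong[OF _ cadlag_continuous[OF drift_continuous]]) (use B in \<open>simp_all add: space_Q\<close>)
      fix \<omega> assume "\<omega> \<in> space Q"
      then have \<omega>: "\<omega> \<in> space M" by (simp add: space_Q)
      show "B 0 \<omega> $ i = 0" by (simp add: B[OF \<omega>] drift_0)
      show "finite_variation_on t (\<lambda>s. B s \<omega> $ i)" if "0 \<le> t" for t
        by (rule finite_variation_onI[where g = "\<lambda>s. drift_bound * s"])
          (use drift_lipschitz[OF \<omega>] in \<open>simp add: B[OF \<omega>] right_diff_distrib\<close>)
    qed
    have "(\<lambda>(\<omega>, t). B t \<omega> $ i) \<in> borel_measurable (predictable_sigma Ft)"
      by (rule measurable_cong[THEN iffD1, OF _ drift_predictable[unfolded predictable_def]])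
        (use B in \<open>auto simp: space_Ft\<close>)
    then show "predictable Ft (\<lambda>t \<omega>. B t \<omega> $ i)" by (simp add: predictable_def)
    have "martingale Q Ft (\<lambda>t \<omega>. \<Sum>p\<in>pairs. truncated_functional (snd p - fst p) * compensated_count (fst p) (snd p) t \<omega>)"
      using finite_pairs K
      by (intro martingale_sum martingale_cmult martingale_compensated_count) (auto simp: pairs_def)
    then have "martingale Q Ft (\<lambda>t \<omega>. truncated_process Y t \<omega> $ i - Y 0 \<omega> $ i - B t \<omega> $ i)"
    proof (rule martingale_cong[rotated])
      fix \<omega> t assume \<omega>: "\<omega> \<in> space M" and t: "0 \<le> (t::real)"
      have "truncated_process Y t \<omega> $ 1 - Y 0 \<omega> $ 1 - B t \<omega> $ 1
          = (\<Sum>p\<in>pairs. truncated_functional (snd p - fst p) * compensated_count (fst p) (snd p) t \<omega>)"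
        unfolding truncated_process_image[OF \<omega> t] B[OF \<omega> t] drift_def
        by (simp add: compensated_count_def right_diff_distrib sum_subtractf case_prod_unfold)
      then show "(\<Sum>p\<in>pairs. truncated_functional (snd p - fst p) * compensated_count (fst p) (snd p) t \<omega>)
          = truncated_process Y t \<omega> $ i - Y 0 \<omega> $ i - B t \<omega> $ i"
        unfolding num1_eq1[of i] by (rule sym)
    qed
    then show "local_martingale Q Ft (\<lambda>t \<omega>. truncated_process Y t \<omega> $ i - Y 0 \<omega> $ i - B t \<omega> $ i)"
      by (rule local_martingale_if_martingale)
  qed
  moreover have "second_characteristic Q Ft Y (\<lambda>t \<omega>. LINT s:{0..t}|lborel. (0 :: real^1^1))"
    using second_characteristic_image by (simp add: set_lebesgue_integral_def)
  ultimately show ?thesis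
    using semimartingale_image compensator_image by (simp add: semimartingale_characteristics_def B_def)
qed

end

end

section \<open>Linear functionals with autonomous jump rates\<close>

text \<open>Unspecified for \<open>\<eta> = 0\<close>, where the point mass is not a measure on the punctured space.\<close>

definition dirac :: "'a::euclidean_space \<Rightarrow> 'a signed_radon" where
  "dirac \<eta> = Abs_signed_radon (radon_difference (return borel \<eta>) (null_measure borel))"

lemma signed_value_dirac:
  assumes "\<eta> \<noteq> 0" "punctured_bounded B"
  shows "signed_value (dirac \<eta>) B = indicator B \<eta>"
proof -
  have "punctured_radon (return borel \<eta>)"
    using assms(1) unfolding punctured_radon_def
    by (auto simp: borel_compact ennreal_indicator[symmetric])
  then have "signed_value (dirac \<eta>) = radon_difference (return borel \<eta>) (null_measure borel)"
    unfolding dirac_def using punctured_radon_null by (intro Abs_signed_radon_inverse) blast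
  moreover have "B \<in> sets borel" using assms(2) by (simp add: punctured_bounded_def)
  ultimately show ?thesis
    using assms(2) by (simp add: radon_difference_def measure_return)
qed

lemma signed_value_sum: "signed_value (\<Sum>i\<in>I. d i) B = (\<Sum>i\<in>I. signed_value (d i) B)"
  by (induction I rule: infinite_finite_induct)
    (simp_all add: zero_signed_radon.rep_eq plus_signed_radon.rep_eq)

lemma affine_map_sum:
  fixes d :: "'i \<Rightarrow> 'b::real_vector"
  shows "affine_map (\<lambda>v :: real^1. \<Sum>i\<in>I. (p i + q i * v $ 1) *\<^sub>R d i)"
proof -
  have "(\<Sum>i\<in>I. (p i + q i * v $ 1) *\<^sub>R d i) - (\<Sum>i\<in>I. (p i + q i * 0 $ 1) *\<^sub>R d i)
      = (\<Sum>i\<in>I. (q i * v $ 1) *\<^sub>R d i)" for v :: "real^1"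
    by (simp add: sum_subtractf[symmetric] scaleR_left_distrib)
  moreover have "linear (\<lambda>v :: real^1. \<Sum>i\<in>I. (q i * v $ 1) *\<^sub>R d i)"
    by (rule linearI) (simp_all add: algebra_simps sum.distrib scaleR_sum_right)
  ultimately show ?thesis by (simp add: affine_map_def)
qed

context finite_affine_process
begin

context
  fixes a :: "real^'n" and p q :: "real^'n \<Rightarrow> real"
  assumes rate_image: "\<And>\<xi> x. a \<bullet> \<xi> \<noteq> 0 \<Longrightarrow> rate \<xi> x = p \<xi> + q \<xi> * (a \<bullet> x)"
begin

definition image_steps :: "(real^'n) set" where
  "image_steps = {\<xi> \<in> steps. a \<bullet> \<xi> \<noteq> 0}"

text \<open>Still depends on the full state \<open>x\<close>; that it is determined by
  \<open>a \<bullet> x\<close> is the content of \<open>image_represents\<close>.\<close>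

definition image_measure :: "real^'n \<Rightarrow> (real^1) measure" where
  "image_measure x = distr (density (kernel x) (indicator {\<xi>. a \<bullet> \<xi> \<noteq> 0})) borel (linear_image a)"

text \<open>Built from the coefficients \<open>p\<close> and \<open>q\<close> instead of the kernel,
  so that it is affine on the whole line and not merely on the image of \<open>E\<close>.\<close>

definition image_F :: "real^1 \<Rightarrow> (real^1) signed_radon" where
  "image_F v = (\<Sum>\<xi>\<in>image_steps. (p \<xi> + q \<xi> * v $ 1) *\<^sub>R dirac (linear_image a \<xi>))"

definition image_b :: "real^1 \<Rightarrow> real^1" where
  "image_b v = (\<Sum>\<xi>\<in>image_steps. (p \<xi> + q \<xi> * v $ 1) *\<^sub>R truncation (linear_image a \<xi>))"

lemma nonzero_borel: "{\<xi>. a \<bullet> \<xi> \<noteq> 0} \<in> sets borel"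
  by (intro borel_open open_Collect_neq continuous_intros)

lemma image_measure_eq:
  assumes "x \<in> E" "B \<in> sets borel"
  shows "emeasure (image_measure x) B = emeasure (kernel x) {\<xi>. a \<bullet> \<xi> \<noteq> 0 \<and> linear_image a \<xi> \<in> B}"
proof -
  have "emeasure (image_measure x) B = emeasure (kernel x) ({\<xi>. a \<bullet> \<xi> \<noteq> 0} \<inter> linear_image a -` B)"
    unfolding image_measure_def using assms
    by (intro emeasure_distr_restricted sets_kernel nonzero_borel linear_image_measurable)
  also have "{\<xi>. a \<bullet> \<xi> \<noteq> 0} \<inter> linear_image a -` B = {\<xi>. a \<bullet> \<xi> \<noteq> 0 \<and> linear_image a \<xi> \<in> B}" by auto
  finally show ?thesis .
qed

lemma image_measure_sum:
  assumes "x \<in> E" "B \<in> sets borel"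
  shows "emeasure (image_measure x) B = ennreal (\<Sum>\<xi>\<in>image_steps. rate \<xi> x * indicator B (linear_image a \<xi>))"
proof -
  have "linear_image a -` B \<in> sets borel" using measurable_sets[OF linear_image_measurable assms(2)] by simp
  then have "{\<xi>. a \<bullet> \<xi> \<noteq> 0} \<inter> linear_image a -` B \<in> sets borel" using nonzero_borel by blast
  also have "{\<xi>. a \<bullet> \<xi> \<noteq> 0} \<inter> linear_image a -` B = {\<xi>. a \<bullet> \<xi> \<noteq> 0 \<and> linear_image a \<xi> \<in> B}" by auto
  finally have "emeasure (image_measure x) B
      = ennreal (\<Sum>\<xi>\<in>steps. rate \<xi> x * indicator {\<xi>. a \<bullet> \<xi> \<noteq> 0 \<and> linear_image a \<xi> \<in> B} \<xi>)"
    using assms by (simp add: image_measure_eq kernel_eq)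
  also have "(\<Sum>\<xi>\<in>steps. rate \<xi> x * indicator {\<xi>. a \<bullet> \<xi> \<noteq> 0 \<and> linear_image a \<xi> \<in> B} \<xi>)
      = (\<Sum>\<xi>\<in>image_steps. rate \<xi> x * indicator B (linear_image a \<xi>))"
    unfolding image_steps_def sum.inter_filter[OF finite_steps]
    by (intro sum.cong) (auto simp: indicator_def)
  finally show ?thesis .
qed

lemma image_represents:
  assumes x: "x \<in> E"
  shows "represents (image_measure x) (image_F (linear_image a x))"
  unfolding represents_def
proof (intro conjI allI impI)
  show "punctured_radon (image_measure x)"
    unfolding punctured_radon_def
  proof (intro conjI allI impI)
    show "sets (image_measure x) = sets borel" by (simp add: image_measure_def)
    have "{\<xi>. a \<bullet> \<xi> \<noteq> 0 \<and> linear_image a \<xi> \<in> {0}} = {}" by auto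
    then show "emeasure (image_measure x) {0} = 0" by (simp add: image_measure_eq[OF x])
    show "emeasure (image_measure x) C < \<infinity>" if "compact C \<and> 0 \<notin> C" for C
      using that by (simp add: image_measure_sum[OF x] borel_compact)
  qed
  fix B :: "(real^1) set" assume B: "punctured_bounded B"
  then have "B \<in> sets borel" by (simp add: punctured_bounded_def)
  have "signed_value (image_F (linear_image a x)) B
      = (\<Sum>\<xi>\<in>image_steps. (p \<xi> + q \<xi> * (a \<bullet> x)) * signed_value (dirac (linear_image a \<xi>)) B)"
    by (simp add: image_F_def signed_value_sum scaleR_signed_radon.rep_eq)
  also have "\<dots> = (\<Sum>\<xi>\<in>image_steps. rate \<xi> x * indicator B (linear_image a \<xi>))"
    by (intro sum.cong) (auto simp: image_steps_def signed_value_dirac[OF _ B] rate_image)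
  also have "\<dots> = measure (image_measure x) B"
    using image_measure_sum[OF x \<open>B \<in> sets borel\<close>] rate_nonneg[OF x]
    by (simp add: measure_def sum_nonneg)
  finally show "signed_value (image_F (linear_image a x)) B = measure (image_measure x) B" .
qed

lemma radon_measure_of_image: "x \<in> E \<Longrightarrow> radon_measure_of (image_F (linear_image a x)) = image_measure x"
  by (rule radon_measure_of_eqI[OF image_represents])

lemma levy_measure_image:
  assumes x: "x \<in> E"
  shows "levy_measure (image_F (linear_image a x))"
  unfolding levy_measure_def radon_measure_of_image[OF x]
proof (intro conjI exI)
  show "represents (image_measure x) (image_F (linear_image a x))" by (rule image_represents[OF x])
  have "(\<integral>\<^sup>+ \<xi>. ennreal (min ((norm \<xi>)\<^sup>2) 1) \<partial>image_measure x) \<le> (\<integral>\<^sup>+ \<xi>. 1 \<partial>image_measure x)"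
    by (intro nn_integral_mono) (simp add: min_le_iff_disj)
  also have "\<dots> = emeasure (image_measure x) UNIV" by (simp add: image_measure_def)
  also have "\<dots> < \<infinity>" by (simp add: image_measure_sum[OF x])
  finally show "(\<integral>\<^sup>+ \<xi>. ennreal (min ((norm \<xi>)\<^sup>2) 1) \<partial>image_measure x) < \<infinity>" .
qed

text \<open>Passes from a sum over all differences of states to a sum over target states: a
  difference that leads from \<open>x\<close> out of \<open>E\<close> has rate 0, and one orthogonal
  to \<open>a\<close> has truncated image 0.\<close>

lemma image_b_eq:
  assumes x: "x \<in> E"
  shows "image_b (linear_image a x) $ 1 = (\<Sum>y\<in>E - {x}. truncated_image a (y - x) * measure (kernel x) {y - x})"
proof -
  define g where "g \<xi> = truncated_image a \<xi> * rate \<xi> x" for \<xi>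
  have "image_b (linear_image a x) $ 1 = (\<Sum>\<xi>\<in>image_steps. (p \<xi> + q \<xi> * (a \<bullet> x)) * truncated_image a \<xi>)"
    by (simp add: image_b_def truncated_image_def)
  also have "\<dots> = (\<Sum>\<xi>\<in>image_steps. g \<xi>)"
    by (intro sum.cong) (auto simp: image_steps_def g_def rate_image)
  also have "\<dots> = (\<Sum>\<xi>\<in>steps. g \<xi>)"
  proof (rule sum.mono_neutral_left[OF finite_steps])
    show "\<forall>\<xi>\<in>steps - image_steps. g \<xi> = 0"
    proof
      fix \<xi> assume "\<xi> \<in> steps - image_steps"
      then have "linear_image a \<xi> = 0" by (simp add: image_steps_def)
      then have "truncated_image a \<xi> = 0" by (simp only: truncated_image_def) (simp add: truncation_def)
      then show "g \<xi> = 0" by (simp add: g_def)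
    qed
  qed (auto simp: image_steps_def)
  also have "\<dots> = (\<Sum>\<xi>\<in>(\<lambda>y. y - x) ` (E - {x}). g \<xi>)"
  proof (rule sum.mono_neutral_right[OF finite_steps])
    show "(\<lambda>y. y - x) ` (E - {x}) \<subseteq> steps" using x step[of x] by force
    show "\<forall>\<xi>\<in>steps - (\<lambda>y. y - x) ` (E - {x}). g \<xi> = 0"
    proof
      fix \<xi> assume \<xi>: "\<xi> \<in> steps - (\<lambda>y. y - x) ` (E - {x})"
      have "\<xi> = 0 \<or> x + \<xi> \<notin> E"
      proof (rule ccontr)
        assume "\<not> ?thesis"
        then have "\<xi> \<in> (\<lambda>y. y - x) ` (E - {x})" by (intro image_eqI[of _ _ "x + \<xi>"]) auto
        then show False using \<xi> by simp
      qed
      then have "rate \<xi> x = 0" using rate_support[OF x, of \<xi>] by (auto simp: rate_0)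
      then show "g \<xi> = 0" by (simp add: g_def)
    qed
  qed
  also have "\<dots> = (\<Sum>y\<in>E - {x}. g (y - x))"
    by (subst sum.reindex) (auto simp: inj_on_def)
  also have "\<dots> = (\<Sum>y\<in>E - {x}. truncated_image a (y - x) * measure (kernel x) {y - x})"
    using kernel_singleton[OF x] by (simp add: g_def measure_def)
  finally show ?thesis .
qed

text \<open>The converse computation: it turns an algebraic property of the rates into an autonomous
  component, so that the absence of such components restricts the rates.\<close>

theorem affine_image_is_affine: "affine_image_is_affine Ft P E X (\<lambda>x. linear_image a x)"
  unfolding affine_image_is_affine_def affine_characteristics_def
proof (rule exI[of _ image_b], rule exI[of _ "\<lambda>_. 0"], rule exI[of _ image_F], intro conjI ballI allI)
  show "affine_map image_b" unfolding image_b_def[abs_def] by (rule affine_map_sum)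
  show "affine_map image_F" unfolding image_F_def[abs_def] by (rule affine_map_sum)
  show "affine_map (\<lambda>_ :: real^1. 0 :: real^1^1)" by (simp add: affine_map_def linear_zero)
  show "transpose (0 :: real^1^1) = 0" by (simp add: transpose_def vec_eq_iff)
  show "0 \<le> v \<bullet> ((0 :: real^1^1) *v v)" for v by simp
  show "levy_measure (image_F y)" if "y \<in> linear_image a ` E" for y
    using that levy_measure_image by blast
  fix R assume "R \<in> P ` E"
  then obtain x where x: "x \<in> E" "R = P x" by blast
  obtain \<nu> where "finite_jump_process M (P x) Ft X E kernel \<nu>" by (rule finite_jump_process[OF x(1)])
  then interpret finite_jump_process M R Ft X E kernel \<nu> by (simp add: x)
  show "\<exists>\<nu>. semimartingale_characteristics R Ft (\<lambda>t \<omega>. linear_image a (X t \<omega>))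
        (\<lambda>t \<omega>. LINT s:{0..t}|lborel. image_b (left_limit (\<lambda>t \<omega>. linear_image a (X t \<omega>)) s \<omega>))
        (\<lambda>t \<omega>. LINT s:{0..t}|lborel. (0 :: real^1^1)) \<nu> \<and>
        (\<forall>\<omega>\<in>space R. \<forall>A\<in>sets borel. emeasure (\<nu> \<omega>) A =
           (\<integral>\<^sup>+ t. emeasure (radon_measure_of (image_F (left_limit (\<lambda>t \<omega>. linear_image a (X t \<omega>)) t \<omega>)))
              {\<xi>. (t, \<xi>) \<in> A} * indicator {0..} t \<partial>lborel))"
  proof (intro exI[of _ "image_compensator a"] conjI ballI)
    show "semimartingale_characteristics R Ft (\<lambda>t \<omega>. linear_image a (X t \<omega>))
        (\<lambda>t \<omega>. LINT s:{0..t}|lborel. image_b (left_limit (\<lambda>t \<omega>. linear_image a (X t \<omega>)) s \<omega>))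
        (\<lambda>t \<omega>. LINT s:{0..t}|lborel. (0 :: real^1^1)) (image_compensator a)"
      by (rule semimartingale_characteristics_image[OF _ image_b_eq]) (use kernel_singleton in auto)
    fix \<omega> and A :: "(real \<times> (real^1)) set" assume "\<omega> \<in> space R" and A: "A \<in> sets borel"
    then have \<omega>: "\<omega> \<in> space M" by (simp add: space_Q)
    have "{\<xi>. (t, \<xi>) \<in> A} \<in> sets borel" for t
      using sets_Pair1[of A borel borel t] A by (simp add: borel_prod vimage_def)
    then show "emeasure (image_compensator a \<omega>) A =
           (\<integral>\<^sup>+ t. emeasure (radon_measure_of (image_F (left_limit (\<lambda>t \<omega>. linear_image a (X t \<omega>)) t \<omega>)))
              {\<xi>. (t, \<xi>) \<in> A} * indicator {0..} t \<partial>lborel)"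
      unfolding emeasure_image_compensator[OF \<omega> A] left_limit_image[OF \<omega>]
        radon_measure_of_image[OF left_limit_in_E[OF \<omega>]]
      by (simp add: image_measure_eq[OF left_limit_in_E[OF \<omega>]])
  qed
qed

end

end


theorem theorem2p5:
  fixes M :: "'w measure" and Ft :: "real \<Rightarrow> 'w measure" and P :: "real^2 \<Rightarrow> 'w measure"
    and E :: "(real^2) set" and X :: "real \<Rightarrow> 'w \<Rightarrow> real^2"
    and b :: "real^2 \<Rightarrow> real^2" and c :: "real^2 \<Rightarrow> real^2^2"
    and F :: "real^2 \<Rightarrow> (real^2) signed_radon"
  assumes "affine_process M Ft P E X b c F"
    and "finite E"
    and "irreducible_state_space M P E X"
    and "affine hull E = UNIV"
    and "\<And>a1 a2 :: real. (a1, a2) \<noteq> (0, 0) \<Longrightarrow>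
           \<not> affine_image_is_affine Ft P E X (\<lambda>x. vec (a1 * x $ 1 + a2 * x $ 2) :: real^1)"
  shows "\<exists>(T :: real^2 \<Rightarrow> real^2) (N :: nat)
            (l1 :: real) (l2 :: real) (l3 :: real) (l4 :: real) (l5 :: real) (l6 :: real).
           affine_map T \<and> bij T \<and>
           0 \<le> l1 \<and> 0 \<le> l2 \<and> 0 \<le> l3 \<and> 0 \<le> l4 \<and> 0 \<le> l5 \<and> 0 \<le> l6 \<and>
           T ` E = {x. x $ 1 \<in> \<nat> \<and> x $ 2 \<in> \<nat> \<and> x $ 1 + x $ 2 \<le> real N} \<and>
           (\<forall>x \<in> T ` E. \<forall>B \<in> sets borel.
              emeasure (transformed_kernel T F x) B = ennreal
                (x $ 1 * (l1 * measure (return borel (vector [-1, 0])) B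
                        + l2 * measure (return borel (vector [-1, 1])) B)
               + x $ 2 * (l3 * measure (return borel (vector [0, -1])) B
                        + l4 * measure (return borel (vector [1, -1])) B)
               + (real N - x $ 1 - x $ 2)
                       * (l5 * measure (return borel (vector [1, 0])) B
                        + l6 * measure (return borel (vector [0, 1])) B)))"
proof -
  interpret finite_affine_process M Ft P E X b c F
    using assms(1,2) by unfold_locales
  \<comment> \<open>A direction violating this would supply coefficient functions \<open>p\<close>
    and \<open>q\<close>, and its linear functional would be an affine process.\<close>
  have no_autonomous: "\<exists>\<xi>. a \<bullet> \<xi> \<noteq> 0 \<and> \<not> (\<exists>p q. \<forall>x. rate \<xi> x = p + q * (a \<bullet> x))" if "a \<noteq> 0" for a
  proof (rule ccontr)
    assume "\<not> ?thesis"
    then have "\<forall>\<xi>. \<exists>p q. a \<bullet> \<xi> \<noteq> 0 \<longrightarrow> (\<forall>x. rate \<xi> x = p + q * (a \<bullet> x))" by blast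
    then obtain p q where "\<And>\<xi> x. a \<bullet> \<xi> \<noteq> 0 \<Longrightarrow> rate \<xi> x = p \<xi> + q \<xi> * (a \<bullet> x)" by metis
    then have "affine_image_is_affine Ft P E X (\<lambda>x. linear_image a x)"
      by (rule affine_image_is_affine)
    moreover have "(a $ 1, a $ 2) \<noteq> (0, 0)" using that by (auto simp: vec2_eq_iff)
    ultimately show False using assms(5)[of "a $ 1" "a $ 2"]
      by (simp add: linear_image_def[abs_def] inner_vec2)
  qed
  interpret rates: affine_rates E rate rate_gradient
    by unfold_locales
      (use assms(2,4) rate_affine rate_nonneg rate_support rate_0 no_autonomous
        exists_decreasing_jump[OF assms(3,4)] in blast)+
  obtain k :: "real^2" and L :: "real^2 \<Rightarrow> real^2" and N :: nat and l :: "real^2 \<Rightarrow> real"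
    where "linear L" "inj L" and l: "\<And>v. 0 \<le> l v"
      and image: "(\<lambda>x. k + L x) ` E = {x. x $ 1 \<in> \<nat> \<and> x $ 2 \<in> \<nat> \<and> x $ 1 + x $ 2 \<le> real N}"
      and formula: "\<And>\<xi> x. rate \<xi> x = particle_rate l N (k + L x) (L \<xi>)"
    by (rule rates.classification) (rule that; assumption)
  define T where "T x = k + L x" for x
  have L: "L x = T x - T 0" for x by (simp add: T_def linear_0[OF \<open>linear L\<close>])
  have "affine_map T" using \<open>linear L\<close> by (simp add: affine_map_def L[symmetric])
  have "bij L"
    using \<open>inj L\<close> linear_injective_imp_surjective[OF \<open>linear L\<close>] by (simp add: bij_def)
  have "bij T"
  proof -
    have "bij ((\<lambda>y. k + y) \<circ> L)" by (intro bij_comp \<open>bij L\<close> bij_plus)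
    moreover have "(\<lambda>y. k + y) \<circ> L = T" by (simp add: fun_eq_iff T_def)
    ultimately show ?thesis by simp
  qed
  have kernel_formula: "emeasure (transformed_kernel T F y) B = ennreal
      (y $ 1 * (l (vector [-1, 0]) * measure (return borel (vector [-1, 0])) B
              + l (vector [-1, 1]) * measure (return borel (vector [-1, 1])) B)
     + y $ 2 * (l (vector [0, -1]) * measure (return borel (vector [0, -1])) B
              + l (vector [1, -1]) * measure (return borel (vector [1, -1])) B)
     + (real N - y $ 1 - y $ 2)
             * (l (vector [1, 0]) * measure (return borel (vector [1, 0])) B
              + l (vector [0, 1]) * measure (return borel (vector [0, 1])) B))"
    if y: "y \<in> T ` E" and B: "B \<in> sets borel" for y B
  proof -
    obtain x where x: "x \<in> E" and y: "y = T x" using y by blast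
    \<comment> \<open>The six type changes of a particle in the new coordinates;
      \<open>particle_rate\<close> vanishes on all other vectors.\<close>
    define V :: "(real^2) set" where
      "V = {vector [-1, 0], vector [-1, 1], vector [0, -1], vector [1, -1], vector [1, 0], vector [0, 1]}"
    have L_meas: "L \<in> borel_measurable borel"
      using \<open>linear L\<close> by (intro borel_measurable_continuous_onI linear_continuous_on linear_conv_bounded_linear[THEN iffD1])
    then have LB: "L -` B \<in> sets borel" using measurable_sets[OF L_meas B] by simp
    have "emeasure (transformed_kernel T F y) B = emeasure (distr (kernel x) borel L) B"
      using \<open>bij T\<close> by (simp add: transformed_kernel_def kernel_def bij_is_inj L[symmetric] y)
    also have "\<dots> = emeasure (kernel x) (L -` B \<inter> space (kernel x))"
      using B L_meas by (intro emeasure_distr) (simp_all add: sets_kernel[OF x] cong: measurable_cong_sets)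
    also have "L -` B \<inter> space (kernel x) = L -` B" using sets_eq_imp_space_eq[OF sets_kernel[OF x]] by simp
    also have "emeasure (kernel x) (L -` B) = ennreal (\<Sum>\<xi>\<in>steps. rate \<xi> x * indicator (L -` B) \<xi>)"
      by (rule kernel_eq[OF x LB])
    \<comment> \<open>Neither index set need contain the other. Outside the preimage of
      \<open>V\<close> the rate vanishes by \<open>formula\<close>, outside \<open>steps\<close> it
      vanishes by \<open>rate_support\<close>.\<close>
    also have "(\<Sum>\<xi>\<in>steps. rate \<xi> x * indicator (L -` B) \<xi>)
        = (\<Sum>\<xi>\<in>inv L ` V. rate \<xi> x * indicator (L -` B) \<xi>)"
    proof (rule sum.mono_neutral_cong)
      show "rate \<xi> x * indicator (L -` B) \<xi> = 0" if "\<xi> \<in> steps - inv L ` V" for \<xi>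
      proof -
        have "L \<xi> \<notin> V"
        proof
          assume "L \<xi> \<in> V"
          then have "inv L (L \<xi>) \<in> inv L ` V" by (rule imageI)
          then show False using that \<open>inj L\<close> by simp
        qed
        then show ?thesis by (simp add: formula particle_rate_def V_def)
      qed
      show "rate \<xi> x * indicator (L -` B) \<xi> = 0" if "\<xi> \<in> inv L ` V - steps" for \<xi>
        using that rate_support[OF x, of \<xi>] step[OF x, of \<xi>] by auto
    qed (simp_all add: finite_steps V_def)
    also have "\<dots> = (\<Sum>v\<in>V. particle_rate l N y v * indicator B v)"
    proof (subst sum.reindex)
      show "inj_on (inv L) V"
        using bij_is_inj[OF bij_imp_bij_inv[OF \<open>bij L\<close>]] by (rule inj_on_subset) simp
      show "sum ((\<lambda>\<xi>. rate \<xi> x * indicator (L -` B) \<xi>) \<circ> inv L) V = (\<Sum>v\<in>V. particle_rate l N y v * indicator B v)"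
        by (intro sum.cong refl)
          (simp add: formula y T_def surj_f_inv_f[OF bij_is_surj[OF \<open>bij L\<close>]] indicator_def)
    qed
    also have "\<dots> = y $ 1 * (l (vector [-1, 0]) * indicator B (vector [-1, 0]) + l (vector [-1, 1]) * indicator B (vector [-1, 1]))
        + y $ 2 * (l (vector [0, -1]) * indicator B (vector [0, -1]) + l (vector [1, -1]) * indicator B (vector [1, -1]))
        + (real N - y $ 1 - y $ 2)
          * (l (vector [1, 0]) * indicator B (vector [1, 0]) + l (vector [0, 1]) * indicator B (vector [0, 1]))"
      by (simp add: V_def particle_rate_def vec2_eq_iff algebra_simps)
    finally show ?thesis using B by (simp add: measure_return)
  qed
  have "T ` E = {x. x $ 1 \<in> \<nat> \<and> x $ 2 \<in> \<nat> \<and> x $ 1 + x $ 2 \<le> real N}"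
    using image unfolding T_def[abs_def] .
  then show ?thesis
    using \<open>affine_map T\<close> \<open>bij T\<close> l kernel_formula
    by - (rule exI[of _ T], rule exI[of _ N], rule exI[of _ "l (vector [-1, 0])"],
      rule exI[of _ "l (vector [-1, 1])"], rule exI[of _ "l (vector [0, -1])"],
      rule exI[of _ "l (vector [1, -1])"], rule exI[of _ "l (vector [1, 0])"],
      rule exI[of _ "l (vector [0, 1])"], intro conjI ballI)
qed

end
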